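(* Let $\ell \geq 2$ be a prime and $Z > 0$. Then for all squarefree integers $d > 1$ with $|\pi_d(Z)| > 0$, $$|\mathrm{Cl}_d[\ell]| \ll \frac{d^{1/2} \log d}{|\pi_d(Z)|} + \frac{d^{1/2} \log d}{|\pi_d(Z)|^2} \cdot |S_\ell(d, Z)|,$$ where the implied constant is absolute.
   Context: For squarefree $d>1$, let $K=\mathbb{Q}(\sqrt{d})$, $O_d$ its ring of integers, $\mathrm{Cl}_d$ its ideal class group, $\mathrm{Cl}_d[\ell]$ its $\ell$-torsion subgroup, and $\sigma$ the non-trivial element of $\mathrm{Gal}(K/\mathbb{Q})$. Let $\pi_d(Z)$ be the set of prime ideals $\mathfrak{p}$ of $O_d$ with ramification index $1$ and residue field degree $1$ over $\mathbb{Q}$ and with $N_{K/\mathbb{Q}}(\mathfrak{p}) \leq Z$. Define $$S_\ell(d, Z) := \left\{\beta = u + v \sqrt{d} \in O_d : |u| \leq 2e^{3/2} Z^\ell,\ |v| \leq 2e^{3/2} Z^\ell d^{-1/2},\ \beta O_d = (\mathfrak{p}_1 \sigma(\mathfrak{p}_2))^{\ell} \text{ for some distinct } \mathfrak{p}_1, \mathfrak{p}_2 \in \pi_d(Z)\right\}$$ (here $u,v$ are rationals, with $\beta=u+v\sqrt d$ the unique such representation). *)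

theory Defs
  imports
    "HOL-Analysis.Analysis"
    "HOL-Algebra.Embedded_Algebras"
    "HOL-Algebra.Ideal_Product"
    "HOL-Algebra.QuotRing"
    "HOL-Computational_Algebra.Squarefree"
begin

definition quad_set :: "int \<Rightarrow> real set" where
  "quad_set d = {u + v * sqrt (real_of_int d) | u v. u \<in> \<rat> \<and> v \<in> \<rat>}"

definition quad_field :: "int \<Rightarrow> real ring" where
  "quad_field d = \<lparr>carrier = quad_set d, monoid.mult = (*), one = 1, ring.zero = 0, add = (+)\<rparr>"

definition ring_of_integers :: "int \<Rightarrow> real ring" where
  "ring_of_integers d = (quad_field d)\<lparr>carrier := {x \<in> quad_set d. algebraic_int x}\<rparr>"

text \<open>The maps are extensional (\<^const>\<open>undefined\<close> off the field), so that distinct elements of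
  this set are distinct automorphisms.\<close>

definition Gal :: "int \<Rightarrow> (real \<Rightarrow> real) set" where
  "Gal d = {f \<in> ring_iso (quad_field d) (quad_field d) \<inter> extensional (quad_set d). \<forall>q\<in>\<rat>. f q = q}"

definition sigma :: "int \<Rightarrow> real \<Rightarrow> real" where
  "sigma d = (THE f. f \<in> Gal d \<and> f \<noteq> (\<lambda>x\<in>quad_set d. x))"

lemma sqrt_squarefree_irrational:
  fixes d :: int
  assumes "squarefree d" "d > 1"
  shows "sqrt (real_of_int d) \<notin> \<rat>"
proof
  assume "sqrt (real_of_int d) \<in> \<rat>"
  moreover have "algebraic_int (sqrt (real_of_int d))"
  proof (rule algebraic_int.intros)
    show "lead_coeff [:- real_of_int d, 0, 1:] = 1" by simp
    show "\<forall>i. Polynomial.coeff [:- real_of_int d, 0, 1:] i \<in> \<int>"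
      by (auto simp: coeff_pCons split: nat.splits)
    show "poly [:- real_of_int d, 0, 1:] (sqrt (real_of_int d)) = 0"
      using assms by simp
  qed
  ultimately have "sqrt (real_of_int d) \<in> \<int>"
    using rational_algebraic_int_is_int by blast
  then obtain n where n: "sqrt (real_of_int d) = real_of_int n"
    by (auto elim: Ints_cases)
  have "real_of_int d = (sqrt (real_of_int d))\<^sup>2"
    using assms by simp
  also have "\<dots> = real_of_int (n\<^sup>2)"
    unfolding n by simp
  finally have dn: "d = n\<^sup>2"
    by (rule of_int_eq_iff[THEN iffD1])
  then have "n dvd 1"
    using assms(1) unfolding squarefree_def by auto
  then have "d dvd 1"
    unfolding dn by (rule is_unit_power_iff[THEN iffD2, OF disjI1])
  then show False using assms(2) by auto
qed

lemma quad_coords_unique: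
  fixes d :: int
  assumes "squarefree d" "d > 1" "u \<in> \<rat>" "v \<in> \<rat>" "u' \<in> \<rat>" "v' \<in> \<rat>"
    and eq: "u + v * sqrt (real_of_int d) = u' + v' * sqrt (real_of_int d)"
  shows "u = u' \<and> v = v'"
proof -
  have "v = v'"
  proof (rule ccontr)
    assume "v \<noteq> v'"
    then have "sqrt (real_of_int d) = (u - u') / (v' - v)"
      using eq by (simp add: field_simps)
    then show False
      using sqrt_squarefree_irrational[OF assms(1,2)] assms(3-6) by simp
  qed
  then show ?thesis using eq by simp
qed

lemma sigma_eq:
  fixes d :: int
  assumes d: "squarefree d" "d > 1" and uv: "u \<in> \<rat>" "v \<in> \<rat>"
  shows "sigma d (u + v * sqrt (real_of_int d)) = u - v * sqrt (real_of_int d)"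
proof -
  define s where "s = sqrt (real_of_int d)"
  have ss: "s * s = real_of_int d" using d by (simp add: s_def)
  have sirr: "s \<notin> \<rat>" using sqrt_squarefree_irrational[OF d] by (simp add: s_def)
  have Q: "quad_set d = {u + v * s | u v. u \<in> \<rat> \<and> v \<in> \<rat>}"
    by (simp add: quad_set_def s_def)
  have inQ: "a + b * s \<in> quad_set d" if "a \<in> \<rat>" "b \<in> \<rat>" for a b
    using that by (auto simp: Q)
  have uniq: "a = a' \<and> b = b'" if "a \<in> \<rat>" "b \<in> \<rat>" "a' \<in> \<rat>" "b' \<in> \<rat>" "a + b * s = a' + b' * s" for a b a' b'
    using quad_coords_unique[OF d that(1-4)] that(5) by (simp add: s_def)
  define c where "c = restrict (\<lambda>x. THE y. \<exists>a\<in>\<rat>. \<exists>b\<in>\<rat>. x = a + b * s \<and> y = a - b * s) (quad_set d)"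
  have c: "c (a + b * s) = a - b * s" if "a \<in> \<rat>" "b \<in> \<rat>" for a b
  proof -
    have "(THE y. \<exists>a'\<in>\<rat>. \<exists>b'\<in>\<rat>. a + b * s = a' + b' * s \<and> y = a' - b' * s) = a - b * s"
      using that uniq by (intro the_equality) (blast, metis)
    then show ?thesis using inQ[OF that] by (simp add: c_def)
  qed
  have ring: "carrier (quad_field d) = quad_set d" "x \<otimes>\<^bsub>quad_field d\<^esub> y = x * y"
    "x \<oplus>\<^bsub>quad_field d\<^esub> y = x + y" "\<one>\<^bsub>quad_field d\<^esub> = 1" for x y
    by (simp_all add: quad_field_def)
  have cQ: "c x \<in> quad_set d" and cc: "c (c x) = x" if x: "x \<in> quad_set d" for x
  proof -
    from x obtain a b where ab: "a \<in> \<rat>" "b \<in> \<rat>" "x = a + b * s" by (auto simp: Q)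
    have 1: "c x = a + (- b) * s" using c[OF ab(1,2)] ab(3) by simp
    show "c x \<in> quad_set d" unfolding 1 using inQ ab by (meson Rats_minus_iff)
    show "c (c x) = x" unfolding 1 using c[of a "- b"] ab by simp
  qed
  have "c \<in> ring_iso (quad_field d) (quad_field d)"
  proof (rule ring_iso_memI; unfold ring)
    fix x y assume "x \<in> quad_set d" "y \<in> quad_set d"
    then obtain a b a' b' where ab: "a \<in> \<rat>" "b \<in> \<rat>" "x = a + b * s" "a' \<in> \<rat>" "b' \<in> \<rat>" "y = a' + b' * s"
      by (auto simp: Q)
    have m: "x * y = (a * a' + b * b' * real_of_int d) + (a * b' + b * a') * s"
      unfolding ab ss[symmetric] by (simp add: algebra_simps)
    have "c (x * y) = (a * a' + b * b' * real_of_int d) - (a * b' + b * a') * s"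
      unfolding m using ab by (intro c) auto
    also have "\<dots> = (a - b * s) * (a' - b' * s)" unfolding ss[symmetric] by (simp add: algebra_simps)
    finally show "c (x * y) = c x * c y" using c ab by simp
    have p: "x + y = (a + a') + (b + b') * s"
      unfolding ab by (simp add: algebra_simps)
    have "c (x + y) = (a + a') - (b + b') * s"
      unfolding p using ab by (intro c) auto
    also have "\<dots> = (a - b * s) + (a' - b' * s)" by (simp add: algebra_simps)
    finally show "c (x + y) = c x + c y" using c ab by simp
  next
    show "c 1 = 1" using c[of 1 0] by simp
    show "bij_betw c (quad_set d) (quad_set d)"
    proof (rule bij_betw_byWitness)
      show "\<forall>x\<in>quad_set d. c (c x) = x" "\<forall>x\<in>quad_set d. c (c x) = x"
        using cc by blast+
      show "c ` quad_set d \<subseteq> quad_set d" "c ` quad_set d \<subseteq> quad_set d"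
        using cQ by blast+
    qed
  qed (use cQ in auto)
  moreover have "c q = q" if "q \<in> \<rat>" for q using c[of q 0] that by simp
  ultimately have cG: "c \<in> Gal d" by (auto simp: Gal_def c_def)
  have cne: "c \<noteq> (\<lambda>x\<in>quad_set d. x)"
  proof
    assume "c = (\<lambda>x\<in>quad_set d. x)"
    then have "c (0 + 1 * s) = 0 + 1 * s" using inQ[of 0 1] by simp
    moreover have "c (0 + 1 * s) = 0 - 1 * s" by (intro c) auto
    ultimately have "s = 0" by simp
    then show False using sirr by simp
  qed
  have "f = c" if f: "f \<in> Gal d" "f \<noteq> (\<lambda>x\<in>quad_set d. x)" for f
  proof -
    have hom: "f (x * y) = f x * f y" "f (x + y) = f x + f y"
      if "x \<in> quad_set d" "y \<in> quad_set d" for x y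
      using f(1) that ring_iso_memE(2,3)[of f "quad_field d" "quad_field d" x y] by (auto simp: Gal_def ring)
    have fq: "f q = q" if "q \<in> \<rat>" for q using f(1) that by (auto simp: Gal_def)
    have qQ: "q \<in> quad_set d" if "q \<in> \<rat>" for q using inQ[of q 0] that by simp
    have sQ: "s \<in> quad_set d" using inQ[of 0 1] by simp
    have fab: "f (a + b * s) = a + b * f s" if "a \<in> \<rat>" "b \<in> \<rat>" for a b
    proof -
      have "b * s \<in> quad_set d" using inQ[of 0 b] that by simp
      then have "f (a + b * s) = f a + f (b * s)" by (rule hom(2)[OF qQ[OF that(1)]])
      also have "f (b * s) = f b * f s" by (rule hom(1)[OF qQ[OF that(2)] sQ])
      finally show ?thesis by (simp only: fq[OF that(1)] fq[OF that(2)])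
    qed
    have "f s * f s = s * s"
      using hom(1)[OF sQ sQ] fq[OF Rats_of_int, of d] unfolding ss by (rule trans[OF sym])
    then have "f s = s \<or> f s = - s" by (rule square_eq_iff[THEN iffD1])
    moreover have "f s \<noteq> s"
    proof
      assume "f s = s"
      then have "f x = x" if "x \<in> quad_set d" for x using fab that by (auto simp: Q)
      then have "f = (\<lambda>x\<in>quad_set d. x)"
        using f(1) by (intro extensionalityI[of _ "quad_set d"]) (auto simp: Gal_def)
      then show False using f(2) by simp
    qed
    ultimately have "f s = - s" by simp
    then have fc: "f x = c x" if "x \<in> quad_set d" for x using fab c that by (auto simp: Q)
    have "f \<in> extensional (quad_set d)" "c \<in> extensional (quad_set d)"
      using f(1) cG unfolding Gal_def by blast+
    then show "f = c"
      using fc by (rule extensionalityI)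
  qed
  then have "sigma d = c"
    unfolding sigma_def using cG cne by (intro the_equality) blast+
  then show ?thesis using c[OF uv] unfolding s_def by (simp only:)
qed

definition prime_below :: "real set \<Rightarrow> nat" where
  "prime_below P = (THE p. prime p \<and> {n::int. real_of_int n \<in> P} = {n. int p dvd n})"

text \<open>The exponent of \<open>P\<close> in the factorisation of the ideal generated by the rational prime below
  \<open>P\<close>, i.e. the largest \<open>e\<close> such that the \<open>e\<close>-th power of \<open>P\<close> divides that ideal.\<close>

definition ramification_index :: "int \<Rightarrow> real set \<Rightarrow> nat" where
  "ramification_index d P =
     (GREATEST e. \<exists>J. ideal J (ring_of_integers d) \<and>
        PIdl\<^bsub>ring_of_integers d\<^esub> (real (prime_below P)) =
          (P [^]\<^bsub>ideals_set (ring_of_integers d)\<^esub> e) \<cdot>\<^bsub>ring_of_integers d\<^esub> J)"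

text \<open>The image of the integers in the residue ring is the prime field of \<open>p\<close> elements, where
  \<open>p\<close> is the rational prime below \<open>P\<close>.\<close>

definition residue_degree :: "int \<Rightarrow> real set \<Rightarrow> nat" where
  "residue_degree d P =
     ring.dim (ring_of_integers d Quot P)
       (range (\<lambda>n::int. P +>\<^bsub>ring_of_integers d\<^esub> real_of_int n))
       (carrier (ring_of_integers d Quot P))"

definition ideal_norm :: "int \<Rightarrow> real set \<Rightarrow> nat" where
  "ideal_norm d I = card (carrier (ring_of_integers d Quot I))"

definition split_primes :: "int \<Rightarrow> real \<Rightarrow> real set set" where
  "split_primes d Z = {P. primeideal P (ring_of_integers d) \<and> P \<noteq> {0} \<and>
     ramification_index d P = 1 \<and> residue_degree d P = 1 \<and> real (ideal_norm d P) \<le> Z}"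

definition fractional_ideal :: "int \<Rightarrow> real set \<Rightarrow> bool" where
  "fractional_ideal d I \<longleftrightarrow>
     additive_subgroup I (quad_field d) \<and> I \<noteq> {0} \<and>
     (\<forall>a\<in>carrier (ring_of_integers d). \<forall>x\<in>I. a * x \<in> I) \<and>
     (\<exists>a\<in>carrier (ring_of_integers d). a \<noteq> 0 \<and> (\<forall>x\<in>I. a * x \<in> carrier (ring_of_integers d)))"

text \<open>\<^const>\<open>ideal_prod\<close> of the field is the additive closure of the set of products, hence also
  the product of fractional ideals.\<close>

definition fractional_ideal_group :: "int \<Rightarrow> real set monoid" where
  "fractional_ideal_group d =
     \<lparr>carrier = {I. fractional_ideal d I},
      monoid.mult = ideal_prod (quad_field d),
      one = carrier (ring_of_integers d)\<rparr>"

definition principal_fractional_ideals :: "int \<Rightarrow> real set set" where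
  "principal_fractional_ideals d =
     {(\<lambda>a. x * a) ` carrier (ring_of_integers d) | x. x \<in> quad_set d \<and> x \<noteq> 0}"

definition class_group :: "int \<Rightarrow> real set set monoid" where
  "class_group d = fractional_ideal_group d Mod principal_fractional_ideals d"

definition torsion :: "nat \<Rightarrow> ('a, 'b) monoid_scheme \<Rightarrow> 'a set" where
  "torsion l G = {c \<in> carrier G. c [^]\<^bsub>G\<^esub> l = \<one>\<^bsub>G\<^esub>}"

definition S_set :: "nat \<Rightarrow> int \<Rightarrow> real \<Rightarrow> real set" where
  "S_set l d Z =
     {\<beta> \<in> carrier (ring_of_integers d).
        (\<exists>u\<in>\<rat>. \<exists>v\<in>\<rat>. \<beta> = u + v * sqrt (real_of_int d) \<and>
           \<bar>u\<bar> \<le> 2 * exp (3/2) * Z ^ l \<and>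
           \<bar>v\<bar> \<le> 2 * exp (3/2) * Z ^ l * real_of_int d powr (-1/2)) \<and>
        (\<exists>P1\<in>split_primes d Z. \<exists>P2\<in>split_primes d Z. P1 \<noteq> P2 \<and>
           PIdl\<^bsub>ring_of_integers d\<^esub> \<beta> =
             (P1 \<cdot>\<^bsub>ring_of_integers d\<^esub> (sigma d ` P2)) [^]\<^bsub>ideals_set (ring_of_integers d)\<^esub> l)}"

end

theory Submission
  imports Defs
begin

text \<open>
  Neither the regulator nor the class number formula is needed. Every nonzero integral ideal \<open>I\<close> contains, by
  the pigeonhole principle, some \<open>\<alpha> \<noteq> 0\<close> with \<open>\<bar>\<alpha>\<bar>\<close> and \<open>\<bar>\<sigma> \<alpha>\<bar>\<close> at most \<open>2 \<surd>(N(I) \<surd>d)\<close>, so \<open>J = \<alpha> I\<inverse>\<close> is integral of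
  norm at most \<open>4 \<surd>d\<close>. The pair of \<open>J\<close> and \<open>\<lfloor>ln (\<bar>\<alpha>\<bar> / \<surd>N(I))\<rfloor>\<close> is the cell of \<open>I\<close>. There are \<open>O(\<surd>d log d)\<close> cells, because
  the number of primitive ideals of norm \<open>a\<close> is at most the number of divisors of \<open>a\<close>.

  Let \<open>T\<close> represent the classes modulo \<open>\<ell>\<close>-th powers, so that \<open>T\<close> has as many elements as the \<open>\<ell>\<close>-torsion.
  Send \<open>(c, P)\<close>, for \<open>c \<in> T\<close> and a split prime \<open>P\<close>, to the cell of \<open>P\<^sup>\<ell> I\<^sub>c\<close>. If \<open>(c, P)\<close> and \<open>(c', P')\<close> share a cell, then
  \<open>c = c'\<close> and \<open>(P \<sigma>(P'))\<^sup>\<ell>\<close> is generated by \<open>\<beta> = (\<alpha> / \<alpha>') N(P')\<^sup>\<ell>\<close>, whose two conjugates are at most \<open>e Z\<^sup>\<ell>\<close>; for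
  \<open>P \<noteq> P'\<close> such a \<open>\<beta>\<close> is counted by \<open>S\<close>, and each \<open>\<beta>\<close> arises from at most four pairs. The Cauchy-Schwarz inequality
  bounds the number of collisions from below.
\<close>

section \<open>The ring of integers\<close>

text \<open>The form of a cell answers two difficulties. An ideal fixes a generator only up to the
  infinite unit group, so equality of the ideals \<open>J\<close> alone bounds no conjugate of
  \<beta>. But the two sizes \<bar>\<alpha>\<bar> and \<bar>\<sigma> \<alpha>\<bar>, each divided by
  \<surd>N(I), multiply to the norm of \<open>J\<close>; hence one logarithm, known to within 1,
  controls both up to a factor e. Secondly, the divisor bound already allows about X log X ideals of
  norm at most X = 4 \<surd>d, so a further factor log X for the logarithmic coordinate would be too
  much. As both sizes are at most \<surd>X, the interval belonging to norm m has length ln (X / m)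
  only, which is bounded on average; replacing it by a multiple of \<surd>(X / m) keeps the sum at X
  log X.

  The arithmetic rests on I \<sigma>(I) being generated by the integer N(I): this yields inverses,
  multiplicativity of the norm and integrality of \<open>J\<close>.\<close>

lemma poly_of_int_pCons:
  "poly (map_poly of_int (pCons a p)) (x :: real) = of_int a + x * poly (map_poly of_int p) x"
  by (simp add: map_poly_pCons)

lemma poly_of_int_add:
  "poly (map_poly of_int (p + q)) (x :: real) = poly (map_poly of_int p) x + poly (map_poly of_int q) x"
  by (induction p q rule: poly_induct2) (simp_all add: poly_of_int_pCons algebra_simps)

lemma poly_of_int_smult:
  "poly (map_poly of_int (Polynomial.smult c p)) (x :: real) = of_int c * poly (map_poly of_int p) x"
  by (induction p) (simp_all add: poly_of_int_pCons algebra_simps)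

lemma poly_of_int_mult:
  "poly (map_poly of_int (p * q)) (x :: real) = poly (map_poly of_int p) x * poly (map_poly of_int q) x"
  by (induction p)
    (simp_all add: poly_of_int_add poly_of_int_smult poly_of_int_pCons algebra_simps)

lemma degree_le_1_conv: "degree p \<le> 1 \<Longrightarrow> p = [:Polynomial.coeff p 0, Polynomial.coeff p 1:]"
  by (rule poly_eqI) (auto simp: coeff_pCons coeff_eq_0 split: nat.splits)

text \<open>Gauss's lemma. Pseudo-division of a monic annihilator of \<open>x\<close> by
  \<open>q\<close> leaves a remainder of degree at most 1, which must be zero because
  \<open>x\<close> is irrational. Comparing contents and leading coefficients in
  \<open>smult a p = q * f\<close> then makes the leading coefficient of \<open>q\<close> a
  unit.\<close>

lemma int_quadratic_algebraic_int_lead_coeff: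
  fixes x :: real and q :: "int poly"
  assumes x: "x \<notin> \<rat>" "algebraic_int x"
    and q: "poly (map_poly of_int q) x = 0" "degree q = 2" "Polynomial.content q = 1"
  shows "\<bar>lead_coeff q\<bar> = 1"
proof -
  obtain p :: "int poly" where p: "poly (map_poly of_int p) x = 0" "lead_coeff p = 1"
    using x(2) by (auto simp: algebraic_int_altdef_ipoly)
  have q0: "q \<noteq> 0" using q(2) by auto
  define r where "r = pseudo_mod p q"
  obtain a f where af: "a \<noteq> 0" "Polynomial.smult a p = q * f + r"
    using pseudo_mod(1)[OF q0, of p] r_def by blast
  have "degree r \<le> 1"
    using pseudo_mod(2)[OF q0, of p] q(2) r_def by auto
  then have rr: "r = [:Polynomial.coeff r 0, Polynomial.coeff r 1:]" by (rule degree_le_1_conv)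
  have "poly (map_poly of_int (Polynomial.smult a p)) x = poly (map_poly of_int r) x"
    using q(1) by (simp add: af(2) poly_of_int_add poly_of_int_mult)
  then have "poly (map_poly of_int r) x = 0" using p(1) by (simp add: poly_of_int_smult)
  moreover have "poly (map_poly of_int r) x = of_int (Polynomial.coeff r 0) + x * of_int (Polynomial.coeff r 1)"
    by (subst rr) (simp add: poly_of_int_pCons)
  ultimately have e: "of_int (Polynomial.coeff r 0) + x * of_int (Polynomial.coeff r 1) = 0" by simp
  have "Polynomial.coeff r 1 = 0"
  proof (rule ccontr)
    assume "Polynomial.coeff r 1 \<noteq> 0"
    then have "x = - of_int (Polynomial.coeff r 0) / of_int (Polynomial.coeff r 1)"
      using e by (simp add: field_simps)
    then show False using x(1) by simp
  qed
  with e have "Polynomial.coeff r 0 = 0" by simp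
  with \<open>Polynomial.coeff r 1 = 0\<close> rr have "r = 0" by simp
  with af have eq: "Polynomial.smult a p = q * f" by simp
  have "Polynomial.content p dvd lead_coeff p" by (rule content_dvd_coeff)
  then have "Polynomial.content p = 1" using p(2) normalize_content[of p] by (metis is_unit_normalize)
  then have "Polynomial.content f = \<bar>a\<bar>"
    using arg_cong[OF eq, of Polynomial.content] q(3) by (simp add: content_mult)
  then have "a dvd lead_coeff f" using content_dvd_coeff[of f "degree f"] by simp
  moreover have "a = lead_coeff q * lead_coeff f"
    using arg_cong[OF eq, of lead_coeff] p(2) af(1) by (simp add: lead_coeff_mult)
  ultimately have "lead_coeff q * lead_coeff f dvd 1 * lead_coeff f" "lead_coeff f \<noteq> 0"
    using af(1) by auto
  then have "lead_coeff q dvd 1" using dvd_mult_cancel_right by blast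
  then show ?thesis by simp
qed

text \<open>Clear denominators and pass to the primitive part \<open>q\<close>. Its leading
  coefficient is 1 or -1 by Gauss's lemma, so dividing by it exhibits \<open>T\<close> and
  \<open>N\<close> as integers.\<close>

lemma algebraic_int_quadratic_coeffs:
  fixes x T N :: real
  assumes x: "x \<notin> \<rat>" "algebraic_int x" and T: "T \<in> \<rat>" "N \<in> \<rat>"
    and eq: "x\<^sup>2 - T * x + N = 0"
  shows "T \<in> \<int> \<and> N \<in> \<int>"
proof -
  obtain a b where ab: "T = of_int a / of_int b" "b > 0"
    by (rule Rats_cases'[OF T(1)]) blast
  obtain c e where ce: "N = of_int c / of_int e" "e > 0"
    by (rule Rats_cases'[OF T(2)]) blast
  define q0 where "q0 = [:c * b, - a * e, b * e:]"
  define q where "q = primitive_part q0"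
  have q0: "q0 \<noteq> 0" "degree q0 = 2" using ab ce by (auto simp: q0_def)
  have sq: "q0 = Polynomial.smult (Polynomial.content q0) q" by (simp add: q_def)
  have "poly (map_poly of_int q0) x = of_int b * of_int e * (x\<^sup>2 - T * x + N)"
    using ab ce by (simp add: q0_def poly_of_int_pCons field_simps power2_eq_square)
  then have "of_int (Polynomial.content q0) * poly (map_poly of_int q) x = 0"
    using eq sq poly_of_int_smult by (metis mult_zero_right)
  then have 1: "poly (map_poly of_int q) x = 0" using q0(1) by simp
  have dq: "degree q = 2" using q0 by (simp add: q_def)
  have "Polynomial.content q = 1" using q0 by (simp add: q_def)
  from int_quadratic_algebraic_int_lead_coeff[OF x 1 dq this]
  have lc: "\<bar>Polynomial.coeff q 2\<bar> = 1" using dq by simp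
  define k where "k = Polynomial.content q0"
  have k: "c * b = k * Polynomial.coeff q 0" "- a * e = k * Polynomial.coeff q 1"
    "b * e = k * Polynomial.coeff q 2"
    using sq unfolding k_def[symmetric] 
    by (metis q0_def coeff_smult coeff_pCons_0,
        metis q0_def coeff_smult coeff_pCons_0 coeff_pCons_Suc One_nat_def,
        metis q0_def coeff_smult coeff_pCons_0 coeff_pCons_Suc One_nat_def numeral_2_eq_2)
  \<comment> \<open>\<open>w\<close> is a sign and thus its own inverse, so \<open>k\<close> can be
    solved for without division.\<close>
  define w where "w = Polynomial.coeff q 2"
  have ww: "w * w = 1" using lc by (simp add: w_def abs_if split: if_splits)
  have "k = k * w * w" using ww by (simp add: mult.assoc)
  then have kw: "k = w * (b * e)" using k(3) by (simp only: w_def mult.commute)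
  have A: "a * e = - (w * Polynomial.coeff q 1 * (b * e))"
  proof -
    have "a * e = - (k * Polynomial.coeff q 1)" using k(2) by linarith
    then show ?thesis by (simp only: kw mult_ac)
  qed
  then have "a * e = - (w * Polynomial.coeff q 1 * b) * e" by (simp only: mult_minus_left mult_minus_right mult_ac)
  then have A': "a = - (w * Polynomial.coeff q 1 * b)" using ce(2) by (simp only: mult_cancel_right) simp
  have B: "c * b = w * Polynomial.coeff q 0 * (b * e)" using k(1) by (simp only: kw mult_ac)
  then have "c * b = (w * Polynomial.coeff q 0 * e) * b" by (simp only: mult_ac)
  then have B': "c = w * Polynomial.coeff q 0 * e" using ab(2) by (simp only: mult_cancel_right) simp
  have "T = of_int (- (w * Polynomial.coeff q 1))" "N = of_int (w * Polynomial.coeff q 0)"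
    using A' B' ab ce by simp_all
  then show ?thesis by auto
qed

text \<open>The square of the reduced denominator of \<open>r\<close> has to divide
  \<open>d\<close>.\<close>

lemma squarefree_mult_square_int:
  fixes d :: int and r :: real
  assumes "squarefree d" "r \<in> \<rat>" "r\<^sup>2 * of_int d \<in> \<int>"
  shows "r \<in> \<int>"
proof -
  obtain m n where mn: "r = of_int m / of_int n" "n > 0" "coprime m n"
    by (rule Rats_cases'[OF assms(2)]) blast
  obtain k where k: "r\<^sup>2 * of_int d = of_int k" using assms(3) by (auto elim: Ints_cases)
  then have "of_int (m\<^sup>2 * d) = (of_int (k * n\<^sup>2) :: real)"
    using mn by (simp add: field_simps)
  then have "m\<^sup>2 * d = k * n\<^sup>2" by (rule of_int_eq_iff[THEN iffD1])
  then have "n\<^sup>2 dvd m\<^sup>2 * d" by simp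
  then have "n\<^sup>2 dvd d" using mn(3)
    by (metis coprime_commute coprime_dvd_mult_right_iff coprime_power_left_iff coprime_power_right_iff)
  then have "n dvd 1" using assms(1) unfolding squarefree_def by auto
  then have "n = 1" using mn(2) by auto
  then show ?thesis using mn by simp
qed

section \<open>The quadratic field, its conjugation and its integral basis\<close>

locale real_quadratic =
  fixes d :: int
  assumes squarefree_d: "squarefree d" and d_gt_1: "d > 1"
begin

definition rt :: real where "rt = sqrt (of_int d)"

text \<open>\<open>om\<close> generates the ring of integers; \<open>tr\<close> and \<open>nm\<close> are its trace and norm, and
  \<open>qf b\<close> is the norm of \<open>b + om\<close>.\<close>

definition tr :: int where "tr = (if d mod 4 = 1 then 1 else 0)"

definition nm :: int where "nm = (if d mod 4 = 1 then (1 - d) div 4 else - d)"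

definition om :: real where "om = (if d mod 4 = 1 then (1 + rt) / 2 else rt)"

definition qf :: "int \<Rightarrow> int" where "qf b = b\<^sup>2 + tr * b + nm"

abbreviation ZK :: "real set" where "ZK \<equiv> carrier (ring_of_integers d)"

abbreviation KK :: "real set" where "KK \<equiv> quad_set d"

abbreviation cj :: "real \<Rightarrow> real" where "cj \<equiv> sigma d"

lemma rt_square: "rt * rt = of_int d"
  using d_gt_1 by (simp add: rt_def)

lemma rt_irrational: "rt \<notin> \<rat>"
  using sqrt_squarefree_irrational[OF squarefree_d d_gt_1] by (simp add: rt_def)

lemma rt_ge_1: "rt \<ge> 1"
  using d_gt_1 by (simp add: rt_def)

lemma d_mod_4: "d mod 4 \<noteq> 0"
proof
  assume "d mod 4 = 0"
  then have "2\<^sup>2 dvd d" by (simp add: dvd_eq_mod_eq_0)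
  then have "(2::int) dvd 1" using squarefree_d unfolding squarefree_def by blast
  then show False by simp
qed

lemma om_square: "om * om = of_int tr * om - of_int nm"
proof (cases "d mod 4 = 1")
  case True
  then have "4 * ((1 - d) div 4) = 1 - d" by presburger
  then have "of_int (4 * ((1 - d) div 4)) = (of_int (1 - d) :: real)" by (simp only:)
  then have "4 * of_int nm = (1 - of_int d :: real)" using True by (simp add: nm_def)
  then show ?thesis using True rt_square
    by (simp add: om_def tr_def field_simps)
next
  case False
  then show ?thesis using rt_square by (simp add: om_def tr_def nm_def)
qed

lemma quad_mem_iff: "x \<in> KK \<longleftrightarrow> (\<exists>u\<in>\<rat>. \<exists>v\<in>\<rat>. x = u + v * rt)"
  by (auto simp: quad_set_def rt_def)

lemma KK_E:
  assumes "x \<in> KK"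
  obtains u v where "u \<in> \<rat>" "v \<in> \<rat>" "x = u + v * rt"
  using assms by (auto simp: quad_mem_iff)

lemma KK_I: "u \<in> \<rat> \<Longrightarrow> v \<in> \<rat> \<Longrightarrow> u + v * rt \<in> KK"
  by (auto simp: quad_mem_iff)

lemma cj_coords: "u \<in> \<rat> \<Longrightarrow> v \<in> \<rat> \<Longrightarrow> cj (u + v * rt) = u - v * rt"
  using sigma_eq[OF squarefree_d d_gt_1] by (simp add: rt_def)

lemma Rats_KK: "q \<in> \<rat> \<Longrightarrow> q \<in> KK"
  using KK_I[of q 0] by simp

lemma rt_KK: "rt \<in> KK" using KK_I[of 0 1] by simp

lemma KK_add: assumes "x \<in> KK" "y \<in> KK" shows "x + y \<in> KK" "cj (x + y) = cj x + cj y"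
proof -
  obtain u v u' v' where *: "u \<in> \<rat>" "v \<in> \<rat>" "x = u + v * rt" "u' \<in> \<rat>" "v' \<in> \<rat>" "y = u' + v' * rt"
    using assms KK_E by metis
  then have e: "x + y = (u + u') + (v + v') * rt" by (simp add: algebra_simps)
  show "x + y \<in> KK" unfolding e using * by (intro KK_I) auto
  show "cj (x + y) = cj x + cj y" unfolding e using * by (subst cj_coords) (auto simp: cj_coords algebra_simps)
qed

lemma KK_mult: assumes "x \<in> KK" "y \<in> KK" shows "x * y \<in> KK" "cj (x * y) = cj x * cj y"
proof -
  obtain u v u' v' where *: "u \<in> \<rat>" "v \<in> \<rat>" "x = u + v * rt" "u' \<in> \<rat>" "v' \<in> \<rat>" "y = u' + v' * rt"
    using assms KK_E by metis
  then have e: "x * y = (u * u' + v * v' * of_int d) + (u * v' + v * u') * rt"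
    by (simp add: algebra_simps flip: rt_square)
  show "x * y \<in> KK" unfolding e using * by (intro KK_I) auto
  have "cj (x * y) = (u * u' + v * v' * of_int d) - (u * v' + v * u') * rt"
    unfolding e using * by (intro cj_coords) auto
  also have "\<dots> = (u - v * rt) * (u' - v' * rt)" by (simp add: algebra_simps flip: rt_square)
  finally show "cj (x * y) = cj x * cj y" using * by (simp add: cj_coords)
qed

lemma cj_KK [simp]: "x \<in> KK \<Longrightarrow> cj x \<in> KK"
  by (erule KK_E) (use KK_I[of _ "- _"] in \<open>auto simp: cj_coords\<close>)

lemma cj_cj [simp]: "x \<in> KK \<Longrightarrow> cj (cj x) = x"
  by (erule KK_E) (use cj_coords[of _ "- _"] in \<open>auto simp: cj_coords\<close>)

lemma cj_Rats: "q \<in> \<rat> \<Longrightarrow> cj q = q"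
  using cj_coords[of q 0] by simp

lemma cj_of_int [simp]: "cj (of_int q) = of_int q"
  and cj_0 [simp]: "cj 0 = 0" and cj_1 [simp]: "cj 1 = 1"
  by (simp_all add: cj_Rats)

lemma cj_rt: "cj rt = - rt" using cj_coords[of 0 1] by simp

lemma KK_uminus: "x \<in> KK \<Longrightarrow> - x \<in> KK" "x \<in> KK \<Longrightarrow> cj (- x) = - cj x"
  using KK_mult[of "-1" x] cj_Rats[of "-1"] Rats_KK[of "-1"] by auto

lemma cj_eq_0_iff: "x \<in> KK \<Longrightarrow> cj x = 0 \<longleftrightarrow> x = 0"
  by (metis cj_0 cj_cj)

lemma norm_Rats: "x \<in> KK \<Longrightarrow> x * cj x \<in> \<rat>"
proof (erule KK_E)
  fix u v assume *: "u \<in> \<rat>" "v \<in> \<rat>" "x = u + v * rt"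
  have "x * cj x = u * u - v * v * of_int d"
    using * by (simp add: cj_coords algebra_simps flip: rt_square)
  then show ?thesis using * by simp
qed

lemma KK_inverse: assumes "x \<in> KK" shows "inverse x \<in> KK"
proof (cases "x = 0")
  case False
  then have "inverse x = cj x * inverse (x * cj x)"
    using assms by (simp add: field_simps cj_eq_0_iff)
  moreover have "inverse (x * cj x) \<in> KK" using norm_Rats[OF assms] by (intro Rats_KK Rats_inverse)
  ultimately show ?thesis using KK_mult(1) cj_KK assms by metis
qed (use assms in simp)

lemma KK_divide: assumes "x \<in> KK" "y \<in> KK" shows "x / y \<in> KK"
  unfolding divide_inverse using assms KK_mult(1) KK_inverse by blast

lemma cj_divide: assumes "x \<in> KK" "y \<in> KK" shows "cj (x / y) = cj x / cj y"
proof (cases "y = 0")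
  case False
  then have "cj x = cj (x / y) * cj y" using KK_mult(2)[OF KK_divide[OF assms] assms(2)] by simp
  then show ?thesis using False assms by (simp add: cj_eq_0_iff)
qed simp

lemma om_KK: "om \<in> KK" 
  using KK_I[of "1/2" "1/2"] rt_KK by (auto simp: om_def field_simps)

lemma cj_om: "cj om = of_int tr - om"
  using cj_coords[of "1/2" "1/2"] cj_rt by (simp add: om_def tr_def field_simps)

lemma om_irrational: "om \<notin> \<rat>"
proof
  assume *: "om \<in> \<rat>"
  have "rt = (if d mod 4 = 1 then 2 * om - 1 else om)" by (simp add: om_def field_simps)
  then have "rt \<in> \<rat>" using * by auto
  then show False using rt_irrational by simp
qed

lemma om_coords_unique:
  assumes "of_int x + of_int y * om = of_int x' + of_int y' * om"
  shows "x = x' \<and> y = y'"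
proof -
  have "y = y'"
  proof (rule ccontr)
    assume "y \<noteq> y'"
    then have "om = (of_int x - of_int x') / (of_int y' - of_int y)"
      using assms by (simp add: field_simps)
    then show False using om_irrational by simp
  qed
  then show ?thesis using assms by simp
qed

lemma ZK_iff_algebraic_int: "x \<in> ZK \<longleftrightarrow> x \<in> KK \<and> algebraic_int x"
  by (simp add: ring_of_integers_def)

lemma algebraic_int_om_coords: "algebraic_int (of_int x + of_int y * om)"
proof (rule algebraic_int.intros)
  \<comment> \<open>The characteristic polynomial: its coefficients are the norm and minus the trace
    of \<open>x + y * om\<close>.\<close>
  define p where "p = [:of_int (x * x + tr * x * y + nm * y * y), - of_int (2 * x + tr * y), 1 :: real:]"
  show "lead_coeff p = 1" by (simp add: p_def)
  show "\<forall>i. Polynomial.coeff p i \<in> \<int>"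
    by (auto simp: p_def coeff_pCons split: nat.splits)
  have "poly p (of_int x + of_int y * om) = of_int y * of_int y * (om * om - of_int tr * om + of_int nm)"
    by (simp add: p_def algebra_simps)
  then show "poly p (of_int x + of_int y * om) = 0" by (simp add: om_square)
qed

text \<open>Squares are 0 or 1 modulo 4, and \<open>d\<close> is 2 or 3 there. With \<open>A\<close>
  and \<open>B\<close> the doubled coordinates of an integer of the field, this says that no proper
  halves occur.\<close>

lemma even_if_square_eq: 
  fixes A B k :: int
  assumes "A * A - d * (B * B) = 4 * k" "d mod 4 \<noteq> 1" shows "even A \<and> even B"
proof -
  have sq: "n * n mod 4 = (if even n then 0 else 1)" for n :: int
  proof (cases "even n")
    case True then obtain m where "n = 2 * m" by auto
    then show ?thesis by (simp add: mod_eq_0_iff_dvd)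
  next
    case False then obtain m where "n = 2 * m + 1" by (auto elim: oddE)
    then have "n * n = 4 * (m * m + m) + 1" by (simp add: algebra_simps)
    then show ?thesis using False by presburger
  qed
  have "A * A mod 4 = (d mod 4) * (B * B mod 4) mod 4"
    using assms(1) by (simp add: mod_mult_eq) (metis diff_add_cancel mod_mult_self4 mult.commute)
  moreover have "d mod 4 = 2 \<or> d mod 4 = 3" using assms(2) d_mod_4 by presburger
  ultimately show ?thesis unfolding sq by (auto split: if_splits)
qed

text \<open>For irrational \<open>x = u + v * rt\<close>, the trace \<open>2 * u\<close> and the
  norm are integers. Then \<open>(2 * v)\<^sup>2 * d\<close> is an integer, hence so is
  \<open>2 * v\<close>, as \<open>d\<close> is squarefree. The parities of the two doubled
  coordinates decide the rest.\<close>

lemma ZK_iff: "x \<in> ZK \<longleftrightarrow> (\<exists>a b :: int. x = of_int a + of_int b * om)"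
proof
  assume "\<exists>a b :: int. x = of_int a + of_int b * om"
  then obtain a b where x: "x = of_int a + of_int b * om" by blast
  then have "x \<in> KK" by (simp add: KK_add KK_mult om_KK Rats_KK)
  then show "x \<in> ZK" using algebraic_int_om_coords[of a b] x by (simp add: ZK_iff_algebraic_int)
next
  assume "x \<in> ZK"
  then have x: "x \<in> KK" "algebraic_int x" by (auto simp: ZK_iff_algebraic_int)
  obtain u v where uv: "u \<in> \<rat>" "v \<in> \<rat>" "x = u + v * rt" using x(1) KK_E by blast
  show "\<exists>a b :: int. x = of_int a + of_int b * om"
  proof (cases "v = 0")
    case True
    then have "x \<in> \<int>" using rational_algebraic_int_is_int[of x] x uv by auto
    then obtain n where "x = of_int n" by (auto elim: Ints_cases)
    then show ?thesis by (intro exI[of _ n] exI[of _ 0]) auto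
  next
    case False
    have "x \<notin> \<rat>"
    proof
      assume "x \<in> \<rat>"
      then have "(x - u) / v \<in> \<rat>" using uv(1,2) by (intro Rats_divide Rats_diff)
      then show False using uv(3) False rt_irrational by simp
    qed
    moreover have "x\<^sup>2 - (2 * u) * x + (u * u - v * v * of_int d) = 0"
      unfolding uv(3) by (simp add: algebra_simps power2_eq_square flip: rt_square)
    ultimately have "2 * u \<in> \<int>" "u * u - v * v * of_int d \<in> \<int>"
      using algebraic_int_quadratic_coeffs[of x "2 * u" "u * u - v * v * of_int d"] uv x by auto
    then obtain A k where A: "2 * u = of_int A" and k: "u * u - v * v * of_int d = of_int k"
      by (meson Ints_cases)
    have Ak: "(2 * v)\<^sup>2 * of_int d = of_int (A * A - 4 * k)"
      unfolding of_int_diff of_int_mult A[symmetric] k[symmetric] by (simp add: algebra_simps power2_eq_square)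
    then have "(2 * v)\<^sup>2 * of_int d \<in> \<int>" by (metis Ints_of_int)
    moreover have "2 * v \<in> \<rat>" using uv(2) by simp
    ultimately have "2 * v \<in> \<int>" using squarefree_mult_square_int[OF squarefree_d] by blast
    then obtain B where B: "2 * v = of_int B" by (auto elim: Ints_cases)
    have "of_int (A * A - d * (B * B)) = (of_int (4 * k) :: real)"
      using Ak unfolding B by (simp add: power2_eq_square algebra_simps)
    then have AB: "A * A - d * (B * B) = 4 * k" by (rule of_int_eq_iff[THEN iffD1])
    show ?thesis
    proof (cases "d mod 4 = 1")
      case True
      then have "odd d" by presburger
      moreover have "even (A * A - d * (B * B))" unfolding AB by simp
      ultimately have "even (A - B)" by simp
      then obtain m where m: "A - B = 2 * m" by (elim evenE)
      have "real_of_int (A - B) = of_int (2 * m)" using m by simp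
      then have "x = of_int m + of_int B * om"
        using A B True uv(3) by (simp add: om_def field_simps)
      then show ?thesis by blast
    next
      case False
      then obtain m n where mn: "A = 2 * m" "B = 2 * n" using even_if_square_eq[OF AB] by (auto elim!: evenE)
      then have "x = of_int m + of_int n * om" using A B uv(3) False by (simp add: om_def)
      then show ?thesis by blast
    qed
  qed
qed

lemma ZK_I: "of_int a + of_int b * om \<in> ZK" by (auto simp: ZK_iff)

lemma ZK_of_int [simp]: "of_int a \<in> ZK"
  and ZK_0 [simp]: "0 \<in> ZK" and ZK_1 [simp]: "1 \<in> ZK" and om_ZK: "om \<in> ZK"
  using ZK_I[of a 0] ZK_I[of 0 0] ZK_I[of 1 0] ZK_I[of 0 1] by simp_all

lemma ZK_KK: "x \<in> ZK \<Longrightarrow> x \<in> KK" by (simp add: ZK_iff_algebraic_int)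

lemma ZK_add: assumes "x \<in> ZK" "y \<in> ZK" shows "x + y \<in> ZK"
proof -
  obtain a b a' b' where "x = of_int a + of_int b * om" "y = of_int a' + of_int b' * om"
    using assms by (auto simp: ZK_iff)
  then have "x + y = of_int (a + a') + of_int (b + b') * om" by (simp add: algebra_simps)
  then show ?thesis using ZK_I by metis
qed

lemma ZK_mult: assumes "x \<in> ZK" "y \<in> ZK" shows "x * y \<in> ZK"
proof -
  obtain a b a' b' where *: "x = of_int a + of_int b * om" "y = of_int a' + of_int b' * om"
    using assms by (auto simp: ZK_iff)
  have "x * y = of_int a * of_int a' + (of_int a * of_int b' + of_int b * of_int a') * om
      + of_int b * of_int b' * (om * om)" 
    by (simp add: * algebra_simps)
  also have "\<dots> = of_int (a * a' - b * b' * nm) + of_int (a * b' + b * a' + b * b' * tr) * om"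
    unfolding om_square by (simp add: algebra_simps)
  finally show ?thesis using ZK_I by metis
qed

lemma ZK_uminus: "x \<in> ZK \<Longrightarrow> - x \<in> ZK"
  using ZK_mult[OF ZK_of_int[of "- 1"]] by simp

lemma ZK_diff: "x \<in> ZK \<Longrightarrow> y \<in> ZK \<Longrightarrow> x - y \<in> ZK"
  using ZK_add[of x "- y"] ZK_uminus by simp

lemma cj_om_coords: "cj (of_int a + of_int b * om) = of_int a + of_int b * (of_int tr - om)"
  by (simp add: KK_add KK_mult om_KK Rats_KK cj_om)

lemma cj_ZK: assumes "x \<in> ZK" shows "cj x \<in> ZK"
proof -
  obtain a b where "x = of_int a + of_int b * om"
    using assms by (auto simp: ZK_iff)
  then have "cj x = of_int (a + b * tr) + of_int (- b) * om"
    by (simp add: cj_om_coords algebra_simps)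
  then show ?thesis using ZK_I by metis
qed

lemma Rats_ZK_Ints: assumes "x \<in> ZK" "x \<in> \<rat>" shows "x \<in> \<int>"
  using assms rational_algebraic_int_is_int ZK_iff_algebraic_int by blast

lemma norm_Ints: "x \<in> ZK \<Longrightarrow> x * cj x \<in> \<int>"
  by (intro Rats_ZK_Ints ZK_mult cj_ZK norm_Rats ZK_KK)

text \<open>The right side is the discriminant of the field. It is the discriminant of the
  polynomial \<open>qf\<close> and hence independent of the shift \<open>b\<close>.\<close>

lemma discriminant_identity: "(2 * b + tr)\<^sup>2 - 4 * qf b = (if d mod 4 = 1 then d else 4 * d)"
proof -
  have "(2 * b + tr)\<^sup>2 - 4 * qf b = tr\<^sup>2 - 4 * nm" by (simp add: qf_def algebra_simps power2_eq_square)
  moreover have "4 * ((1 - d) div 4) = 1 - d" if "d mod 4 = 1" using that by presburger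
  ultimately show ?thesis by (auto simp: tr_def nm_def)
qed

lemma norm_om_shift: "(of_int b + om) * (of_int b + of_int tr - om) = of_int (qf b)"
proof -
  have "(of_int b + om) * (of_int b + of_int tr - om) = of_int b * of_int b + of_int b * of_int tr + of_int tr * om - om * om"
    by (simp add: algebra_simps)
  then show ?thesis unfolding om_square by (simp add: qf_def power2_eq_square algebra_simps)
qed

end

section \<open>Ideals as lattices\<close>

lemma int_subgroup_generator:
  fixes S :: "int set"
  assumes add: "\<And>x y. x \<in> S \<Longrightarrow> y \<in> S \<Longrightarrow> x + y \<in> S"
    and mult: "\<And>x k. x \<in> S \<Longrightarrow> k * x \<in> S"
    and nz: "x0 \<in> S" "x0 \<noteq> 0"
  shows "\<exists>g>0. g \<in> S \<and> (\<forall>x\<in>S. g dvd x)"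
proof -
  have "\<bar>x0\<bar> \<in> S" using mult[OF nz(1), of "sgn x0"] by (simp add: abs_sgn mult.commute)
  then have ex: "\<exists>n. n > 0 \<and> int n \<in> S" using nz(2) by (intro exI[of _ "nat \<bar>x0\<bar>"]) simp
  define n where "n = (LEAST n. n > 0 \<and> int n \<in> S)"
  have n: "n > 0" "int n \<in> S" using LeastI_ex[OF ex] by (auto simp: n_def)
  have "int n dvd x" if x: "x \<in> S" for x
  proof -
    have "x mod int n = x + (- (x div int n)) * int n" by (simp add: minus_div_mult_eq_mod[symmetric])
    then have "x mod int n \<in> S" using add[OF x mult[OF n(2)]] by metis
    then have "\<not> nat (x mod int n) > 0"
      using n not_less_Least[of "nat (x mod int n)" "\<lambda>n. n > 0 \<and> int n \<in> S"]
      by (auto simp: n_def[symmetric] zless_nat_eq_int_zless nat_less_iff)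
    then have "x mod int n \<le> 0" by linarith
    moreover have "x mod int n \<ge> 0" using n(1) by simp
    ultimately show ?thesis by (intro mod_0_imp_dvd) linarith
  qed
  then show ?thesis using n by (intro exI[of _ "int n"]) auto
qed

lemma bezout3_int:
  fixes a b c :: int
  assumes "\<And>p. prime p \<Longrightarrow> p dvd a \<Longrightarrow> p dvd b \<Longrightarrow> p dvd c \<Longrightarrow> False"
  shows "\<exists>x y z. x * a + y * b + z * c = 1"
proof -
  define g where "g = gcd a (gcd b c)"
  have "is_unit g"
  proof (cases "g = 0")
    case True
    then have "a = 0" "b = 0" "c = 0" by (auto simp: g_def)
    \<comment> \<open>If all three numbers vanish, every prime is a common factor; 2 serves.\<close>
    then show ?thesis using assms[of 2] by simp
  next
    case False
    show ?thesis
    proof (rule ccontr)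
      assume "\<not> is_unit g"
      then obtain p where "prime p" "p dvd g" using prime_divisorE[OF False] by blast
      then show False using assms[of p] by (auto simp: g_def)
    qed
  qed
  then have g1: "g = 1" using gcd_ge_0_int[of a "gcd b c"] unfolding g_def by simp
  obtain u v where uv: "u * b + v * c = gcd b c" using bezout_int by blast
  obtain x w where "x * a + w * gcd b c = gcd a (gcd b c)" using bezout_int by blast
  then have "x * a + (w * u) * b + (w * v) * c = 1" 
    using g1 uv unfolding g_def by (simp add: algebra_simps flip: uv)
  then show ?thesis by blast
qed

context real_quadratic
begin

section \<open>Modules over the ring of integers and their products\<close>

definition scale :: "real \<Rightarrow> real set \<Rightarrow> real set" where "scale x I = (\<lambda>a. x * a) ` I"

abbreviation prd :: "real set \<Rightarrow> real set \<Rightarrow> real set" where "prd \<equiv> ideal_prod (quad_field d)"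

text \<open>The zero module and the whole field are included, so that products, conjugates and
  multiples, even by 0, stay in the class.\<close>

definition zmodule :: "real set \<Rightarrow> bool" where
  "zmodule I \<longleftrightarrow> I \<subseteq> KK \<and> 0 \<in> I \<and> (\<forall>x\<in>I. \<forall>y\<in>I. x + y \<in> I) \<and> (\<forall>a\<in>ZK. \<forall>x\<in>I. a * x \<in> I)"

definition zideal :: "real set \<Rightarrow> bool" where
  "zideal I \<longleftrightarrow> zmodule I \<and> I \<subseteq> ZK \<and> I \<noteq> {0}"

lemma
  assumes "zmodule I"
  shows zmodule_KK: "x \<in> I \<Longrightarrow> x \<in> KK" and zmodule_0: "0 \<in> I"
    and zmodule_add: "x \<in> I \<Longrightarrow> y \<in> I \<Longrightarrow> x + y \<in> I"
    and zmodule_mult: "a \<in> ZK \<Longrightarrow> x \<in> I \<Longrightarrow> a * x \<in> I"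
  using assms by (auto simp: zmodule_def)

lemma zmodule_uminus: "zmodule I \<Longrightarrow> x \<in> I \<Longrightarrow> - x \<in> I"
  using zmodule_mult[of I "- 1" x] ZK_uminus[OF ZK_1] by simp

lemma zmodule_diff: "zmodule I \<Longrightarrow> x \<in> I \<Longrightarrow> y \<in> I \<Longrightarrow> x - y \<in> I"
  using zmodule_add[of I x "- y"] zmodule_uminus by simp

lemma prd_I: "x \<in> I \<Longrightarrow> y \<in> J \<Longrightarrow> x * y \<in> prd I J"
  using ideal_prod.prod[of x I y J "quad_field d"] by (simp add: quad_field_def)

lemma prd_add: "x \<in> prd I J \<Longrightarrow> y \<in> prd I J \<Longrightarrow> x + y \<in> prd I J"
  using ideal_prod.sum[of x "quad_field d" I J y] by (simp add: quad_field_def)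

lemma prd_induct [consumes 1, case_names prod sum]:
  assumes "x \<in> prd I J" "\<And>i j. i \<in> I \<Longrightarrow> j \<in> J \<Longrightarrow> P (i * j)"
    "\<And>x y. x \<in> prd I J \<Longrightarrow> P x \<Longrightarrow> y \<in> prd I J \<Longrightarrow> P y \<Longrightarrow> P (x + y)"
  shows "P x"
  using assms(1) by (induction rule: ideal_prod.induct) (use assms(2,3) in \<open>auto simp: quad_field_def\<close>)

text \<open>Addition and multiplication agree in both rings, and the closure that defines the
  product uses only these. Integral and fractional ideals can thus share the product
  \<open>prd\<close>.\<close>

lemma ideal_prod_ring_of_integers: "ideal_prod (ring_of_integers d) = prd"
proof (intro ext equalityI subsetI)
  fix I J x assume "x \<in> ideal_prod (ring_of_integers d) I J"
  then show "x \<in> prd I J"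
    by (induction rule: ideal_prod.induct)
      (use prd_I prd_add in \<open>auto simp: ring_of_integers_def quad_field_def\<close>)
next
  fix I J x assume "x \<in> prd I J"
  then show "x \<in> ideal_prod (ring_of_integers d) I J"
  proof (induction rule: prd_induct)
    case (prod i j)
    then show ?case using ideal_prod.prod[of i I j J "ring_of_integers d"]
      by (simp add: ring_of_integers_def quad_field_def)
  next
    case (sum x y)
    then show ?case using ideal_prod.sum[of x "ring_of_integers d" I J y]
      by (simp add: ring_of_integers_def quad_field_def)
  qed
qed

lemma prd_subsetI:
  assumes "\<And>i j. i \<in> I \<Longrightarrow> j \<in> J \<Longrightarrow> i * j \<in> M" "\<And>x y. x \<in> M \<Longrightarrow> y \<in> M \<Longrightarrow> x + y \<in> M"
  shows "prd I J \<subseteq> M"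
proof
  fix x assume "x \<in> prd I J" then show "x \<in> M" by (induction rule: prd_induct) (use assms in auto)
qed

lemma prd_commute: "prd I J = prd J I"
proof -
  have "prd A B \<subseteq> prd B A" for A B
    by (intro prd_subsetI prd_add) (subst mult.commute, rule prd_I)
  then show ?thesis by blast
qed

lemma prd_assoc: "prd (prd I J) M = prd I (prd J M)"
proof (intro equalityI prd_subsetI prd_add)
  fix s k assume "s \<in> prd I J" "k \<in> M"
  then show "s * k \<in> prd I (prd J M)"
    by (induction rule: prd_induct)
      (auto simp: mult.assoc distrib_right intro!: prd_add intro: prd_I)
next
  fix i s assume "s \<in> prd J M" "i \<in> I"
  then show "i * s \<in> prd (prd I J) M"
    by (induction rule: prd_induct)
      (auto simp: mult.assoc[symmetric] distrib_left intro!: prd_add intro: prd_I)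
qed

lemma prd_left_commute: "prd I (prd J M) = prd J (prd I M)"
  by (metis prd_assoc prd_commute)

lemmas prd_ac = prd_assoc prd_commute prd_left_commute

lemma prd_ZK: "zmodule I \<Longrightarrow> prd I ZK = I"
proof (intro equalityI prd_subsetI subsetI)
  fix x assume "x \<in> I" then show "x \<in> prd I ZK" using prd_I[of x I 1 ZK] by simp
next
  fix i j assume "zmodule I" "i \<in> I" "j \<in> ZK"
  then show "i * j \<in> I" by (subst mult.commute) (rule zmodule_mult)
qed (auto simp: zmodule_add)

lemma ZK_prd: "zmodule I \<Longrightarrow> prd ZK I = I"
  by (simp add: prd_commute[of ZK] prd_ZK)

lemma prd_scale: "prd (scale x I) J = scale x (prd I J)"
proof (intro equalityI prd_subsetI subsetI)
  fix i j assume "i \<in> scale x I" "j \<in> J"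
  then show "i * j \<in> scale x (prd I J)" by (auto simp: scale_def mult.assoc intro!: imageI prd_I)
next
  fix u v assume "u \<in> scale x (prd I J)" "v \<in> scale x (prd I J)"
  then show "u + v \<in> scale x (prd I J)"
    by (auto simp: scale_def distrib_left[symmetric] intro!: imageI prd_add)
next
  fix u assume "u \<in> scale x (prd I J)"
  then obtain w where w: "w \<in> prd I J" "u = x * w" by (auto simp: scale_def)
  from w(1) have "x * w \<in> prd (scale x I) J"
  proof (induction rule: prd_induct)
    case (prod i j)
    then show ?case using prd_I[of "x * i" "scale x I" j J] by (auto simp: scale_def mult.assoc)
  qed (simp add: distrib_left prd_add)
  then show "u \<in> prd (scale x I) J" using w by simp
qed

lemma prd_scale_right: "prd I (scale x J) = scale x (prd I J)"
  by (metis prd_commute prd_scale)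

lemma scale_scale: "scale x (scale y I) = scale (x * y) I"
  by (auto simp: scale_def image_image mult.assoc)

lemma scale_1 [simp]: "scale 1 I = I" by (simp add: scale_def)

lemma scale_cancel: "x \<noteq> 0 \<Longrightarrow> scale x I = scale x J \<Longrightarrow> I = J"
  by (metis left_inverse scale_1 scale_scale)

lemma cj_scale: "x \<in> KK \<Longrightarrow> I \<subseteq> KK \<Longrightarrow> cj ` scale x I = scale (cj x) (cj ` I)"
  by (auto simp: scale_def image_image KK_mult subset_iff intro!: image_cong)

lemma cj_prd: assumes "I \<subseteq> KK" "J \<subseteq> KK" shows "cj ` prd I J = prd (cj ` I) (cj ` J)"
proof (intro equalityI prd_subsetI)
  have sub: "prd I J \<subseteq> KK" using assms KK_mult KK_add by (intro prd_subsetI) auto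
  have "cj s \<in> prd (cj ` I) (cj ` J)" if "s \<in> prd I J" for s
    using that
  proof (induction rule: prd_induct)
    case (prod i j)
    then show ?case using assms by (auto simp: KK_mult subset_iff intro!: prd_I)
  next
    case (sum x y)
    then have "cj (x + y) = cj x + cj y" using sub KK_add by blast
    then show ?case using sum by (simp add: prd_add)
  qed
  then show "cj ` prd I J \<subseteq> prd (cj ` I) (cj ` J)" by blast
  show "i * j \<in> cj ` prd I J" if "i \<in> cj ` I" "j \<in> cj ` J" for i j
  proof -
    obtain i' j' where "i' \<in> I" "j' \<in> J" "i = cj i'" "j = cj j'" using \<open>i \<in> cj ` I\<close> \<open>j \<in> cj ` J\<close> by blast
    then show ?thesis using assms
      by (intro image_eqI[of _ _ "i' * j'"]) (auto simp: KK_mult subset_iff intro!: prd_I)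
  qed
  show "x + y \<in> cj ` prd I J" if "x \<in> cj ` prd I J" "y \<in> cj ` prd I J" for x y
  proof -
    obtain x' y' where *: "x' \<in> prd I J" "y' \<in> prd I J" "x = cj x'" "y = cj y'"
      using \<open>x \<in> cj ` prd I J\<close> \<open>y \<in> cj ` prd I J\<close> by blast
    then have "x + y = cj (x' + y')" using sub KK_add by (metis subsetD)
    then show ?thesis using * prd_add by blast
  qed
qed

lemma zmodule_ZK: "zmodule ZK"
  by (auto simp: zmodule_def ZK_add ZK_mult ZK_KK)

lemma zideal_ZK: "zideal ZK"
  using ZK_1 zmodule_ZK unfolding zideal_def by (metis order_refl singletonD zero_neq_one)

lemma zmodule_prd: assumes "zmodule I" "zmodule J" shows "zmodule (prd I J)"
  unfolding zmodule_def
proof (intro conjI ballI)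
  show "prd I J \<subseteq> KK"
    using assms zmodule_KK KK_mult(1) KK_add(1) by (intro prd_subsetI) blast+
  show "0 \<in> prd I J" using prd_I[of 0 I 0 J] assms zmodule_0 by simp
  show "x + y \<in> prd I J" if "x \<in> prd I J" "y \<in> prd I J" for x y using that by (rule prd_add)
  show "a * x \<in> prd I J" if "a \<in> ZK" "x \<in> prd I J" for a x
    using that(2)
  proof (induction rule: prd_induct)
    case (prod i j)
    then show ?case using prd_I[of "a * i" I j J] zmodule_mult[OF assms(1) that(1)] by (simp add: mult.assoc)
  qed (simp add: distrib_left prd_add)
qed

lemma zmodule_scale: assumes "zmodule I" "x \<in> KK" shows "zmodule (scale x I)"
  unfolding zmodule_def
proof (intro conjI ballI)
  show "scale x I \<subseteq> KK" using assms zmodule_KK KK_mult(1) by (auto simp: scale_def)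
  show "0 \<in> scale x I" using zmodule_0[OF assms(1)] by (auto simp: scale_def intro!: image_eqI[of _ _ 0])
  show "u + v \<in> scale x I" if "u \<in> scale x I" "v \<in> scale x I" for u v
    using that assms zmodule_add by (auto simp: scale_def distrib_left[symmetric] intro!: imageI)
  show "a * u \<in> scale x I" if "a \<in> ZK" "u \<in> scale x I" for a u
    using that zmodule_mult[OF assms(1)] by (auto simp: scale_def mult.left_commute[of a])
qed

lemma zmodule_cj: assumes "zmodule I" shows "zmodule (cj ` I)"
  unfolding zmodule_def
proof (intro conjI ballI)
  show "cj ` I \<subseteq> KK" using assms zmodule_KK by auto
  show "0 \<in> cj ` I" using zmodule_0[OF assms] by (auto intro!: image_eqI[of _ _ 0])
  show "u + v \<in> cj ` I" if "u \<in> cj ` I" "v \<in> cj ` I" for u v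
  proof -
    obtain u' v' where *: "u' \<in> I" "v' \<in> I" "u = cj u'" "v = cj v'"
      using \<open>u \<in> cj ` I\<close> \<open>v \<in> cj ` I\<close> by blast
    then have "u + v = cj (u' + v')" using KK_add zmodule_KK[OF assms] by auto
    then show ?thesis using * zmodule_add[OF assms] by auto
  qed
  show "a * u \<in> cj ` I" if "a \<in> ZK" "u \<in> cj ` I" for a u
  proof -
    obtain u' where *: "u' \<in> I" "u = cj u'" using \<open>u \<in> cj ` I\<close> by blast
    then have "a * u = cj (cj a * u')" using KK_mult zmodule_KK[OF assms] that(1) by (auto simp: ZK_KK)
    then show ?thesis using * zmodule_mult[OF assms cj_ZK[OF that(1)]] by auto
  qed
qed

lemma cj_cj_image: "I \<subseteq> KK \<Longrightarrow> cj ` cj ` I = I"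
  by (force simp: image_image subset_iff)

lemma cj_image_ZK: "cj ` ZK = ZK"
proof -
  have "cj ` ZK \<subseteq> ZK" using cj_ZK by auto
  moreover have "ZK \<subseteq> cj ` ZK"
  proof
    fix x assume "x \<in> ZK" then show "x \<in> cj ` ZK"
      by (intro image_eqI[of _ _ "cj x"]) (auto simp: cj_ZK ZK_KK)
  qed
  ultimately show ?thesis by blast
qed

lemma zidealD:
  assumes "zideal I"
  shows "zmodule I" "I \<subseteq> ZK" "I \<subseteq> KK" "\<exists>x\<in>I. x \<noteq> 0"
  using assms zmodule_0[of I] ZK_KK by (auto simp: zideal_def)

lemma zidealI: "zmodule I \<Longrightarrow> I \<subseteq> ZK \<Longrightarrow> x \<in> I \<Longrightarrow> x \<noteq> 0 \<Longrightarrow> zideal I"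
  by (auto simp: zideal_def)

lemma zideal_prd: assumes "zideal I" "zideal J" shows "zideal (prd I J)"
proof -
  obtain x y where "x \<in> I" "y \<in> J" "x \<noteq> 0" "y \<noteq> 0" using assms zidealD(4) by metis
  moreover have "prd I J \<subseteq> ZK"
    using assms zidealD(2) ZK_mult ZK_add by (intro prd_subsetI) blast+
  ultimately show ?thesis
    using zmodule_prd assms zidealD(1) by (intro zidealI[of _ "x * y"]) (auto intro: prd_I)
qed

lemma zideal_cj: assumes "zideal I" shows "zideal (cj ` I)"
proof -
  obtain x where x: "x \<in> I" "x \<noteq> 0" using assms zidealD(4) by metis
  then show ?thesis using assms zidealD[OF assms] cj_ZK
    by (intro zidealI[of _ "cj x"]) (auto simp: zmodule_cj cj_eq_0_iff subset_iff)
qed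

section \<open>Hermite normal form and the product of an ideal with its conjugate\<close>

definition lat :: "int \<Rightarrow> int \<Rightarrow> int \<Rightarrow> real set" where
  "lat g a b = {of_int (g * a * x + g * b * y) + of_int (g * y) * om | x y. True}"

text \<open>\<open>lat g a b\<close> is \<open>g\<close> times the lattice with basis
  \<open>a\<close> and \<open>b + om\<close>. It is closed under \<open>om\<close> when
  \<open>a\<close> divides \<open>qf b\<close>, because
  \<open>om * (b + om) = (b + tr) * (b + om) - qf b\<close>. The range of \<open>b\<close> selects a
  representative modulo \<open>a\<close>.\<close>

definition lat_params :: "int \<Rightarrow> int \<Rightarrow> int \<Rightarrow> bool" where
  "lat_params g a b \<longleftrightarrow> g > 0 \<and> a > 0 \<and> 0 \<le> b \<and> b < a \<and> a dvd qf b"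

lemma lat_iff: "of_int u + of_int v * om \<in> lat g a b \<longleftrightarrow> (\<exists>x y. u = g * a * x + g * b * y \<and> v = g * y)"
proof
  assume "of_int u + of_int v * om \<in> lat g a b"
  then obtain x y where "of_int u + of_int v * om = of_int (g * a * x + g * b * y) + of_int (g * y) * om"
    by (auto simp: lat_def)
  from om_coords_unique[OF this] show "\<exists>x y. u = g * a * x + g * b * y \<and> v = g * y" by blast
qed (unfold lat_def, blast)

text \<open>Hermite normal form: \<open>g * a\<close> generates the integers in the ideal, \<open>g\<close> the \<open>om\<close>-coordinates.\<close>

lemma zideal_eq_lat:
  assumes "zideal I"
  shows "\<exists>g a b. lat_params g a b \<and> I = lat g a b"
proof -
  note I = zidealD[OF assms]
  note add = zmodule_add[OF I(1)] and mul = zmodule_mult[OF I(1)]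
  define S where "S = {n :: int. of_int n \<in> I}"
  define V where "V = {v :: int. \<exists>u. of_int u + of_int v * om \<in> I}"
  obtain z where z: "z \<in> I" "z \<noteq> 0" using I(4) by blast
  have zK: "z \<in> ZK" "z \<in> KK" using z I by auto
  \<comment> \<open>The norm of a nonzero element is a multiple of it by an integer of the field, so
    the ideal contains a nonzero rational integer.\<close>
  obtain n where n: "z * cj z = of_int n" using norm_Ints[OF zK(1)] by (auto elim: Ints_cases)
  have "n \<noteq> 0" using n z zK by (auto simp: cj_eq_0_iff)
  have "n \<in> S" using mul[OF cj_ZK[OF zK(1)] z(1)] n by (simp add: S_def mult.commute)
  have nV: "n \<in> V"
    using mul[OF om_ZK, of "of_int n"] \<open>n \<in> S\<close>
    by (auto simp: V_def S_def mult.commute intro!: exI[of _ 0])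
  have "\<exists>A>0. A \<in> S \<and> (\<forall>x\<in>S. A dvd x)"
    using add mul[OF ZK_of_int] \<open>n \<in> S\<close> \<open>n \<noteq> 0\<close>
    by (intro int_subgroup_generator[of S n]) (auto simp: S_def)
  then obtain A where A: "A > 0" "A \<in> S" "\<And>x. x \<in> S \<Longrightarrow> A dvd x" by blast
  have "\<exists>g>0. g \<in> V \<and> (\<forall>x\<in>V. g dvd x)"
  proof (rule int_subgroup_generator[OF _ _ nV \<open>n \<noteq> 0\<close>])
    fix v w assume "v \<in> V" "w \<in> V"
    then obtain u u' where "of_int u + of_int v * om \<in> I" "of_int u' + of_int w * om \<in> I" by (auto simp: V_def)
    from add[OF this] show "v + w \<in> V"
      by (auto simp: V_def intro!: exI[of _ "u + u'"]) (simp add: algebra_simps)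
  next
    fix v k assume "v \<in> V"
    then obtain u where "of_int u + of_int v * om \<in> I" by (auto simp: V_def)
    from mul[OF ZK_of_int[of k] this] show "k * v \<in> V"
      by (auto simp: V_def intro!: exI[of _ "k * u"]) (simp add: algebra_simps)
  qed
  then obtain g where g: "g > 0" "g \<in> V" "\<And>x. x \<in> V \<Longrightarrow> g dvd x" by blast
  obtain B where B: "of_int B + of_int g * om \<in> I" using g(2) by (auto simp: V_def)
  have "A \<in> V"
    using mul[OF om_ZK, of "of_int A"] A(2)
    by (auto simp: V_def S_def mult.commute intro!: exI[of _ 0])
  then obtain a where a: "A = g * a" using g(3) by blast
  \<comment> \<open>The \<open>om\<close>-coordinate of this product is \<open>B + g * tr\<close>;
    since \<open>g\<close> divides it, \<open>g\<close> divides \<open>B\<close>.\<close>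
  have "om * (of_int B + of_int g * om) = of_int B * om + of_int g * (om * om)" by (simp add: algebra_simps)
  also have "\<dots> = of_int (- (g * nm)) + of_int (B + g * tr) * om" by (simp add: om_square algebra_simps)
  finally have "B + g * tr \<in> V" using mul[OF om_ZK B] unfolding V_def by (metis (mono_tags, lifting) mem_Collect_eq)
  then have "g dvd B + g * tr" by (rule g(3))
  then have "g dvd B" by (simp add: dvd_add_left_iff)
  then obtain b0 where b0: "B = g * b0" by blast
  define b where "b = b0 mod a"
  have a0: "a > 0" using A(1) a g(1) by (simp add: zero_less_mult_iff)
  have AI: "of_int (A * k) \<in> I" for k
    using mul[OF ZK_of_int[of k], of "of_int A"] A(2) by (simp add: S_def mult.commute)
  have "of_int (g * b) + of_int g * om = (of_int B + of_int g * om) + of_int (A * (- (b0 div a)))"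
    by (simp add: b0 b_def a algebra_simps minus_div_mult_eq_mod[symmetric])
  then have bI: "of_int (g * b) + of_int g * om \<in> I" using add[OF B AI] by metis
  \<comment> \<open>Multiplying by the conjugate of \<open>b + om\<close> yields the rational
    integer \<open>g * qf b\<close>, so \<open>A = g * a\<close> divides it.\<close>
  have "(of_int b + of_int tr - om) * (of_int (g * b) + of_int g * om) = 
      of_int g * ((of_int b + om) * (of_int b + of_int tr - om))" by (simp add: algebra_simps)
  also have "\<dots> = of_int (g * qf b)" by (simp only: norm_om_shift of_int_mult)
  finally have "of_int (g * qf b) \<in> I"
    using mul[OF _ bI, of "of_int (b + tr) + of_int (-1) * om"] ZK_I[of "b + tr" "-1"] by simp
  then have "A dvd g * qf b" using A(3) by (simp add: S_def)
  then have "a dvd qf b" using a g(1) by simp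
  then have gp: "lat_params g a b" using g(1) a0 by (simp add: lat_params_def b_def)
  moreover have "I = lat g a b"
  proof (intro equalityI subsetI)
    fix x assume x: "x \<in> I"
    then have "x \<in> ZK" using I by auto
    then obtain u v where uv: "x = of_int u + of_int v * om" by (auto simp: ZK_iff)
    have "v \<in> V" using x uv by (auto simp: V_def)
    then obtain y where y: "v = g * y" using g(3) by blast
    have "x - of_int y * (of_int (g * b) + of_int g * om) \<in> I"
      using zmodule_diff[OF I(1) x mul[OF ZK_of_int bI]] .
    moreover have "x - of_int y * (of_int (g * b) + of_int g * om) = of_int (u - g * b * y)"
      by (simp add: uv y algebra_simps)
    ultimately have "u - g * b * y \<in> S" by (simp add: S_def)
    then obtain k where "u - g * b * y = A * k" using A(3) by blast
    then have "u = g * a * k + g * b * y" by (simp add: a)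
    then show "x \<in> lat g a b" unfolding uv using y lat_iff by blast
  next
    fix x assume "x \<in> lat g a b"
    then obtain k y where "x = of_int (g * a * k + g * b * y) + of_int (g * y) * om" by (auto simp: lat_def)
    then have "x = of_int (A * k) + of_int y * (of_int (g * b) + of_int g * om)"
      by (simp add: a algebra_simps)
    then show "x \<in> I" using add[OF AI mul[OF ZK_of_int bI]] by metis
  qed
  ultimately show ?thesis by blast
qed

text \<open>The form with coefficients \<open>a\<close>, \<open>2 * b + tr\<close>, \<open>c\<close>
  has the discriminant of the field, so a common prime \<open>p\<close> gives
  \<open>p\<^sup>2\<close> dividing \<open>d\<close> or \<open>4 * d\<close>. Squarefreeness
  excludes this except for \<open>p = 2\<close> with \<open>d\<close> not 1 modulo 4; there
  \<open>d\<close> would be congruent to the square of \<open>b\<close> modulo 4, hence 0 or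
  1.\<close>

lemma qf_primitive:
  assumes "qf b = a * c" "prime p" "p dvd a" "p dvd 2 * b + tr" "p dvd c"
  shows False
proof -
  have nsq: "\<not> p\<^sup>2 dvd d" 
    using squarefree_d assms(2) unfolding squarefree_def by (meson not_prime_unit)
  obtain x y z where xyz: "a = p * x" "2 * b + tr = p * y" "c = p * z" using assms(3-5) by (auto elim!: dvdE)
  have "(2 * b + tr)\<^sup>2 - 4 * qf b = p\<^sup>2 * (y\<^sup>2 - 4 * x * z)"
    unfolding assms(1) xyz(2) unfolding xyz(1,3) by (simp add: algebra_simps power2_eq_square)
  then have *: "p\<^sup>2 dvd (if d mod 4 = 1 then d else 4 * d)" unfolding discriminant_identity by simp
  show False
  proof (cases "d mod 4 = 1")
    case True then show False using * nsq by simp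
  next
    case False
    then have d4: "p\<^sup>2 dvd 4 * d" using * by simp
    show False
    proof (cases "p = 2")
      case True
      have "b * b - d = 4 * (x * z)"
        using assms(1) False by (simp add: qf_def tr_def nm_def xyz True power2_eq_square)
      have "b * b mod 4 = d mod 4" using \<open>b * b - d = 4 * (x * z)\<close> by presburger
      moreover have "b * b mod 4 = 0 \<or> b * b mod 4 = 1"
      proof (cases "even b")
        case True then obtain m where "b = 2 * m" by auto
        then show ?thesis by (simp add: mod_eq_0_iff_dvd)
      next
        case False then obtain m where "b = 2 * m + 1" by (auto elim: oddE)
        then have "b * b = 4 * (m * m + m) + 1" by (simp add: algebra_simps)
        then show ?thesis by presburger
      qed
      ultimately show False using False d_mod_4 by auto
    next
      case np: False
      have "coprime p 2" using assms(2) np by (intro primes_coprime) auto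
      then have "coprime (p\<^sup>2) (2\<^sup>2)" unfolding coprime_power_left_iff coprime_power_right_iff by blast
      then have "p\<^sup>2 dvd d" using d4 by (simp add: coprime_dvd_mult_right_iff)
      then show False using nsq by simp
    qed
  qed
qed

text \<open>The product is \<open>g\<^sup>2 a\<close> times the ideal generated by \<open>a\<close>, \<open>2 b + tr\<close>, \<open>qf b div a\<close> and others;
  these three have no common prime factor because the discriminant is fundamental.\<close>

lemma prd_cj_lat:
  assumes "zideal (lat g a b)" "lat_params g a b"
  shows "prd (lat g a b) (cj ` lat g a b) = scale (of_int (g\<^sup>2 * a)) ZK"
proof -
  define I where "I = lat g a b"
  note I = zidealD[OF assms(1)[folded I_def]]
  have zm: "zmodule (prd I (cj ` I))" using I by (simp add: zmodule_prd zmodule_cj)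
  obtain c where c: "qf b = a * c" using assms(2) by (auto simp: lat_params_def)
  have e1: "of_int (g * a) \<in> I" using lat_iff[of "g * a" 0 g a b, THEN iffD2] by (force simp: I_def)
  have e2: "of_int (g * b) + of_int g * om \<in> I"
    using lat_iff[of "g * b" g g a b, THEN iffD2, OF exI[of _ 0], OF exI[of _ 1]] by (simp add: I_def)
  have e3: "of_int (g * a) \<in> cj ` I" using imageI[OF e1, of cj] by (simp only: cj_of_int)
  have e4: "of_int (g * b) + of_int g * (of_int tr - om) \<in> cj ` I"
    using imageI[OF e2, of cj] by (simp only: cj_om_coords)
  have p1: "of_int (g\<^sup>2 * a * a) \<in> prd I (cj ` I)"
    using prd_I[OF e1 e3] by (simp add: power2_eq_square mult_ac)
  have "(of_int (g * b) + of_int g * om) * of_int (g * a) + of_int (g * a) * (of_int (g * b) + of_int g * (of_int tr - om))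
     = of_int (g\<^sup>2 * a * (2 * b + tr))" by (simp add: power2_eq_square algebra_simps)
  then have p2: "of_int (g\<^sup>2 * a * (2 * b + tr)) \<in> prd I (cj ` I)"
    using prd_add[OF prd_I[OF e2 e3] prd_I[OF e1 e4]] by simp
  have "(of_int (g * b) + of_int g * om) * (of_int (g * b) + of_int g * (of_int tr - om))
     = of_int (g\<^sup>2) * ((of_int b + om) * (of_int b + of_int tr - om))" by (simp add: power2_eq_square algebra_simps)
  also have "\<dots> = of_int (g\<^sup>2 * a * c)" by (simp only: norm_om_shift c of_int_mult mult.assoc)
  finally have p3: "of_int (g\<^sup>2 * a * c) \<in> prd I (cj ` I)" using prd_I[OF e2 e4] by simp
  obtain x y z where xyz: "x * a + y * (2 * b + tr) + z * c = 1"
    using bezout3_int[of a "2 * b + tr" c] qf_primitive[OF c] by blast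
  have "of_int (g\<^sup>2 * a) = real_of_int (g\<^sup>2 * a * (x * a + y * (2 * b + tr) + z * c))" by (simp add: xyz)
  also have "\<dots> = of_int x * of_int (g\<^sup>2 * a * a) + of_int y * of_int (g\<^sup>2 * a * (2 * b + tr)) + of_int z * of_int (g\<^sup>2 * a * c)"
    by (simp add: algebra_simps)
  also have "\<dots> \<in> prd I (cj ` I)"
    by (intro zmodule_add[OF zm] zmodule_mult[OF zm ZK_of_int] p1 p2 p3)
  finally have N: "of_int (g\<^sup>2 * a) \<in> prd I (cj ` I)" .
  have "prd I (cj ` I) = scale (of_int (g\<^sup>2 * a)) ZK"
  proof (intro equalityI prd_subsetI subsetI)
    fix u assume "u \<in> scale (of_int (g\<^sup>2 * a)) ZK"
    then show "u \<in> prd I (cj ` I)" using zmodule_mult[OF zm _ N] by (auto simp: scale_def mult.commute)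
  next
    fix u v assume "u \<in> scale (of_int (g\<^sup>2 * a)) ZK" "v \<in> scale (of_int (g\<^sup>2 * a)) ZK"
    then show "u + v \<in> scale (of_int (g\<^sup>2 * a)) ZK"
      using zmodule_add[OF zmodule_scale[OF zmodule_ZK Rats_KK]] by auto
  next
    fix u v assume "u \<in> I" "v \<in> cj ` I"
    then obtain w where w: "w \<in> I" "v = cj w" by blast
    obtain x y where u: "u = of_int (g * a * x + g * b * y) + of_int (g * y) * om"
      using \<open>u \<in> I\<close> by (auto simp: I_def lat_def)
    obtain x' y' where w': "w = of_int (g * a * x' + g * b * y') + of_int (g * y') * om"
      using w(1) by (auto simp: I_def lat_def)
    \<comment> \<open>The quotient of \<open>u * v\<close> by \<open>g\<^sup>2 * a\<close>: of the
      four products of basis vectors, three contain the factor \<open>a\<close> and the fourth is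
      the norm \<open>qf b = a * c\<close>.\<close>
    define z where "z = of_int (a * x * x') + of_int (x * y') * (of_int (b + tr) + of_int (-1) * om) +
      of_int (x' * y) * (of_int b + of_int 1 * om) + of_int (c * y * y')"
    have zZ: "z \<in> ZK" unfolding z_def by (intro ZK_add ZK_mult ZK_of_int ZK_I)
    have "u * v = of_int (g\<^sup>2) * (of_int (a * a * x * x') + of_int (a * x * y') * (of_int b + of_int tr - om)
        + of_int (a * x' * y) * (of_int b + om) + of_int (y * y') * ((of_int b + om) * (of_int b + of_int tr - om)))"
      unfolding w(2) w' cj_om_coords u by (simp add: power2_eq_square algebra_simps)
    also have "\<dots> = of_int (g\<^sup>2 * a) * z"
      unfolding norm_om_shift c z_def by (simp add: algebra_simps)
    finally show "u * v \<in> scale (of_int (g\<^sup>2 * a)) ZK" using zZ by (auto simp: scale_def)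
  qed
  then show ?thesis by (simp add: I_def)
qed

end

section \<open>Norms and small elements\<close>

context real_quadratic
begin

section \<open>The norm, residue classes and small elements of an ideal\<close>

lemma scale_of_int_subset_imp_dvd:
  fixes m n :: int
  assumes "scale (of_int m) ZK \<subseteq> scale (of_int n) ZK"
  shows "n dvd m"
proof (cases "n = 0")
  case True
  have "of_int m \<in> scale (of_int m) ZK" by (auto simp: scale_def intro!: image_eqI[of _ _ 1])
  then have "of_int m \<in> scale (of_int n) ZK" using assms by blast
  then show ?thesis using True by (auto simp: scale_def)
next
  case False
  have "of_int m \<in> scale (of_int m) ZK" by (auto simp: scale_def intro!: image_eqI[of _ _ 1])
  then obtain z where z: "z \<in> ZK" "of_int m = of_int n * z" using assms by (auto simp: scale_def)
  then have "z = of_int m / of_int n" using False by (simp add: field_simps)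
  then have "z \<in> \<rat>" by simp
  then obtain k where "z = of_int k" using Rats_ZK_Ints[OF z(1)] by (auto elim: Ints_cases)
  then have "real_of_int m = of_int (n * k)" using z(2) by simp
  then have "m = n * k" by (rule of_int_eq_iff[THEN iffD1])
  then show ?thesis by simp
qed

text \<open>Defined by this identity, the norm is multiplicative by commutativity alone. Agreement
  with the number of residue classes is \<open>ideal_norm_eq_idnorm\<close>.\<close>

definition idnorm :: "real set \<Rightarrow> int" where
  "idnorm I = (THE n. n > 0 \<and> prd I (cj ` I) = scale (of_int n) ZK)"

lemma idnorm_eqI:
  assumes "n > 0" "prd I (cj ` I) = scale (of_int n) ZK"
  shows "idnorm I = n"
  unfolding idnorm_def
proof (rule the_equality)
  show "n > 0 \<and> prd I (cj ` I) = scale (of_int n) ZK" using assms by simp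
  fix m assume "m > 0 \<and> prd I (cj ` I) = scale (of_int m) ZK"
  then have "m > 0" "scale (of_int m) ZK = scale (of_int n) ZK" using assms by auto
  then have "m dvd n" "n dvd m" using scale_of_int_subset_imp_dvd by auto
  then show "m = n" using \<open>m > 0\<close> assms(1) by (simp add: zdvd_antisym_nonneg)
qed

lemma idnorm_lat: "zideal (lat g a b) \<Longrightarrow> lat_params g a b \<Longrightarrow> idnorm (lat g a b) = g\<^sup>2 * a"
  by (rule idnorm_eqI) (auto simp: lat_params_def prd_cj_lat)

lemma
  assumes "zideal I"
  shows idnorm_pos: "idnorm I > 0" and prd_cj: "prd I (cj ` I) = scale (of_int (idnorm I)) ZK"
proof -
  obtain g a b where *: "lat_params g a b" "I = lat g a b" using zideal_eq_lat[OF assms] by blast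
  have "idnorm I = g\<^sup>2 * a" using idnorm_lat assms * by simp
  then show "idnorm I > 0" "prd I (cj ` I) = scale (of_int (idnorm I)) ZK"
    using * assms prd_cj_lat by (auto simp: lat_params_def)
qed

lemma idnorm_prd:
  assumes "zideal I" "zideal J"
  shows "idnorm (prd I J) = idnorm I * idnorm J"
proof (rule idnorm_eqI)
  have "prd (prd I J) (cj ` prd I J) = prd (prd I (cj ` I)) (prd J (cj ` J))"
    using assms zidealD(3) by (simp add: cj_prd prd_ac)
  also have "\<dots> = scale (of_int (idnorm I * idnorm J)) ZK"
    using assms by (simp add: prd_cj prd_scale prd_scale_right scale_scale prd_ZK zmodule_ZK mult.commute)
  finally show "prd (prd I J) (cj ` prd I J) = scale (of_int (idnorm I * idnorm J)) ZK" .
qed (use assms idnorm_pos in simp)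

lemma idnorm_ZK: "idnorm ZK = 1"
  by (rule idnorm_eqI) (simp_all add: cj_image_ZK prd_ZK zmodule_ZK)

text \<open>For \<open>lat g a b\<close>, the integer points with coordinates below
  \<open>g * a\<close> and \<open>g\<close> form a fundamental domain: reduce the
  \<open>om\<close>-coordinate first, then the rational one.\<close>

lemma zideal_residues:
  assumes "zideal I"
  shows "\<exists>R\<subseteq>ZK. finite R \<and> card R = nat (idnorm I) \<and> (\<forall>z\<in>ZK. \<exists>r\<in>R. z - r \<in> I) \<and>
    (\<forall>r\<in>R. \<forall>r'\<in>R. r - r' \<in> I \<longrightarrow> r = r')"
proof -
  obtain g a b where *: "lat_params g a b" "I = lat g a b" using zideal_eq_lat[OF assms] by blast
  have g: "g > 0" "a > 0" using * by (auto simp: lat_params_def)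
  define f :: "int \<times> int \<Rightarrow> real" where "f = (\<lambda>(x, y). of_int x + of_int y * om)"
  define R where "R = f ` ({0..<g * a} \<times> {0..<g})"
  have inj: "inj f" using om_coords_unique by (auto simp: inj_on_def f_def)
  have "card R = card ({0..<g * a} \<times> {0..<g})" unfolding R_def by (rule card_image[OF inj_on_subset[OF inj]]) simp
  also have "\<dots> = nat (idnorm I)"
    using idnorm_lat[of g a b] assms * g by (simp add: card_cartesian_product power2_eq_square nat_mult_distrib mult_ac)
  finally have card: "card R = nat (idnorm I)" .
  have cover: "\<exists>r\<in>R. z - r \<in> I" if z: "z \<in> ZK" for z
  proof -
    obtain u v where uv: "z = of_int u + of_int v * om" using z by (auto simp: ZK_iff)
    define y where "y = v div g"
    define w where "w = u - g * b * y"
    define x where "x = w div (g * a)"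
    have "f (w mod (g * a), v mod g) \<in> R" using g by (auto simp: R_def)
    moreover have "z - f (w mod (g * a), v mod g) = of_int (g * a * x + g * b * y) + of_int (g * y) * om"
    proof -
      have "u - w mod (g * a) = g * a * x + g * b * y" "v - v mod g = g * y"
        using mod_mult_div_eq[of w "g * a"] mod_mult_div_eq[of v g] w_def
        unfolding x_def y_def by linarith+
      moreover have "z - f (w mod (g * a), v mod g) = of_int (u - w mod (g * a)) + of_int (v - v mod g) * om"
        by (simp add: uv f_def algebra_simps)
      ultimately show ?thesis by simp
    qed
    ultimately show ?thesis using * by (auto simp: lat_def)
  qed
  have sep: "r = r'" if r: "r \<in> R" "r' \<in> R" "r - r' \<in> I" for r r'
  proof -
    obtain x y where xy: "r = of_int x + of_int y * om" "x \<in> {0..<g*a}" "y \<in> {0..<g}" using r by (auto simp: R_def f_def)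
    obtain x' y' where xy': "r' = of_int x' + of_int y' * om" "x' \<in> {0..<g*a}" "y' \<in> {0..<g}" using r by (auto simp: R_def f_def)
    have "of_int (x - x') + of_int (y - y') * om \<in> lat g a b" using r(3) *(2) by (simp add: xy xy' algebra_simps)
    then obtain k m where km: "x - x' = g * a * k + g * b * m" "y - y' = g * m" unfolding lat_iff by blast
    have "y mod g = y' mod g" using km(2) by (metis mod_mult_self2 diff_add_cancel add.commute)
    then have "y = y'" using xy xy' by simp
    then have "m = 0" using km(2) g by simp
    then have "x mod (g * a) = x' mod (g * a)" using km(1) by (metis mod_mult_self2 diff_add_cancel add.commute mult_zero_right add_0_right)
    then have "x = x'" using xy xy' by simp
    then show "r = r'" using \<open>y = y'\<close> xy xy' by simp
  qed
  have "R \<subseteq> ZK" "finite R" using ZK_I by (auto simp: R_def f_def)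
  then show ?thesis using card cover sep by blast
qed

lemma ideal_norm_eq_idnorm:
  assumes "zideal I"
  shows "int (ideal_norm d I) = idnorm I"
proof -
  note zm = zidealD(1)[OF assms]
  obtain R where R: "R \<subseteq> ZK" "finite R" "card R = nat (idnorm I)" "\<forall>z\<in>ZK. \<exists>r\<in>R. z - r \<in> I"
    "\<forall>r\<in>R. \<forall>r'\<in>R. r - r' \<in> I \<longrightarrow> r = r'"
    using zideal_residues[OF assms] by blast
  define cs where "cs z = (\<lambda>h. h + z) ` I" for z :: real
  have cs: "I +>\<^bsub>ring_of_integers d\<^esub> z = cs z" for z
    by (auto simp: a_r_coset_def' cs_def ring_of_integers_def quad_field_def)
  have eq: "cs z = cs w \<longleftrightarrow> z - w \<in> I" for z w
  proof
    assume "cs z = cs w"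
    moreover have "0 + z \<in> cs z" using zmodule_0[OF zm] by (auto simp: cs_def)
    ultimately obtain h where "z = h + w" "h \<in> I" by (auto simp: cs_def)
    then show "z - w \<in> I" by simp
  next
    assume zw: "z - w \<in> I"
    have "h + z \<in> cs w" if "h \<in> I" for h
      unfolding cs_def by (rule image_eqI[of _ _ "h + (z - w)"]) (use zmodule_add[OF zm that zw] in auto)
    moreover have "h + w \<in> cs z" if "h \<in> I" for h
      unfolding cs_def by (rule image_eqI[of _ _ "h - (z - w)"]) (use zmodule_diff[OF zm that zw] in auto)
    ultimately show "cs z = cs w" by (auto simp: cs_def)
  qed
  have "carrier (ring_of_integers d Quot I) = cs ` ZK"
    by (auto simp: FactRing_def A_RCOSETS_def' cs)
  also have "\<dots> = cs ` R" using R(1,4) eq by blast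
  finally have "ideal_norm d I = card (cs ` R)" by (simp add: ideal_norm_def)
  also have "\<dots> = card R" using R(5) eq by (intro card_image) (auto simp: inj_on_def)
  finally show ?thesis using R(3) idnorm_pos[OF assms] by simp
qed

lemma om_bounds: "\<bar>om\<bar> \<le> rt" "\<bar>of_int tr - om\<bar> \<le> rt"
  using rt_ge_1 by (auto simp: om_def tr_def)

text \<open>A box with sides \<open>X\<close> and \<open>Y\<close>, where \<open>X * Y\<close> is
  the norm, contains more integer points than there are residue classes; \<alpha> is the difference
  of two congruent points. The choice \<open>X = Y * rt\<close> balances the two coordinates, as
  \<open>om\<close> and its conjugate are at most \<open>rt\<close> in absolute value.\<close>

lemma zideal_small_element:
  assumes "zideal I"
  shows "\<exists>\<alpha>\<in>I. \<alpha> \<noteq> 0 \<and> \<bar>\<alpha>\<bar> \<le> 2 * sqrt (of_int (idnorm I) * rt) \<and> \<bar>cj \<alpha>\<bar> \<le> 2 * sqrt (of_int (idnorm I) * rt)"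
proof -
  define n where "n = idnorm I"
  have n: "n > 0" using idnorm_pos[OF assms] by (simp add: n_def)
  have rt0: "rt > 0" using rt_ge_1 by linarith
  obtain R where R: "R \<subseteq> ZK" "finite R" "card R = nat n" "\<forall>z\<in>ZK. \<exists>r\<in>R. z - r \<in> I"
    using zideal_residues[OF assms] n_def by blast
  define X where "X = sqrt (of_int n * rt)"
  define Y where "Y = sqrt (of_int n / rt)"
  have XY: "X \<ge> 0" "Y \<ge> 0" "X * Y = of_int n" "Y * rt = X"
  proof -
    show "X \<ge> 0" "Y \<ge> 0" using n rt0 by (auto simp: X_def Y_def)
    have "X * Y = sqrt ((of_int n * rt) * (of_int n / rt))" by (simp only: X_def Y_def real_sqrt_mult)
    also have "(of_int n * rt) * (of_int n / rt) = (of_int n)\<^sup>2" using rt0 by (simp add: field_simps power2_eq_square)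
    finally show "X * Y = of_int n" using n by simp
    have "Y * rt = sqrt (of_int n / rt) * sqrt (rt\<^sup>2)" using rt0 by (simp add: Y_def)
    also have "\<dots> = sqrt (of_int n / rt * rt\<^sup>2)" by (simp only: real_sqrt_mult)
    also have "of_int n / rt * rt\<^sup>2 = of_int n * rt" using rt0 by (simp add: field_simps power2_eq_square)
    finally show "Y * rt = X" by (simp add: X_def)
  qed
  define f :: "int \<times> int \<Rightarrow> real" where "f = (\<lambda>(x, y). of_int x + of_int y * om)"
  define B where "B = {0..\<lfloor>X\<rfloor>} \<times> {0..\<lfloor>Y\<rfloor>}"
  define h where "h p = (SOME r. r \<in> R \<and> f p - r \<in> I)" for p
  have h: "h p \<in> R \<and> f p - h p \<in> I" for p
  proof -
    have "\<exists>r. r \<in> R \<and> f p - r \<in> I" using R(4) ZK_I by (auto simp: f_def split: prod.splits)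
    then show ?thesis unfolding h_def by (rule someI_ex)
  qed
  have fl: "\<lfloor>X\<rfloor> \<ge> 0" "\<lfloor>Y\<rfloor> \<ge> 0" using XY by auto
  have "real_of_int n < (of_int \<lfloor>X\<rfloor> + 1) * (of_int \<lfloor>Y\<rfloor> + 1)"
    unfolding XY(3)[symmetric] using XY(1,2) by (intro mult_strict_mono) (auto simp: add_nonneg_pos)
  then have "real_of_int n < of_int ((\<lfloor>X\<rfloor> + 1) * (\<lfloor>Y\<rfloor> + 1))" by simp
  then have "n < (\<lfloor>X\<rfloor> + 1) * (\<lfloor>Y\<rfloor> + 1)" by (rule of_int_less_iff[THEN iffD1])
  then have "card R < card B"
    using fl R(3) n by (simp add: B_def card_cartesian_product nat_mult_distrib[symmetric])
  moreover have "card (h ` B) \<le> card R" using h R(2) by (intro card_mono) auto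
  ultimately have "\<not> inj_on h B" by (intro pigeonhole) linarith
  then obtain p p' where p: "p \<in> B" "p' \<in> B" "p \<noteq> p'" "h p = h p'" by (auto simp: inj_on_def)
  obtain x y x' y' where xy: "p = (x, y)" "p' = (x', y')" by (cases p, cases p') auto
  define \<alpha> where "\<alpha> = of_int (x - x') + of_int (y - y') * om"
  have "\<alpha> = (f p - h p) - (f p' - h p')" using p(4) by (simp add: \<alpha>_def f_def xy algebra_simps)
  then have "\<alpha> \<in> I" using zmodule_diff[OF zidealD(1)[OF assms]] h by metis
  moreover have "\<alpha> \<noteq> 0"
  proof
    assume "\<alpha> = 0"
    then have "x - x' = 0 \<and> y - y' = 0" using om_coords_unique[of "x - x'" "y - y'" 0 0] by (simp add: \<alpha>_def)
    then show False using p(3) xy by simp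
  qed
  moreover have bd: "\<bar>of_int (x - x') + of_int (y - y') * t\<bar> \<le> 2 * X" if t: "\<bar>t\<bar> \<le> rt" for t :: real
  proof -
    have "\<bar>x - x'\<bar> \<le> \<lfloor>X\<rfloor>" "\<bar>y - y'\<bar> \<le> \<lfloor>Y\<rfloor>" using p(1,2) xy by (auto simp: B_def)
    then have "\<bar>real_of_int (x - x')\<bar> \<le> X" "\<bar>real_of_int (y - y')\<bar> \<le> Y" by linarith+
    then have "\<bar>real_of_int (y - y')\<bar> * \<bar>t\<bar> \<le> Y * rt" using t XY by (intro mult_mono) auto
    then have "\<bar>real_of_int (y - y') * t\<bar> \<le> X" using XY by (simp add: abs_mult)
    then show ?thesis using \<open>\<bar>real_of_int (x - x')\<bar> \<le> X\<close> by linarith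
  qed
  moreover have "cj \<alpha> = of_int (x - x') + of_int (y - y') * (of_int tr - om)"
    unfolding \<alpha>_def by (rule cj_om_coords)
  ultimately show ?thesis
    using bd[OF om_bounds(1)] bd[OF om_bounds(2)] unfolding \<alpha>_def X_def n_def by auto
qed

end

section \<open>Counting ideals of bounded norm\<close>

text \<open>Each term is at most twice the increment of the square root, so the sum
  telescopes.\<close>

lemma sum_inverse_sqrt_le: "(\<Sum>f=1..n. 1 / sqrt (real f)) \<le> 2 * sqrt (real n)"
proof (induction n)
  case (Suc n)
  define s t where "s = sqrt (real n)" and "t = sqrt (real (Suc n))"
  have st: "s \<ge> 0" "t > 0" "t * t = s * s + 1" by (auto simp: s_def t_def)
  have "0 \<le> (t - s) * (t - s)" by simp
  then have "2 * s * t \<le> t * t + s * s" by (simp add: algebra_simps)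
  then have "1 / t \<le> 2 * t - 2 * s" using st by (simp add: field_simps)
  then show ?case using Suc by (simp add: s_def t_def)
qed simp

text \<open>Telescoping; the induction needs the sharper bound \<open>2 - 1 / n\<close>.\<close>

lemma sum_inverse_square_le: "(\<Sum>g=1..n. 1 / (real g)\<^sup>2) \<le> 2"
proof -
  have "(\<Sum>g=1..Suc n. 1 / (real g)\<^sup>2) \<le> 2 - 1 / real (Suc n)" for n
  proof (induction n)
    case (Suc n)
    have "1 / (real (Suc (Suc n)))\<^sup>2 \<le> 1 / (real (Suc n) * real (Suc (Suc n)))"
      by (intro divide_left_mono) (auto simp: power2_eq_square intro!: mult_right_mono)
    also have "\<dots> = 1 / real (Suc n) - 1 / real (Suc (Suc n))" by (simp add: divide_simps)
    finally show ?case using Suc by simp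
  qed simp
  from this[of "n - 1"] show ?thesis by (cases n) (auto intro: order_trans)
qed

text \<open>Write each \<open>a\<close> with a divisor \<open>e\<close> as \<open>a = e * f\<close>
  and exchange the order of summation.\<close>

lemma sum_card_divisors:
  fixes h :: "nat \<Rightarrow> real"
  shows "(\<Sum>a=1..n. real (card {e. e dvd a}) * h a) = (\<Sum>e=1..n. \<Sum>f=1..n div e. h (e * f))"
proof -
  have le: "b \<le> n" if "b * k \<le> n" "0 < k" for b k :: nat using that by (cases k) auto
  have "(\<Sum>a=1..n. real (card {e. e dvd a}) * h a) = (\<Sum>a=1..n. \<Sum>e\<in>{e. e dvd a}. h a)" by simp
  also have "\<dots> = (\<Sum>(a, e)\<in>(SIGMA a:{1..n}. {e. e dvd a}). h a)"
    by (intro sum.Sigma) auto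
  also have "\<dots> = (\<Sum>(e, f)\<in>(SIGMA e:{1..n}. {1..n div e}). h (e * f))"
    by (rule sum.reindex_bij_witness[where i = "\<lambda>(e, f). (e * f, e)" and j = "\<lambda>(a, e). (e, a div e)"])
      (auto simp: Suc_le_eq div_le_mono less_eq_div_iff_mult_less_eq mult.commute dvd_imp_le
        intro: Nat.gr0I le elim!: dvdE)
  also have "\<dots> = (\<Sum>e=1..n. \<Sum>f=1..n div e. h (e * f))"
    by (intro sum.Sigma[symmetric]) auto
  finally show ?thesis .
qed

text \<open>The inner sum over the cofactor is at most \<open>2 * sqrt (Y / e)\<close>, which leaves
  a harmonic sum over \<open>e\<close>. The separate bound \<open>M\<close> makes the logarithm
  uniform when \<open>n\<close> and \<open>Y\<close> vary with \<open>g\<close>.\<close>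

lemma sum_card_divisors_inverse_sqrt_le:
  assumes "Y \<ge> 0" "real n \<le> Y" "n \<le> M" "M \<ge> 1"
  shows "(\<Sum>a=1..n. real (card {e. e dvd a}) * (1 / sqrt (real a))) \<le> 2 * sqrt Y * (1 + ln (real M))"
proof -
  have "(\<Sum>a=1..n. real (card {e. e dvd a}) * (1 / sqrt (real a)))
      = (\<Sum>e=1..n. \<Sum>f=1..n div e. 1 / sqrt (real (e * f)))" by (rule sum_card_divisors)
  also have "\<dots> = (\<Sum>e=1..n. 1 / sqrt (real e) * (\<Sum>f=1..n div e. 1 / sqrt (real f)))"
    by (simp add: sum_distrib_left real_sqrt_mult)
  also have "\<dots> \<le> (\<Sum>e=1..n. 1 / sqrt (real e) * (2 * (sqrt Y / sqrt (real e))))"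
  proof (intro sum_mono mult_left_mono)
    fix e assume "e \<in> {1..n}"
    have "(\<Sum>f=1..n div e. 1 / sqrt (real f)) \<le> 2 * sqrt (real (n div e))" by (rule sum_inverse_sqrt_le)
    also have "real (n div e) \<le> real n / real e" 
      using of_int_floor_le[of "real n / real e"] unfolding floor_divide_of_nat_eq by simp
    also have "\<dots> \<le> Y / real e" using assms by (intro divide_right_mono) auto
    finally show "(\<Sum>f=1..n div e. 1 / sqrt (real f)) \<le> 2 * (sqrt Y / sqrt (real e))"
      by (simp add: real_sqrt_divide)
  qed simp
  also have "\<dots> = 2 * sqrt Y * (\<Sum>e=1..n. 1 / real e)"
    unfolding sum_distrib_left
    by (intro sum.cong) (auto simp: field_simps)
  also have "(\<Sum>e=1..n. 1 / real e) \<le> (\<Sum>e=1..M. 1 / real e)"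
    using assms by (intro sum_mono2) auto
  also have "\<dots> = harm M" by (simp add: harm_def inverse_eq_divide)
  \<comment> \<open>The sequence \<open>harm n - ln n\<close> decreases from its value 1 at
    \<open>n = 1\<close>.\<close>
  also have "harm M \<le> 1 + ln (real M)" using euler_mascheroni_sequence_decreasing[of 1 M] assms by (simp add: harm_expand)
  finally show ?thesis using assms by (simp add: mult_left_mono)
qed

text \<open>Every divisor \<open>e\<close> of \<open>m\<close> gives the two divisors
  \<open>e\<close> and \<open>p * e\<close> of \<open>n\<close>, and \<open>p * e\<close> does not
  divide \<open>m\<close>.\<close>

lemma card_divisors_prime_power_mult:
  fixes p m n k :: nat
  assumes "prime p" "\<not> p dvd m" "m > 0" "n = p ^ k * m" "k > 0"
  shows "2 * card {e. e dvd m} \<le> card {e. e dvd n}"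
proof -
  have fin: "finite {e. e dvd m}" "finite {e. e dvd n}" using assms prime_gt_0_nat[of p] by auto
  have inj: "inj_on ((*) p) {e. e dvd m}" using assms(1) by (auto simp: inj_on_def)
  have disj: "{e. e dvd m} \<inter> (*) p ` {e. e dvd m} = {}"
    using assms(2) by (auto dest: dvd_mult_left)
  have "p dvd p ^ k" using assms(5) by simp
  then have sub: "{e. e dvd m} \<union> (*) p ` {e. e dvd m} \<subseteq> {e. e dvd n}"
    unfolding assms(4) by (auto intro: mult_dvd_mono)
  have "2 * card {e. e dvd m} = card ({e. e dvd m} \<union> (*) p ` {e. e dvd m})"
    using fin disj by (simp add: card_Un_disjoint card_image[OF inj])
  also have "\<dots> \<le> card {e. e dvd n}" using fin sub by (intro card_mono)
  finally show ?thesis .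
qed

section \<open>Roots of the norm polynomial modulo an integer, and the number of cells\<close>

context real_quadratic
begin

text \<open>The values of \<open>b\<close> that \<open>lat_params\<close> admits for given
  \<open>a\<close>; their number bounds the ideals \<open>lat g a b\<close> with fixed
  \<open>g\<close> and \<open>a\<close>.\<close>

definition qf_roots :: "nat \<Rightarrow> int set" where
  "qf_roots a = {b. 0 \<le> b \<and> b < int a \<and> int a dvd qf b}"

lemma finite_qf_roots: "finite (qf_roots a)"
  by (rule finite_subset[of _ "{0..<int a}"]) (auto simp: qf_roots_def)

lemma qf_diff: "qf b - qf b' = (b - b') * (b + b' + tr)"
  by (simp add: qf_def algebra_simps power2_eq_square)

lemma dvd_qf_mod: "c dvd a \<Longrightarrow> c dvd qf (b mod a) \<longleftrightarrow> c dvd qf b"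
proof -
  assume "c dvd a"
  then have "c dvd b - b mod a" by (simp add: minus_mod_eq_mult_div)
  then have "c dvd qf b - qf (b mod a)" unfolding qf_diff by simp
  then show ?thesis by (metis dvd_diff_commute dvd_diff_right_iff dvd_add_left_iff diff_add_cancel)
qed

text \<open>For two roots, the prime power divides \<open>(b - b1) * (b + b1 + tr)\<close>. If the
  prime does not divide both factors, the power divides one, so \<open>b\<close> is
  \<open>b1\<close> or its conjugate \<open>- b1 - tr\<close>. If it does, it divides
  \<open>2 * b1 + tr\<close>, and \<open>qf_primitive\<close> forces \<open>k = 1\<close>, where
  divisibility by the prime is enough.\<close>

lemma card_qf_roots_prime_power:
  assumes "prime p" "k > 0"
  shows "card (qf_roots (p ^ k)) \<le> 2"
proof (cases "qf_roots (p ^ k) = {}")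
  case False
  define P where "P = int p"
  have P: "prime P" using assms by (simp add: P_def)
  define q where "q = P ^ k"
  have q: "int (p ^ k) = q" "q > 0" using prime_gt_0_int[OF P] by (auto simp: q_def P_def)
  obtain b1 where b1: "b1 \<in> qf_roots (p ^ k)" using False by blast
  have b1q: "q dvd qf b1" using b1 q by (simp add: qf_roots_def)
  have "b \<in> {b1 mod q, (- b1 - tr) mod q}" if b: "b \<in> qf_roots (p ^ k)" for b
  proof -
    have bb: "0 \<le> b" "b < q" "q dvd qf b" using b q by (auto simp: qf_roots_def)
    have dv: "q dvd (b - b1) * (b + b1 + tr)" using bb(3) b1q by (simp flip: qf_diff)
    have "q dvd b - b1 \<or> q dvd b + b1 + tr"
    proof (cases "P dvd b - b1 \<and> P dvd b + b1 + tr")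
      case False
      then have "coprime P (b - b1) \<or> coprime P (b + b1 + tr)" using P prime_imp_coprime by blast
      then have "coprime q (b - b1) \<or> coprime q (b + b1 + tr)" by (auto simp: q_def)
      then show ?thesis using dv by (auto simp: coprime_dvd_mult_left_iff coprime_dvd_mult_right_iff)
    next
      case True
      then have "P dvd (b + b1 + tr) - (b - b1)" by (metis dvd_diff)
      then have P2: "P dvd 2 * b1 + tr" by (simp add: algebra_simps)
      have "k = 1"
      proof (rule ccontr)
        assume "k \<noteq> 1"
        then have "P\<^sup>2 dvd q" using assms(2) unfolding q_def by (intro le_imp_power_dvd) simp
        then have "P\<^sup>2 dvd qf b1" using b1q by (rule dvd_trans)
        then obtain c where "qf b1 = P * (P * c)" unfolding power2_eq_square mult.assoc by (elim dvdE) (simp only: mult.assoc)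
        then show False using qf_primitive[of b1 P "P * c" P] P P2 by simp
      qed
      then show ?thesis using True by (simp add: q_def)
    qed
    then show ?thesis
    proof
      assume "q dvd b - b1"
      then have "b mod q = b1 mod q" by (simp add: mod_eq_dvd_iff)
      then show ?thesis using bb by simp
    next
      assume "q dvd b + b1 + tr"
      then have "b mod q = (- b1 - tr) mod q" by (simp add: mod_eq_dvd_iff algebra_simps)
      then show ?thesis using bb by simp
    qed
  qed
  then have "card (qf_roots (p ^ k)) \<le> card {b1 mod q, (- b1 - tr) mod q}" by (intro card_mono) auto
  also have "\<dots> \<le> 2" by (simp add: card_insert_if)
  finally show ?thesis .
qed simp

text \<open>The injective half of the Chinese remainder theorem.\<close>

lemma card_qf_roots_mult:
  assumes "coprime m n" "m > 0" "n > 0"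
  shows "card (qf_roots (m * n)) \<le> card (qf_roots m) * card (qf_roots n)"
proof -
  define h where "h b = (b mod int m, b mod int n)" for b
  have "inj_on h (qf_roots (m * n))"
  proof (rule inj_onI)
    fix b b' assume b: "b \<in> qf_roots (m * n)" "b' \<in> qf_roots (m * n)" "h b = h b'"
    then have "int m dvd b - b'" "int n dvd b - b'" by (auto simp: h_def mod_eq_dvd_iff)
    then have "int m * int n dvd b - b'" using assms(1) by (intro divides_mult) auto
    then have "b mod (int m * int n) = b' mod (int m * int n)" by (simp add: mod_eq_dvd_iff)
    then show "b = b'" using b by (simp add: qf_roots_def)
  qed
  moreover have "h ` qf_roots (m * n) \<subseteq> qf_roots m \<times> qf_roots n"
    using assms by (auto simp: h_def qf_roots_def dvd_qf_mod dest: dvd_mult_left dvd_mult_right)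
  ultimately show ?thesis
    using card_inj_on_le[of h "qf_roots (m * n)" "qf_roots m \<times> qf_roots n"] finite_qf_roots
    by (simp add: card_cartesian_product)
qed

text \<open>Splitting off a full prime power at most doubles the number of roots and at least
  doubles the number of divisors.\<close>

lemma card_qf_roots_le_card_divisors: "n > 0 \<Longrightarrow> card (qf_roots n) \<le> card {e. e dvd n}"
proof (induction n rule: less_induct)
  case (less n)
  show ?case
  proof (cases "n = 1")
    case True
    have "qf_roots 1 \<subseteq> {0}" by (auto simp: qf_roots_def)
    then have "card (qf_roots 1) \<le> card {0 :: int}" by (intro card_mono) simp_all
    then show ?thesis using True by simp
  next
    case False
    then obtain p where p: "prime p" "p dvd n" using prime_factor_nat by blast
    define k where "k = multiplicity p n"
    have "n \<noteq> 0" "\<not> is_unit p" using less.prems p by auto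
    then obtain m where m: "n = p ^ k * m" "\<not> p dvd m"
      using multiplicity_decompose'[of n p] unfolding k_def by blast
    have k: "k > 0" using p less.prems by (simp add: k_def prime_multiplicity_gt_zero_iff)
    have m0: "m > 0" using m less.prems by (cases m) auto
    have pk: "p ^ k > 1" using k p prime_gt_1_nat one_less_power by blast
    then have "m < n" using m m0 by simp
    have "coprime p m" using p m prime_imp_coprime by blast
    then have "coprime (p ^ k) m" by simp
    then have "card (qf_roots n) \<le> card (qf_roots (p ^ k)) * card (qf_roots m)"
      unfolding m(1) using pk m0 p(1) by (intro card_qf_roots_mult) (auto simp: prime_gt_0_nat)
    also have "\<dots> \<le> 2 * card {e. e dvd m}"
      using card_qf_roots_prime_power[OF p(1) k] less.IH[OF \<open>m < n\<close> m0] by (rule mult_le_mono)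
    also have "\<dots> \<le> card {e. e dvd n}"
      using card_divisors_prime_power_mult[OF p(1) m(2) m0 m(1) k] .
    finally show ?thesis .
  qed
qed

text \<open>A cell is an integral ideal \<open>lat g a b\<close> of norm \<open>m = g\<^sup>2 a \<le> X\<close> together with a unit interval of the range
  \<open>[ln m - (ln X) / 2, (ln X) / 2]\<close>, which contains \<open>ln (\<bar>\<alpha>\<bar> / \<surd>N(I))\<close> whenever the ideal is \<open>\<alpha> I\<inverse>\<close> with
  both conjugates of \<open>\<alpha>\<close> at most \<open>\<surd>(X N(I))\<close>.\<close>

definition cells :: "real \<Rightarrow> (nat \<times> nat \<times> int \<times> int) set" where
  "cells X = (SIGMA g:{1..nat \<lfloor>X\<rfloor>}. SIGMA a:{1..nat \<lfloor>X / (real g)\<^sup>2\<rfloor>}. SIGMA b:qf_roots a.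
     {\<lfloor>ln ((real g)\<^sup>2 * real a) - ln X / 2\<rfloor>..\<lfloor>ln X / 2\<rfloor>})"

lemma finite_cells: "finite (cells X)"
  unfolding cells_def by (intro finite_SigmaI finite_qf_roots) auto

text \<open>The count is at most 2 + ln (X / m), and ln y \<le> y - 1 at y = \<surd>(X / m) turns
  this into exactly 2 y. The square root factors over \<open>g\<close> and \<open>a\<close>, which
  the logarithm does not.\<close>

lemma card_log_interval:
  assumes "0 < m" "m \<le> X"
  shows "real (card {\<lfloor>ln m - ln X / 2\<rfloor>..\<lfloor>ln X / 2\<rfloor>}) \<le> 2 * sqrt (X / m)"
proof -
  have lnm: "ln m \<le> ln X" using assms by simp
  then have "ln m - ln X / 2 \<le> ln X / 2" by simp
  then have "\<lfloor>ln m - ln X / 2\<rfloor> \<le> \<lfloor>ln X / 2\<rfloor>" by (rule floor_mono)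
  then have "real (card {\<lfloor>ln m - ln X / 2\<rfloor>..\<lfloor>ln X / 2\<rfloor>}) = of_int \<lfloor>ln X / 2\<rfloor> - of_int \<lfloor>ln m - ln X / 2\<rfloor> + 1"
    by simp
  also have "\<dots> \<le> 2 + (ln X - ln m)" by linarith
  also have "ln X - ln m = ln (X / m)" using assms by (simp add: ln_div)
  also have "ln (X / m) = 2 * ln (sqrt (X / m))" using assms by (simp add: ln_sqrt)
  also have "ln (sqrt (X / m)) \<le> sqrt (X / m) - 1" using assms by (intro ln_le_minus_one) simp
  finally show ?thesis by simp
qed

text \<open>The interval length and the sum over \<open>a\<close> each contribute a factor 1 / g, so
  the sum over \<open>g\<close> converges. The constant is 2 from the interval, 2 from the sum over
  \<open>a\<close> and 2 from the sum over \<open>g\<close>.\<close>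

lemma card_cells_le:
  assumes X: "X \<ge> 1"
  shows "real (card (cells X)) \<le> 8 * X * (1 + ln X)"
proof -
  define M where "M = nat \<lfloor>X\<rfloor>"
  have M: "M \<ge> 1" "real M \<le> X" using X by (auto simp: M_def le_nat_iff le_floor_iff)
  define N where "N g = nat \<lfloor>X / (real g)\<^sup>2\<rfloor>" for g :: nat
  define K where "K g a = {\<lfloor>ln ((real g)\<^sup>2 * real a) - ln X / 2\<rfloor>..\<lfloor>ln X / 2\<rfloor>}" for g a :: nat
  have NX: "real (N g) \<le> X / (real g)\<^sup>2" for g using X by (simp add: N_def)
  have "card (cells X) = (\<Sum>g=1..M. \<Sum>a=1..N g. \<Sum>b\<in>qf_roots a. card (K g a))"
    unfolding cells_def M_def[symmetric] N_def[symmetric] K_def[symmetric]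
    by (simp add: finite_qf_roots K_def)
  then have "real (card (cells X)) = (\<Sum>g=1..M. \<Sum>a=1..N g. real (card (qf_roots a)) * real (card (K g a)))"
    by simp
  also have "\<dots> \<le> (\<Sum>g=1..M. \<Sum>a=1..N g. real (card {e. e dvd a}) * (2 * (sqrt X / real g) * (1 / sqrt (real a))))"
  proof (intro sum_mono mult_mono)
    fix g a assume g: "g \<in> {1..M}" and a: "a \<in> {1..N g}"
    show "real (card (qf_roots a)) \<le> real (card {e. e dvd a})"
      using a card_qf_roots_le_card_divisors[of a] by simp
    have "real a \<le> X / (real g)\<^sup>2" using a NX[of g] by (meson atLeastAtMost_iff of_nat_le_iff order_trans)
    then have "(real g)\<^sup>2 * real a \<le> X" using g by (simp add: field_simps)
    then have "real (card (K g a)) \<le> 2 * sqrt (X / ((real g)\<^sup>2 * real a))"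
      unfolding K_def using g a by (intro card_log_interval) auto
    also have "\<dots> = 2 * (sqrt X / real g) * (1 / sqrt (real a))"
      by (simp add: real_sqrt_divide real_sqrt_mult)
    finally show "real (card (K g a)) \<le> 2 * (sqrt X / real g) * (1 / sqrt (real a))" .
  qed auto
  also have "\<dots> = (\<Sum>g=1..M. 2 * (sqrt X / real g) * (\<Sum>a=1..N g. real (card {e. e dvd a}) * (1 / sqrt (real a))))"
    by (simp add: sum_distrib_left mult_ac)
  also have "\<dots> \<le> (\<Sum>g=1..M. 2 * (sqrt X / real g) * (2 * sqrt (X / (real g)\<^sup>2) * (1 + ln (real M))))"
  proof (intro sum_mono mult_left_mono sum_card_divisors_inverse_sqrt_le NX)
    fix g assume g: "g \<in> {1..M}"
    then have "(real g)\<^sup>2 \<ge> 1" by simp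
    then have "X / (real g)\<^sup>2 \<le> X / 1" using X g by (intro divide_left_mono) auto
    then show "N g \<le> M" unfolding N_def M_def by (intro nat_mono floor_mono) simp
  qed (use X M in auto)
  also have "\<dots> = (\<Sum>g=1..M. 4 * X * (1 + ln (real M)) * (1 / (real g)\<^sup>2))"
  proof (rule sum.cong[OF refl])
    fix g
    have "2 * (sqrt X / real g) * (2 * sqrt (X / (real g)\<^sup>2) * (1 + ln (real M)))
        = 4 * (sqrt X * sqrt X) * (1 + ln (real M)) * (1 / (real g)\<^sup>2)"
      by (simp add: real_sqrt_divide power2_eq_square)
    then show "2 * (sqrt X / real g) * (2 * sqrt (X / (real g)\<^sup>2) * (1 + ln (real M)))
        = 4 * X * (1 + ln (real M)) * (1 / (real g)\<^sup>2)"
      using X by (simp only: real_sqrt_mult_self abs_of_nonneg)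
  qed
  also have "\<dots> = 4 * X * (1 + ln (real M)) * (\<Sum>g=1..M. 1 / (real g)\<^sup>2)" by (simp add: sum_distrib_left)
  also have "\<dots> \<le> 4 * X * (1 + ln X) * 2"
    using X M sum_inverse_square_le[of M] by (intro mult_mono) (auto intro!: sum_nonneg)
  finally show ?thesis by simp
qed

end

section \<open>The class group and prime ideals\<close>

text \<open>The fibres of the power map are cosets of the torsion, so the index of its image
  \<open>H\<close> equals the size of the torsion. \<open>T\<close> has one element in each coset of
  \<open>H\<close>.\<close>

lemma (in comm_group) torsion_transversal:
  fixes l :: nat
  assumes fin: "finite (carrier G)"
  shows "\<exists>T\<subseteq>carrier G. card T = card (torsion l G) \<and>
    (\<forall>c\<in>T. \<forall>c'\<in>T. \<forall>x\<in>carrier G. \<forall>y\<in>carrier G. c \<otimes> x [^] l = c' \<otimes> y [^] l \<longrightarrow> c = c')"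
proof -
  define H where "H = (\<lambda>x. x [^] l) ` carrier G"
  have HG: "subgroup H G"
  proof (rule subgroupI)
    show "H \<subseteq> carrier G" "H \<noteq> {}" by (auto simp: H_def)
    show "inv a \<in> H" if a: "a \<in> H" for a
    proof -
      obtain x where "x \<in> carrier G" "a = x [^] l" using a by (auto simp: H_def)
      then have "inv a = (inv x) [^] l" "inv x \<in> carrier G" by (simp_all add: nat_pow_inv)
      then show ?thesis by (auto simp: H_def)
    qed
    show "a \<otimes> b \<in> H" if ab: "a \<in> H" "b \<in> H" for a b
    proof -
      obtain x y where "x \<in> carrier G" "a = x [^] l" "y \<in> carrier G" "b = y [^] l" using ab by (auto simp: H_def)
      then have "a \<otimes> b = (x \<otimes> y) [^] l" "x \<otimes> y \<in> carrier G" by (simp_all add: nat_pow_distrib)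
      then show ?thesis by (auto simp: H_def)
    qed
  qed
  have fib: "card {x \<in> carrier G. x [^] l = y} = card (torsion l G)" if y: "y \<in> H" for y
  proof -
    obtain x0 where x0: "x0 \<in> carrier G" "y = x0 [^] l" using y by (auto simp: H_def)
    have "bij_betw (\<lambda>z. x0 \<otimes> z) (torsion l G) {x \<in> carrier G. x [^] l = y}"
      by (rule bij_betwI[where g = "\<lambda>x. inv x0 \<otimes> x"])
        (use x0 in \<open>auto simp: torsion_def nat_pow_distrib nat_pow_inv m_assoc[symmetric]\<close>)
    then show ?thesis by (simp add: bij_betw_same_card)
  qed
  have "card (carrier G) = (\<Sum>y\<in>H. card {x \<in> carrier G. x [^] l = y})"
    using sum.image_gen[OF fin, of "\<lambda>_. 1 :: nat" "\<lambda>x. x [^] l"] by (simp add: H_def)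
  also have "\<dots> = card (torsion l G) * card H" by (simp add: fib)
  finally have "card (rcosets H) * card H = card (torsion l G) * card H"
    using lagrange[OF HG] by (simp add: order_def)
  moreover have "card H > 0" using fin by (auto simp: H_def card_gt_0_iff)
  ultimately have card: "card (rcosets H) = card (torsion l G)" by simp
  define rep where "rep C = (SOME c. c \<in> C)" for C :: "'a set"
  have rep: "rep C \<in> carrier G \<and> C = H #> rep C" if C: "C \<in> rcosets H" for C
  proof -
    obtain x where x: "x \<in> carrier G" "C = H #> x" using C by (auto simp: RCOSETS_def)
    then have "x \<in> C" using rcos_self HG by blast
    then have "rep C \<in> C" unfolding rep_def by (rule someI)
    then show ?thesis using x repr_independence[OF _ x(1) HG] subgroup.elemrcos_carrier[OF HG group_axioms x(1)] by auto
  qed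
  have inj: "inj_on rep (rcosets H)" using rep by (metis inj_onI)
  define T where "T = rep ` (rcosets H)"
  have "card T = card (torsion l G)" using card_image[OF inj] card by (simp add: T_def)
  moreover have "T \<subseteq> carrier G" using rep by (auto simp: T_def)
  moreover have "c = c'" if c: "c \<in> T" "c' \<in> T" and xy: "x \<in> carrier G" "y \<in> carrier G"
    and e: "c \<otimes> x [^] l = c' \<otimes> y [^] l" for c c' x y
  proof -
    obtain C C' where C: "C \<in> rcosets H" "C' \<in> rcosets H" "c = rep C" "c' = rep C'" using c by (auto simp: T_def)
    have cc: "c \<in> carrier G" "c' \<in> carrier G" using C rep by auto
    have m: "x [^] l \<otimes> c \<in> H #> c" "y [^] l \<otimes> c' \<in> H #> c'" using xy by (auto simp: H_def r_coset_def)
    have 1: "H #> c = H #> (x [^] l \<otimes> c)" "H #> c' = H #> (y [^] l \<otimes> c')"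
      by (rule repr_independence[OF m(1) cc(1) HG], rule repr_independence[OF m(2) cc(2) HG])
    have "x [^] l \<otimes> c = y [^] l \<otimes> c'" using e m_comm[OF cc(1)] m_comm[OF cc(2)] xy by simp
    then have "H #> c = H #> c'" using 1 by simp
    then have "C = C'" using rep[OF C(1)] rep[OF C(2)] C(3,4) by simp
    then show ?thesis using C by simp
  qed
  ultimately show ?thesis by blast
qed

section \<open>Fractional ideals and the class group\<close>

context real_quadratic
begin

lemma fractional_ideal_iff:
  "fractional_ideal d I \<longleftrightarrow> zmodule I \<and> (\<exists>a\<in>ZK. a \<noteq> 0 \<and> zideal (scale a I))"
proof
  assume "fractional_ideal d I"
  then have I: "additive_subgroup I (quad_field d)" "I \<noteq> {0}" "\<forall>a\<in>ZK. \<forall>x\<in>I. a * x \<in> I"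
    and "\<exists>a\<in>ZK. a \<noteq> 0 \<and> (\<forall>x\<in>I. a * x \<in> ZK)" by (auto simp: fractional_ideal_def)
  then obtain a where a: "a \<in> ZK" "a \<noteq> 0" "\<forall>x\<in>I. a * x \<in> ZK" by blast
  have "I \<subseteq> KK" "0 \<in> I" "\<And>x y. x \<in> I \<Longrightarrow> y \<in> I \<Longrightarrow> x + y \<in> I"
    using additive_subgroup.a_subset[OF I(1)] additive_subgroup.zero_closed[OF I(1)]
      additive_subgroup.a_closed[OF I(1)] by (auto simp: quad_field_def)
  then have zm: "zmodule I" using I(3) by (auto simp: zmodule_def)
  obtain x where x: "x \<in> I" "x \<noteq> 0" using I(2) \<open>0 \<in> I\<close> by blast
  have "zideal (scale a I)"
    using x a by (intro zidealI[of _ "a * x"] zmodule_scale zm) (auto simp: scale_def ZK_KK)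
  then show "zmodule I \<and> (\<exists>a\<in>ZK. a \<noteq> 0 \<and> zideal (scale a I))" using zm a by blast
next
  assume "zmodule I \<and> (\<exists>a\<in>ZK. a \<noteq> 0 \<and> zideal (scale a I))"
  then obtain a where zm: "zmodule I" and a: "a \<in> ZK" "a \<noteq> 0" "zideal (scale a I)" by blast
  \<comment> \<open>The inverse is a definite description, so it must be identified with negation
    inside the carrier.\<close>
  have minv: "inv\<^bsub>add_monoid (quad_field d)\<^esub> x = - x" if "x \<in> KK" for x
    unfolding m_inv_def using that KK_uminus(1)[OF that]
    by (intro the_equality) (auto simp: quad_field_def)
  have "additive_subgroup I (quad_field d)"
  proof (rule additive_subgroup.intro, rule subgroup.intro)
    show "I \<subseteq> carrier (add_monoid (quad_field d))"
      using zmodule_KK[OF zm] by (auto simp: quad_field_def)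
    show "x \<otimes>\<^bsub>add_monoid (quad_field d)\<^esub> y \<in> I" if "x \<in> I" "y \<in> I" for x y
      using zmodule_add[OF zm that] by (simp add: quad_field_def)
    show "\<one>\<^bsub>add_monoid (quad_field d)\<^esub> \<in> I" using zmodule_0[OF zm] by (simp add: quad_field_def)
    show "inv\<^bsub>add_monoid (quad_field d)\<^esub> x \<in> I" if "x \<in> I" for x
      using minv zmodule_KK[OF zm that] zmodule_uminus[OF zm that] by simp
  qed
  moreover have "I \<noteq> {0}"
  proof
    assume "I = {0}"
    then have "scale a I = {0}" by (simp add: scale_def)
    then show False using a(3) by (simp add: zideal_def)
  qed
  moreover have "\<forall>x\<in>I. a * x \<in> ZK" using zidealD(2)[OF a(3)] by (auto simp: scale_def)
  ultimately show "fractional_ideal d I"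
    using zmodule_mult[OF zm] a unfolding fractional_ideal_def by blast
qed

lemma zideal_fractional: "zideal I \<Longrightarrow> fractional_ideal d I"
  unfolding fractional_ideal_iff using zidealD(1) by (auto intro!: bexI[of _ 1])

lemma fractional_prd:
  assumes "fractional_ideal d I" "fractional_ideal d J"
  shows "fractional_ideal d (prd I J)"
proof -
  obtain a b where ab: "zmodule I" "a \<in> ZK" "a \<noteq> 0" "zideal (scale a I)"
    "zmodule J" "b \<in> ZK" "b \<noteq> 0" "zideal (scale b J)" using assms unfolding fractional_ideal_iff by blast
  have "zideal (prd (scale a I) (scale b J))" by (intro zideal_prd ab)
  then have "zideal (scale (a * b) (prd I J))" by (simp add: prd_scale prd_scale_right scale_scale mult.commute)
  then show ?thesis using ab unfolding fractional_ideal_iff by (intro conjI zmodule_prd bexI[of _ "a * b"]) (auto simp: ZK_mult)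
qed

lemma rt_ZK: "rt \<in> ZK"
proof -
  have "rt = (if d mod 4 = 1 then of_int (-1) + of_int 2 * om else of_int 0 + of_int 1 * om)"
    by (simp add: om_def field_simps)
  then show ?thesis using ZK_I by metis
qed

lemma KK_denominator: assumes "x \<in> KK" shows "\<exists>a\<in>ZK. a \<noteq> 0 \<and> a * x \<in> ZK"
proof -
  obtain u v where uv: "u \<in> \<rat>" "v \<in> \<rat>" "x = u + v * rt" using assms KK_E by blast
  obtain p q where pq: "u = of_int p / of_int q" "q > 0" by (rule Rats_cases'[OF uv(1)]) blast
  obtain r s where rs: "v = of_int r / of_int s" "s > 0" by (rule Rats_cases'[OF uv(2)]) blast
  have "of_int (q * s) * x = of_int (p * s) + of_int (r * q) * rt"
    using pq(2) rs(2) unfolding uv(3) pq(1) rs(1) by (simp add: field_simps)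
  moreover have "of_int (p * s) + of_int (r * q) * rt \<in> ZK" by (intro ZK_add ZK_mult ZK_of_int rt_ZK)
  ultimately have "of_int (q * s) * x \<in> ZK" by simp
  then show ?thesis using pq rs by (intro bexI[of _ "of_int (q * s)"]) (auto simp: simp del: of_int_mult)
qed

lemma fractional_principal: assumes "x \<in> KK" "x \<noteq> 0" shows "fractional_ideal d (scale x ZK)"
proof -
  obtain a where a: "a \<in> ZK" "a \<noteq> 0" "a * x \<in> ZK" using KK_denominator[OF assms(1)] by blast
  have "scale (a * x) ZK \<subseteq> ZK" using a ZK_mult by (auto simp: scale_def)
  moreover have "a * x \<in> scale (a * x) ZK" by (auto simp: scale_def intro!: image_eqI[of _ _ 1])
  ultimately have "zideal (scale (a * x) ZK)"
    using a assms by (intro zidealI[of _ "a * x"] zmodule_scale zmodule_ZK) (auto simp: ZK_KK)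
  then show ?thesis unfolding fractional_ideal_iff scale_scale[symmetric]
    using a assms by (auto intro!: zmodule_scale zmodule_ZK)
qed

text \<open>If \<open>A = a I\<close> is integral of norm \<open>n\<close>, then
  \<open>a / n\<close> times the conjugate of \<open>A\<close> is inverse to \<open>I\<close>,
  because \<open>A\<close> times its conjugate is generated by \<open>n\<close>.\<close>

lemma fractional_inverse:
  assumes "fractional_ideal d I"
  shows "\<exists>J. fractional_ideal d J \<and> prd J I = ZK"
proof -
  obtain a where a: "zmodule I" "a \<in> ZK" "a \<noteq> 0" "zideal (scale a I)"
    using assms unfolding fractional_ideal_iff by blast
  define A where "A = scale a I"
  define n where "n = idnorm A"
  have A: "zideal A" using a by (simp add: A_def)
  have n: "n > 0" using idnorm_pos[OF A] by (simp add: n_def)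
  define J where "J = prd (scale (a / of_int n) ZK) (cj ` A)"
  have "fractional_ideal d J" unfolding J_def
    using a n A by (intro fractional_prd fractional_principal zideal_fractional zideal_cj KK_divide)
      (auto simp: ZK_KK Rats_KK)
  moreover have "prd J I = ZK"
  proof -
    have "J = scale (a / of_int n) (cj ` A)"
      unfolding J_def prd_scale by (simp add: ZK_prd zmodule_cj zidealD(1) A)
    then have "prd J I = scale (1 / of_int n) (scale a (prd (cj ` A) I))"
      by (simp add: prd_scale scale_scale)
    also have "scale a (prd (cj ` A) I) = prd A (cj ` A)"
      by (simp add: A_def prd_scale prd_scale_right prd_commute)
    also have "\<dots> = scale (of_int n) ZK" using prd_cj[OF A] by (simp add: n_def)
    also have "scale (1 / of_int n) \<dots> = ZK" using n by (simp add: scale_scale)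
    finally show ?thesis .
  qed
  ultimately show ?thesis by blast
qed

abbreviation FI :: "real set monoid" where "FI \<equiv> fractional_ideal_group d"

abbreviation PI :: "real set set" where "PI \<equiv> principal_fractional_ideals d"

lemma FI_simps: "carrier FI = {I. fractional_ideal d I}" "I \<otimes>\<^bsub>FI\<^esub> J = prd I J" "\<one>\<^bsub>FI\<^esub> = ZK"
  by (simp_all add: fractional_ideal_group_def)

lemma comm_group_FI: "comm_group FI"
proof (rule comm_groupI; unfold FI_simps)
  show "prd I J = prd J I" for I J by (rule prd_commute)
  show "\<exists>J\<in>{I. fractional_ideal d I}. prd J I = ZK" if "I \<in> {I. fractional_ideal d I}" for I
    using fractional_inverse that by auto
  show "prd ZK I = I" if "I \<in> {I. fractional_ideal d I}" for I
    using that by (simp add: ZK_prd fractional_ideal_iff)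
qed (auto simp: fractional_prd zideal_fractional zideal_ZK prd_assoc)

lemma principal_fractional_ideals_eq: "PI = {scale x ZK | x. x \<in> KK \<and> x \<noteq> 0}"
  by (simp add: principal_fractional_ideals_def scale_def)

lemma subgroup_PI: "subgroup PI FI"
proof -
  interpret F: comm_group FI by (rule comm_group_FI)
  show ?thesis
  proof (rule F.subgroupI)
    show "PI \<subseteq> carrier FI" by (auto simp: principal_fractional_ideals_eq FI_simps fractional_principal)
    show "PI \<noteq> {}" using Rats_KK[of 1] by (auto simp: principal_fractional_ideals_eq)
    show "inv\<^bsub>FI\<^esub> a \<in> PI" if a: "a \<in> PI" for a
    proof -
      obtain x where x: "x \<in> KK" "x \<noteq> 0" "a = scale x ZK" using a by (auto simp: principal_fractional_ideals_eq)
      have i: "inverse x \<in> KK" "inverse x \<noteq> 0" using x KK_inverse by auto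
      have "inv\<^bsub>FI\<^esub> a = scale (inverse x) ZK"
        using x i by (intro F.inv_equality)
          (auto simp: FI_simps fractional_principal prd_scale prd_scale_right scale_scale prd_ZK zmodule_ZK)
      then show ?thesis using i by (auto simp: principal_fractional_ideals_eq)
    qed
    show "a \<otimes>\<^bsub>FI\<^esub> b \<in> PI" if ab: "a \<in> PI" "b \<in> PI" for a b
    proof -
      obtain x y where x: "x \<in> KK" "x \<noteq> 0" "a = scale x ZK" "y \<in> KK" "y \<noteq> 0" "b = scale y ZK"
        using ab by (auto simp: principal_fractional_ideals_eq)
      then have "a \<otimes>\<^bsub>FI\<^esub> b = scale (x * y) ZK"
        by (simp add: FI_simps prd_scale prd_scale_right scale_scale prd_ZK zmodule_ZK mult.commute)
      then show ?thesis using x KK_mult(1) by (auto simp: principal_fractional_ideals_eq)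
    qed
  qed
qed

lemma normal_PI: "normal PI FI"
  by (rule comm_group.subgroup_imp_normal[OF comm_group_FI subgroup_PI])

lemma comm_group_class_group: "comm_group (class_group d)"
  unfolding class_group_def by (rule comm_group.abelian_FactGroup[OF comm_group_FI subgroup_PI])

definition cls :: "real set \<Rightarrow> real set set" where "cls I = PI #>\<^bsub>FI\<^esub> I"

lemma cls_in_class_group: "fractional_ideal d I \<Longrightarrow> cls I \<in> carrier (class_group d)"
  by (auto simp: class_group_def carrier_FactGroup cls_def FI_simps)

lemma cls_prd:
  assumes "fractional_ideal d I" "fractional_ideal d J"
  shows "cls (prd I J) = cls I \<otimes>\<^bsub>class_group d\<^esub> cls J"
  using normal.rcos_sum[OF normal_PI, of I J] assms by (simp add: cls_def class_group_def FI_simps)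

lemma cls_pow:
  assumes "fractional_ideal d I"
  shows "cls (I [^]\<^bsub>FI\<^esub> (n :: nat)) = cls I [^]\<^bsub>class_group d\<^esub> n"
  using normal.FactGroup_pow[OF normal_PI, of I n] assms by (simp add: cls_def class_group_def FI_simps)

lemma cls_scale:
  assumes "fractional_ideal d I" "x \<in> KK" "x \<noteq> 0"
  shows "cls (scale x I) = cls I"
proof -
  have "scale x I = prd (scale x ZK) I"
    using assms by (simp add: prd_scale ZK_prd fractional_ideal_iff)
  then have "scale x I \<in> PI #>\<^bsub>FI\<^esub> I"
    using assms by (auto simp: r_coset_def FI_simps principal_fractional_ideals_eq)
  then show ?thesis
    using group.repr_independence[OF comm_group.axioms(2)[OF comm_group_FI] _ _ subgroup_PI] assms(1)
    by (auto simp: cls_def FI_simps)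
qed

lemma class_group_zideal_rep:
  assumes "c \<in> carrier (class_group d)"
  shows "\<exists>I. zideal I \<and> cls I = c"
proof -
  obtain I where I: "fractional_ideal d I" "c = cls I"
    using assms by (auto simp: class_group_def carrier_FactGroup cls_def FI_simps)
  obtain a where a: "a \<in> ZK" "a \<noteq> 0" "zideal (scale a I)" using I(1) unfolding fractional_ideal_iff by blast
  then show ?thesis using I cls_scale[of I a] by (auto simp: ZK_KK)
qed

lemma FI_pow_simps: "I [^]\<^bsub>FI\<^esub> (0::nat) = ZK" "I [^]\<^bsub>FI\<^esub> (Suc n) = prd (I [^]\<^bsub>FI\<^esub> n) I"
  by (simp_all add: FI_simps)

lemma ideals_set_pow: "I [^]\<^bsub>ideals_set (ring_of_integers d)\<^esub> (n::nat) = I [^]\<^bsub>FI\<^esub> n"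
  by (induction n) (simp_all add: FI_simps ideals_set_def ideal_prod_ring_of_integers)

lemma zideal_pow: "zideal I \<Longrightarrow> zideal (I [^]\<^bsub>FI\<^esub> (n::nat))"
  by (induction n) (simp_all only: FI_pow_simps zideal_ZK zideal_prd)

lemma idnorm_pow: "zideal I \<Longrightarrow> idnorm (I [^]\<^bsub>FI\<^esub> (n::nat)) = idnorm I ^ n"
  by (induction n) (simp_all only: FI_pow_simps idnorm_ZK idnorm_prd zideal_pow power_0 power_Suc mult.commute)

lemma prd_pow: "zideal I \<Longrightarrow> zideal J \<Longrightarrow> prd I J [^]\<^bsub>FI\<^esub> (n::nat) = prd (I [^]\<^bsub>FI\<^esub> n) (J [^]\<^bsub>FI\<^esub> n)"
proof (induction n)
  case 0 show ?case by (simp only: FI_pow_simps prd_ZK zmodule_ZK)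
next
  case (Suc n) then show ?case by (simp only: FI_pow_simps prd_ac)
qed

lemma cj_pow: "zideal I \<Longrightarrow> cj ` (I [^]\<^bsub>FI\<^esub> (n::nat)) = (cj ` I) [^]\<^bsub>FI\<^esub> n"
  by (induction n) (simp_all only: FI_pow_simps cj_image_ZK cj_prd zideal_pow zidealD(3))

lemma PIdl_eq: "PIdl\<^bsub>ring_of_integers d\<^esub> x = scale x ZK"
  by (auto simp: cgenideal_def scale_def ring_of_integers_def quad_field_def mult.commute)

section \<open>Nonzero prime ideals and the prime factors of a power\<close>

definition zprime :: "real set \<Rightarrow> bool" where
  "zprime P \<longleftrightarrow> zideal P \<and> 1 \<notin> P \<and> (\<forall>x\<in>ZK. \<forall>y\<in>ZK. x * y \<in> P \<longrightarrow> x \<in> P \<or> y \<in> P)"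

lemma primeideal_imp_zprime:
  assumes P: "primeideal P (ring_of_integers d)" and "P \<noteq> {0}"
  shows "zprime P"
proof -
  interpret primeideal P "ring_of_integers d" by fact
  have ring: "x \<otimes>\<^bsub>ring_of_integers d\<^esub> y = x * y" "x \<oplus>\<^bsub>ring_of_integers d\<^esub> y = x + y"
    "\<zero>\<^bsub>ring_of_integers d\<^esub> = 0" for x y by (simp_all add: ring_of_integers_def quad_field_def)
  have sub: "P \<subseteq> ZK" using Icarr by blast
  have zm: "zmodule P" unfolding zmodule_def
    using sub ZK_KK additive_subgroup.zero_closed[OF additive_subgroup_axioms]
      additive_subgroup.a_closed[OF additive_subgroup_axioms] I_l_closed by (auto simp: ring)
  then have "zideal P" using sub assms(2) by (simp add: zideal_def)
  moreover have "1 \<notin> P"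
  proof
    assume "1 \<in> P"
    then have "ZK \<subseteq> P" using zmodule_mult[OF zm, of _ 1] by auto
    then show False using sub I_notcarr by blast
  qed
  moreover have "x \<in> P \<or> y \<in> P" if "x \<in> ZK" "y \<in> ZK" "x * y \<in> P" for x y
    using I_prime[of x y] that by (simp add: ring)
  ultimately show ?thesis by (auto simp: zprime_def)
qed

lemma zprime_cj: assumes "zprime P" shows "zprime (cj ` P)"
proof -
  have zi: "zideal P" and sub: "P \<subseteq> KK" using assms zidealD by (auto simp: zprime_def)
  have mem: "x \<in> cj ` P \<longleftrightarrow> cj x \<in> P" if "x \<in> KK" for x
    using that sub by (force simp: image_iff)
  show ?thesis unfolding zprime_def
  proof (intro conjI ballI impI)
    show "zideal (cj ` P)" using zi by (rule zideal_cj)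
    show "1 \<notin> cj ` P" using assms mem[of 1] Rats_KK[of 1] by (simp add: zprime_def)
    fix x y assume xy: "x \<in> ZK" "y \<in> ZK" "x * y \<in> cj ` P"
    then have "cj x * cj y \<in> P" using mem[of "x * y"] by (simp add: KK_mult ZK_KK)
    then have "cj x \<in> P \<or> cj y \<in> P" using assms xy cj_ZK by (auto simp: zprime_def)
    then show "x \<in> cj ` P \<or> y \<in> cj ` P" using mem xy ZK_KK by auto
  qed
qed

text \<open>There are finitely many residues modulo \<open>P\<close>, so the powers of some
  \<open>x\<close> in \<open>Q\<close> but not in \<open>P\<close> repeat:
  \<open>x ^ i * (1 - x ^ (j - i))\<close> lies in \<open>P\<close>. Primality puts the second
  factor into \<open>P\<close> and hence into \<open>Q\<close>, which then contains 1.\<close>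

lemma zprime_maximal:
  assumes P: "zprime P" and Q: "zprime Q" and "P \<subseteq> Q"
  shows "P = Q"
proof (rule ccontr)
  assume "P \<noteq> Q"
  then obtain x where x: "x \<in> Q" "x \<notin> P" using assms by blast
  have zi: "zideal P" "zideal Q" using P Q by (auto simp: zprime_def)
  have xZ: "x \<in> ZK" using x zi zidealD by blast
  obtain R where R: "finite R" "\<forall>z\<in>ZK. \<exists>r\<in>R. z - r \<in> P" using zideal_residues[OF zi(1)] by blast
  have pw: "x ^ i \<in> ZK" for i by (induction i) (auto simp: ZK_mult xZ)
  have npw: "x ^ i \<notin> P" for i
  proof (induction i)
    case 0 then show ?case using P by (simp add: zprime_def)
  next
    case (Suc i) then show ?case using P x(2) pw[of i] xZ by (auto simp: zprime_def)
  qed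
  define h where "h i = (SOME r. r \<in> R \<and> x ^ i - r \<in> P)" for i
  have h: "h i \<in> R \<and> x ^ i - h i \<in> P" for i
  proof -
    have "\<exists>r. r \<in> R \<and> x ^ i - r \<in> P" using R pw by blast
    then show ?thesis unfolding h_def by (rule someI_ex)
  qed
  have "range h \<subseteq> R" using h by auto
  then have "\<not> inj h" using R(1) finite_imageD finite_subset infinite_UNIV_nat by blast
  then obtain i0 j0 where "h i0 = h j0" "i0 \<noteq> j0" by (auto simp: inj_on_def)
  then obtain i j where ij: "h i = h j" "i < j" by (metis nat_neq_iff)
  have "(x ^ i - h i) - (x ^ j - h j) \<in> P" using zmodule_diff[OF zidealD(1)[OF zi(1)]] h by blast
  then have "x ^ i * (1 - x ^ (j - i)) \<in> P" using ij by (simp add: algebra_simps flip: power_add)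
  then have "1 - x ^ (j - i) \<in> P" using P npw[of i] pw[of i] ZK_diff[OF ZK_1 pw[of "j - i"]] unfolding zprime_def by blast
  then have "1 - x ^ (j - i) \<in> Q" using assms by blast
  moreover have "x ^ (j - i) = x ^ (j - i - 1) * x" using ij by (metis Suc_diff_Suc diff_Suc_eq_diff_pred power_Suc2 diff_commute Suc_diff_1 zero_less_diff)
  then have "x ^ (j - i) \<in> Q" using zmodule_mult[OF zidealD(1)[OF zi(2)] pw x(1)] by simp
  ultimately have "(1 - x ^ (j - i)) + x ^ (j - i) \<in> Q" by (rule zmodule_add[OF zidealD(1)[OF zi(2)]])
  then show False using Q by (simp add: zprime_def)
qed

lemma zprime_prd_subset:
  assumes "zprime Q" "zideal I" "zideal J" "prd I J \<subseteq> Q"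
  shows "I \<subseteq> Q \<or> J \<subseteq> Q"
proof (rule ccontr)
  assume "\<not> (I \<subseteq> Q \<or> J \<subseteq> Q)"
  then obtain x y where xy: "x \<in> I" "x \<notin> Q" "y \<in> J" "y \<notin> Q" by blast
  then have "x * y \<in> Q" using assms prd_I by blast
  then show False using assms xy zidealD(2) unfolding zprime_def by blast
qed

lemma zprime_pow_subset:
  assumes "zprime Q" "zideal I" "I [^]\<^bsub>FI\<^esub> (n::nat) \<subseteq> Q"
  shows "I \<subseteq> Q"
  using assms(3)
proof (induction n)
  case 0
  then have "1 \<in> Q" using ZK_1 unfolding FI_pow_simps by blast
  then show ?case using assms(1) by (simp add: zprime_def)
next
  case (Suc n)
  then show ?case using zprime_prd_subset[OF assms(1) zideal_pow[OF assms(2)] assms(2)] unfolding FI_pow_simps by blast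
qed

text \<open>This stands in for unique factorisation: \<open>Q1\<close> contains the power, hence
  contains \<open>P1\<close> or \<open>P2\<close> as it is prime, and equals that ideal by
  maximality.\<close>

lemma zprime_factors_of_power:
  assumes P: "zprime P1" "zprime P2" and Q: "zprime Q1" "zprime Q2"
    and eq: "prd P1 P2 [^]\<^bsub>FI\<^esub> (l::nat) = prd Q1 Q2 [^]\<^bsub>FI\<^esub> l" and "l > 0"
  shows "Q1 \<in> {P1, P2}"
proof -
  have zi: "zideal P1" "zideal P2" "zideal Q1" "zideal Q2" using P Q by (auto simp: zprime_def)
  obtain k where k: "l = Suc k" using \<open>l > 0\<close> by (cases l) auto
  have "prd Q1 Q2 [^]\<^bsub>FI\<^esub> l \<subseteq> Q1"
  proof -
    have "prd Q1 Q2 [^]\<^bsub>FI\<^esub> l = prd Q1 (prd Q2 (prd Q1 Q2 [^]\<^bsub>FI\<^esub> k))"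
      unfolding k FI_pow_simps by (simp only: prd_ac)
    also have "\<dots> \<subseteq> Q1"
    proof (rule prd_subsetI)
      have "prd Q2 (prd Q1 Q2 [^]\<^bsub>FI\<^esub> k) \<subseteq> ZK"
        by (intro zidealD(2) zideal_prd zideal_pow zi)
      then show "i * j \<in> Q1" if "i \<in> Q1" "j \<in> prd Q2 (prd Q1 Q2 [^]\<^bsub>FI\<^esub> k)" for i j
        using zmodule_mult[OF zidealD(1)[OF zi(3)], of j i] that by (auto simp: mult.commute)
    qed (use zmodule_add[OF zidealD(1)[OF zi(3)]] in blast)
    finally show ?thesis .
  qed
  then have "prd P1 P2 \<subseteq> Q1"
    unfolding eq[symmetric] using zprime_pow_subset[OF Q(1)] zideal_prd[OF zi(1,2)] by blast
  then have "P1 \<subseteq> Q1 \<or> P2 \<subseteq> Q1" using zprime_prd_subset[OF Q(1)] zi by blast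
  then show ?thesis using zprime_maximal P Q by blast
qed

end

section \<open>Collisions of reduced ideals\<close>

text \<open>The collisions number the sum of the squared fibre sizes; Cauchy-Schwarz compares it
  with the square of their sum.\<close>

lemma card_square_le_collisions:
  assumes fA: "finite A" and fB: "finite B" and F: "F ` A \<subseteq> B"
  shows "(real (card A))\<^sup>2 \<le> real (card B) * real (card {(x, y). x \<in> A \<and> y \<in> A \<and> F x = F y})"
proof -
  define r where "r b = card {x \<in> A. F x = b}" for b
  have "A = (\<Union>b\<in>B. {x \<in> A. F x = b})" using F by auto
  then have "card A = card (\<Union>b\<in>B. {x \<in> A. F x = b})" by simp
  also have "\<dots> = (\<Sum>b\<in>B. r b)" unfolding r_def using fA fB by (intro card_UN_disjoint) auto
  finally have 1: "card A = (\<Sum>b\<in>B. r b)" .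
  have "{(x, y). x \<in> A \<and> y \<in> A \<and> F x = F y} = (\<Union>b\<in>B. {x \<in> A. F x = b} \<times> {x \<in> A. F x = b})"
    using F by auto
  then have "card {(x, y). x \<in> A \<and> y \<in> A \<and> F x = F y} = card (\<Union>b\<in>B. {x \<in> A. F x = b} \<times> {x \<in> A. F x = b})" by simp
  also have "\<dots> = (\<Sum>b\<in>B. card ({x \<in> A. F x = b} \<times> {x \<in> A. F x = b}))"
    using fA fB by (intro card_UN_disjoint) auto
  also have "\<dots> = (\<Sum>b\<in>B. (r b)\<^sup>2)" by (simp add: card_cartesian_product r_def power2_eq_square)
  finally have 2: "card {(x, y). x \<in> A \<and> y \<in> A \<and> F x = F y} = (\<Sum>b\<in>B. (r b)\<^sup>2)" .
  show ?thesis using sum_squared_le_sum_of_squares[of "\<lambda>b. real (r b)" B] by (simp add: 1 2 mult.commute)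
qed

text \<open>Converts a comparison of normalised sizes into a bound on \<beta>. Here \<open>A\<close>
  and \<open>B\<close> are the norms of the two prime powers and \<open>c\<close> that of the common
  ideal, which cancels; the remaining \<surd>(A B) is at most \<open>W\<close>.\<close>

lemma ratio_bound:
  fixes q1 q2 A B c W E :: real
  assumes "q2 > 0" "A > 0" "B > 0" "c > 0" "A \<le> W" "B \<le> W" "E \<ge> 0"
    and le: "q1 / sqrt (A * c) \<le> E * (q2 / sqrt (B * c))"
  shows "q1 / q2 * B \<le> E * W"
proof -
  have BB: "sqrt B * sqrt B = B" using assms by simp
  have "q1 = q1 / sqrt (A * c) * sqrt (A * c)" using assms by simp
  also have "\<dots> \<le> E * (q2 / sqrt (B * c)) * sqrt (A * c)" using le assms by (intro mult_right_mono) auto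
  also have "\<dots> = E * q2 * (sqrt A / sqrt B)" using assms by (simp add: real_sqrt_mult)
  finally have "q1 / q2 \<le> E * (sqrt A / sqrt B)" using assms by (simp add: field_simps)
  then have "q1 / q2 * B \<le> E * (sqrt A / sqrt B) * B" using assms by (intro mult_right_mono) auto
  also have "\<dots> = E * (sqrt A * sqrt B)"
    using assms by (subst BB[symmetric]) (simp add: field_simps)
  also have "\<dots> \<le> E * (sqrt W * sqrt W)" using assms by (intro mult_left_mono mult_mono) auto
  also have "\<dots> = E * W" using assms by simp
  finally show ?thesis .
qed

section \<open>Reduced ideals, archimedean sizes and cells\<close>

context real_quadratic
begin

definition small_elt :: "real set \<Rightarrow> real" where
  "small_elt I = (SOME \<alpha>. \<alpha> \<in> I \<and> \<alpha> \<noteq> 0 \<and> \<bar>\<alpha>\<bar> \<le> 2 * sqrt (of_int (idnorm I) * rt) \<and>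
     \<bar>cj \<alpha>\<bar> \<le> 2 * sqrt (of_int (idnorm I) * rt))"

lemma small_elt:
  assumes "zideal I"
  shows "small_elt I \<in> I" "small_elt I \<noteq> 0"
    "\<bar>small_elt I\<bar> \<le> 2 * sqrt (of_int (idnorm I) * rt)"
    "\<bar>cj (small_elt I)\<bar> \<le> 2 * sqrt (of_int (idnorm I) * rt)"
proof -
  have "\<exists>\<alpha>. \<alpha> \<in> I \<and> \<alpha> \<noteq> 0 \<and> \<bar>\<alpha>\<bar> \<le> 2 * sqrt (of_int (idnorm I) * rt) \<and>
     \<bar>cj \<alpha>\<bar> \<le> 2 * sqrt (of_int (idnorm I) * rt)"
    using zideal_small_element[OF assms] by blast
  from someI_ex[OF this] show "small_elt I \<in> I" "small_elt I \<noteq> 0"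
    "\<bar>small_elt I\<bar> \<le> 2 * sqrt (of_int (idnorm I) * rt)"
    "\<bar>cj (small_elt I)\<bar> \<le> 2 * sqrt (of_int (idnorm I) * rt)"
    unfolding small_elt_def by blast+
qed

text \<open>If \<open>\<alpha>\<close> is the small element, this is the integral ideal \<open>\<alpha> I\<inverse>\<close>, of norm at most \<open>4 \<surd>d\<close>.\<close>

definition reduced :: "real set \<Rightarrow> real set" where
  "reduced I = scale (small_elt I / of_int (idnorm I)) (cj ` I)"

lemma small_elt_ZK: "zideal I \<Longrightarrow> small_elt I \<in> ZK" and small_elt_KK: "zideal I \<Longrightarrow> small_elt I \<in> KK"
  using small_elt(1) zidealD by blast+

lemma prd_reduced:
  assumes "zideal I"
  shows "prd (reduced I) I = scale (small_elt I) ZK"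
  using idnorm_pos[OF assms] prd_cj[OF assms]
  by (simp add: reduced_def prd_scale prd_commute[of "cj ` I"] scale_scale)

lemma zideal_reduced:
  assumes "zideal I"
  shows "zideal (reduced I)"
proof -
  define \<alpha> n where "\<alpha> = small_elt I" and "n = idnorm I"
  have n: "n > 0" using idnorm_pos[OF assms] by (simp add: n_def)
  have zm: "zmodule (reduced I)"
    unfolding reduced_def using assms
    by (intro zmodule_scale zmodule_cj zidealD(1) KK_divide small_elt_KK Rats_KK) auto
  \<comment> \<open>As \<alpha> lies in \<open>I\<close>, the product \<alpha> y lies in
    \<open>I\<close> times its conjugate, all of whose elements are divisible by
    \<open>n\<close>.\<close>
  have "\<alpha> / of_int n * y \<in> ZK" if y: "y \<in> cj ` I" for y
  proof -
    have "\<alpha> * y \<in> scale (of_int n) ZK"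
      using prd_I[OF small_elt(1)[OF assms] y] prd_cj[OF assms] by (simp add: \<alpha>_def n_def)
    then obtain z where "z \<in> ZK" "\<alpha> * y = of_int n * z" by (auto simp: scale_def)
    then show ?thesis using n by (simp add: field_simps)
  qed
  then have "reduced I \<subseteq> ZK" by (auto simp: reduced_def scale_def \<alpha>_def n_def)
  moreover obtain x where x: "x \<in> cj ` I" "x \<noteq> 0" using zidealD(4)[OF zideal_cj[OF assms]] by blast
  ultimately show ?thesis
    using n small_elt(2)[OF assms] zm
    by (intro zidealI[of _ "\<alpha> / of_int n * x"]) (auto simp: reduced_def scale_def \<alpha>_def n_def)
qed

text \<open>Multiplying \<open>reduced I\<close> by its conjugate expresses its norm through that of
  \<alpha>. Absolute values appear because an ideal determines an integer generator only up to sign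
  and the norm of \<alpha> may be negative.\<close>

lemma idnorm_reduced:
  assumes "zideal I"
  shows "of_int (idnorm (reduced I)) * of_int (idnorm I) = \<bar>small_elt I\<bar> * \<bar>cj (small_elt I)\<bar>"
proof -
  define \<alpha> n m where "\<alpha> = small_elt I" and "n = idnorm I" and "m = idnorm (reduced I)"
  have n: "n > 0" using idnorm_pos[OF assms] by (simp add: n_def)
  have m: "m > 0" using idnorm_pos[OF zideal_reduced[OF assms]] by (simp add: m_def)
  have aK: "\<alpha> \<in> KK" "\<alpha> \<in> ZK" using small_elt_KK small_elt_ZK assms by (auto simp: \<alpha>_def)
  obtain w where w: "\<alpha> * cj \<alpha> = of_int w" using norm_Ints[OF aK(2)] by (auto elim: Ints_cases)
  have IK: "I \<subseteq> KK" "cj ` I \<subseteq> KK" using zidealD(3) assms zideal_cj by blast+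
  have "cj ` reduced I = scale (cj \<alpha> / of_int n) I"
    using aK IK by (simp add: reduced_def cj_scale cj_divide KK_divide Rats_KK cj_cj_image \<alpha>_def n_def)
  then have "scale (of_int m) ZK = scale (\<alpha> / of_int n * (cj \<alpha> / of_int n)) (prd (cj ` I) I)"
    using prd_cj[OF zideal_reduced[OF assms]]
    by (simp add: reduced_def prd_scale prd_scale_right scale_scale \<alpha>_def n_def m_def mult.commute)
  also have "prd (cj ` I) I = scale (of_int n) ZK" using prd_cj[OF assms] by (simp add: prd_commute n_def)
  also have "scale (\<alpha> / of_int n * (cj \<alpha> / of_int n)) (scale (of_int n) ZK) = scale (of_int w / of_int n) ZK"
    using n by (simp add: scale_scale flip: w)
  finally have "scale (of_int n) (scale (of_int m) ZK) = scale (of_int n) (scale (of_int w / of_int n) ZK)" by simp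
  then have "scale (of_int (n * m)) ZK = scale (of_int w) ZK" using n by (simp add: scale_scale)
  then have "w dvd n * m" "n * m dvd w" using scale_of_int_subset_imp_dvd by blast+
  then have "\<bar>w\<bar> = \<bar>n * m\<bar>" by (metis zdvd_antisym_abs)
  then have "real_of_int \<bar>w\<bar> = of_int (n * m)" using n m by simp
  then show ?thesis using w by (simp add: \<alpha>_def n_def m_def mult.commute abs_mult[symmetric])
qed

text \<open>With the common reduced ideal \<open>J\<close>, both sides equal
  \<open>J I1 I2\<close>.\<close>

lemma scale_small_elt_cong:
  assumes "zideal I1" "zideal I2" "reduced I1 = reduced I2"
  shows "scale (small_elt I1) I2 = scale (small_elt I2) I1"
proof -
  have "scale (small_elt I1) I2 = prd (prd (reduced I1) I1) I2"
    using assms(1,2) by (simp add: prd_reduced prd_scale ZK_prd zidealD(1))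
  also have "\<dots> = prd (prd (reduced I2) I2) I1" unfolding assms(3) by (simp only: prd_ac)
  also have "\<dots> = scale (small_elt I2) I1"
    using assms(1,2) by (simp add: prd_reduced prd_scale ZK_prd zidealD(1))
  finally show ?thesis .
qed

lemma cls_eq_if_reduced_eq:
  assumes "zideal I1" "zideal I2" "reduced I1 = reduced I2"
  shows "cls I1 = cls I2"
proof -
  have "cls I1 = cls (scale (small_elt I2) I1)" "cls I2 = cls (scale (small_elt I1) I2)"
    using assms cls_scale[OF zideal_fractional] small_elt_KK small_elt(2) by auto
  then show ?thesis using scale_small_elt_cong[OF assms] by simp
qed

text \<open>The normalisation makes the product of the two sizes equal to the norm of the reduced
  ideal, so either size determines the other once that ideal is known.\<close>

definition size1 :: "real set \<Rightarrow> real" where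
  "size1 I = \<bar>small_elt I\<bar> / sqrt (of_int (idnorm I))"

definition size2 :: "real set \<Rightarrow> real" where
  "size2 I = \<bar>cj (small_elt I)\<bar> / sqrt (of_int (idnorm I))"

lemma sizes:
  assumes "zideal I"
  shows "size1 I > 0" "size2 I > 0" "size1 I \<le> sqrt (4 * rt)" "size2 I \<le> sqrt (4 * rt)"
    "size1 I * size2 I = of_int (idnorm (reduced I))"
proof -
  have n: "idnorm I > 0" by (rule idnorm_pos[OF assms])
  have c: "cj (small_elt I) \<noteq> 0" using small_elt(2)[OF assms] small_elt_KK[OF assms] by (simp add: cj_eq_0_iff)
  show "size1 I > 0" "size2 I > 0" using n c small_elt(2)[OF assms] by (auto simp: size1_def size2_def)
  have s: "2 * sqrt (of_int (idnorm I) * rt) = sqrt (4 * rt) * sqrt (of_int (idnorm I))"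
    by (simp add: real_sqrt_mult)
  show "size1 I \<le> sqrt (4 * rt)" "size2 I \<le> sqrt (4 * rt)"
    using small_elt(3,4)[OF assms] n unfolding s size1_def size2_def by (simp_all add: pos_divide_le_eq)
  have "size1 I * size2 I = \<bar>small_elt I\<bar> * \<bar>cj (small_elt I)\<bar> / of_int (idnorm I)"
    using n by (simp add: size1_def size2_def)
  then show "size1 I * size2 I = of_int (idnorm (reduced I))"
    unfolding idnorm_reduced[OF assms, symmetric] using n by simp
qed

text \<open>A fixed choice of normal form; equal parameters recover equal ideals.\<close>

definition params :: "real set \<Rightarrow> int \<times> int \<times> int" where
  "params J = (SOME (g, a, b). lat_params g a b \<and> J = lat g a b)"

lemma params:
  assumes "zideal J" "params J = (g, a, b)"
  shows "lat_params g a b" "J = lat g a b"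
proof -
  have "\<exists>p. case p of (g, a, b) \<Rightarrow> lat_params g a b \<and> J = lat g a b" using zideal_eq_lat[OF assms(1)] by auto
  from someI_ex[OF this] show "lat_params g a b" "J = lat g a b"
    using assms(2) unfolding params_def by auto
qed

definition cell :: "real set \<Rightarrow> nat \<times> nat \<times> int \<times> int" where
  "cell I = (case params (reduced I) of (g, a, b) \<Rightarrow> (nat g, nat a, b, \<lfloor>ln (size1 I)\<rfloor>))"

lemma cell_in_cells:
  assumes "zideal I"
  shows "cell I \<in> cells (4 * rt)"
proof -
  obtain g a b where gab: "params (reduced I) = (g, a, b)" by (cases "params (reduced I)") auto
  note p = params[OF zideal_reduced[OF assms] gab]
  have g: "g > 0" "a > 0" "0 \<le> b" "b < a" "a dvd qf b" using p(1) by (auto simp: lat_params_def)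
  define X where "X = 4 * rt"
  have X: "X \<ge> 1" using rt_ge_1 by (simp add: X_def)
  note sz = sizes[OF assms, folded X_def]
  define m where "m = idnorm (reduced I)"
  have m: "m = g\<^sup>2 * a" using idnorm_lat[of g a b] p zideal_reduced[OF assms] by (simp add: m_def)
  have m0: "m > 0" using g by (simp add: m)
  have xy: "size1 I * size2 I = of_int m" using sz by (simp add: m_def)
  have "size1 I * size2 I \<le> sqrt X * sqrt X" using sz X by (intro mult_mono) auto
  then have mX: "of_int m \<le> X" using X xy by simp
  have "g * 1 \<le> g * (g * a)" using g by (intro mult_left_mono) (auto simp: int_one_le_iff_zero_less)
  then have "g \<le> m" by (simp add: m power2_eq_square mult.assoc)
  then have gX: "of_int g \<le> X" using mX by linarith
  have aX: "of_int a \<le> X / (of_int g)\<^sup>2" using mX g by (simp add: m field_simps)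
  have "ln (size1 I) \<le> ln (sqrt X)" using sz X by (subst ln_le_cancel_iff) auto
  then have up: "ln (size1 I) \<le> ln X / 2" using X by (simp add: ln_sqrt)
  \<comment> \<open>The upper bound for the second size becomes a lower bound for the first, since
    their product is \<open>m\<close>.\<close>
  have "ln (size2 I) \<le> ln (sqrt X)" using sz X by (subst ln_le_cancel_iff) auto
  moreover have "ln (of_int m) = ln (size1 I) + ln (size2 I)" unfolding xy[symmetric] using sz(1,2) by (rule ln_mult_pos)
  ultimately have lo: "ln (of_int m) - ln X / 2 \<le> ln (size1 I)" using X by (simp add: ln_sqrt)
  have rg: "(real (nat g))\<^sup>2 * real (nat a) = of_int m" using g by (simp add: m)
  have "nat g \<in> {1..nat \<lfloor>X\<rfloor>}" using g gX by (auto simp: le_floor_iff nat_mono)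
  moreover have "nat a \<in> {1..nat \<lfloor>X / (real (nat g))\<^sup>2\<rfloor>}" using g aX by (auto simp: le_floor_iff nat_mono)
  moreover have "b \<in> qf_roots (nat a)" using g by (simp add: qf_roots_def)
  moreover have "\<lfloor>ln (size1 I)\<rfloor> \<in> {\<lfloor>ln ((real (nat g))\<^sup>2 * real (nat a)) - ln X / 2\<rfloor>..\<lfloor>ln X / 2\<rfloor>}"
    unfolding rg using lo up by (auto intro: floor_mono)
  ultimately show ?thesis unfolding cell_def cells_def gab X_def[symmetric] prod.case
    by (intro SigmaI)
qed

lemma reduced_eq_if_cell_eq:
  assumes "zideal I1" "zideal I2" "cell I1 = cell I2"
  shows "reduced I1 = reduced I2"
proof -
  obtain g a b where 1: "params (reduced I1) = (g, a, b)" by (cases "params (reduced I1)") auto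
  obtain g' a' b' where 2: "params (reduced I2) = (g', a', b')" by (cases "params (reduced I2)") auto
  note p = params[OF zideal_reduced[OF assms(1)] 1] params[OF zideal_reduced[OF assms(2)] 2]
  have "nat g = nat g'" "nat a = nat a'" "b = b'" using assms(3) by (auto simp: cell_def 1 2)
  then have "g = g'" "a = a'" using p(1,3) by (auto simp: lat_params_def)
  then show ?thesis using p \<open>b = b'\<close> by simp
qed

text \<open>Logarithms with equal floors differ by less than 1, whence the factor e.\<close>

lemma size1_le_if_cell_eq:
  assumes "zideal I1" "zideal I2" "cell I1 = cell I2"
  shows "size1 I1 \<le> exp 1 * size1 I2"
proof -
  have "\<lfloor>ln (size1 I1)\<rfloor> = \<lfloor>ln (size1 I2)\<rfloor>"
    using assms(3) by (auto simp: cell_def split: prod.splits)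
  then have "ln (size1 I1) \<le> 1 + ln (size1 I2)" by linarith
  then have "exp (ln (size1 I1)) \<le> exp (1 + ln (size1 I2))" by simp
  then show ?thesis using sizes(1) assms by (simp add: exp_add)
qed

text \<open>The product of the sizes is the same for both ideals, so the comparison of the first
  sizes with the ideals exchanged bounds the second.\<close>

lemma size2_le_if_cell_eq:
  assumes "zideal I1" "zideal I2" "cell I1 = cell I2"
  shows "size2 I1 \<le> exp 1 * size2 I2"
proof -
  define m where "m = real_of_int (idnorm (reduced I1))"
  have e: "size1 I1 * size2 I1 = m" "size1 I2 * size2 I2 = m"
    using sizes(5) assms reduced_eq_if_cell_eq[OF assms] by (auto simp: m_def)
  have p: "size1 I1 > 0" "size2 I1 > 0" "size1 I2 > 0" "size2 I2 > 0" using sizes assms by auto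
  have "size1 I2 \<le> exp 1 * size1 I1" using size1_le_if_cell_eq[of I2 I1] assms by simp
  then have "size1 I2 * size2 I2 \<le> exp 1 * size1 I1 * size2 I2" using p by (intro mult_right_mono) auto
  then have "size1 I1 * size2 I1 \<le> size1 I1 * (exp 1 * size2 I2)" using e by (simp add: mult_ac)
  then show ?thesis using p by simp
qed

text \<open>The cell of a representative determines its reduced ideal and thereby its class.\<close>

lemma finite_class_group: "finite (carrier (class_group d))"
proof -
  define rep where "rep c = (SOME I. zideal I \<and> cls I = c)" for c
  have rep: "zideal (rep c) \<and> cls (rep c) = c" if "c \<in> carrier (class_group d)" for c
    unfolding rep_def by (rule someI_ex[OF class_group_zideal_rep[OF that]])
  have "inj_on (\<lambda>c. cell (rep c)) (carrier (class_group d))"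
    using rep cls_eq_if_reduced_eq reduced_eq_if_cell_eq by (metis (no_types, lifting) inj_onI)
  moreover have "(\<lambda>c. cell (rep c)) ` carrier (class_group d) \<subseteq> cells (4 * rt)"
    using rep cell_in_cells by blast
  ultimately show ?thesis using finite_cells inj_on_finite by blast
qed

text \<open>The coordinates are half the sum and half the difference of the two conjugates.\<close>

lemma KK_coords_bound:
  assumes "\<beta> \<in> KK" "\<bar>\<beta>\<bar> \<le> W" "\<bar>cj \<beta>\<bar> \<le> W"
  shows "\<exists>u\<in>\<rat>. \<exists>v\<in>\<rat>. \<beta> = u + v * rt \<and> \<bar>u\<bar> \<le> W \<and> \<bar>v\<bar> \<le> W / rt"
proof -
  obtain u v where uv: "u \<in> \<rat>" "v \<in> \<rat>" "\<beta> = u + v * rt" using assms(1) KK_E by blast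
  have c: "cj \<beta> = u - v * rt" using uv cj_coords by simp
  have "\<bar>u\<bar> \<le> W" "\<bar>v * rt\<bar> \<le> W" using assms(2,3) unfolding c unfolding uv(3) by linarith+
  then have "\<bar>v\<bar> \<le> W / rt" using rt_ge_1 by (simp add: abs_mult field_simps)
  then show ?thesis using uv \<open>\<bar>u\<bar> \<le> W\<close> by blast
qed

lemma cell_collision:
  assumes P: "zideal P1" "zideal P2" and I: "zideal I"
    and Z: "of_int (idnorm P1) \<le> Z" "of_int (idnorm P2) \<le> Z"
    and eq: "cell (prd (P1 [^]\<^bsub>FI\<^esub> (l::nat)) I) = cell (prd (P2 [^]\<^bsub>FI\<^esub> l) I)"
  shows "\<exists>\<beta>\<in>ZK. scale \<beta> ZK = prd P1 (cj ` P2) [^]\<^bsub>FI\<^esub> l \<and>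
    \<bar>\<beta>\<bar> \<le> exp 1 * Z ^ l \<and> \<bar>cj \<beta>\<bar> \<le> exp 1 * Z ^ l"
proof -
  define A1 A2 where "A1 = P1 [^]\<^bsub>FI\<^esub> l" and "A2 = P2 [^]\<^bsub>FI\<^esub> l"
  have A: "zideal A1" "zideal A2" using P zideal_pow by (auto simp: A1_def A2_def)
  define I1 I2 where "I1 = prd A1 I" and "I2 = prd A2 I"
  have I12: "zideal I1" "zideal I2" using A I zideal_prd by (auto simp: I1_def I2_def)
  have ce: "cell I1 = cell I2" using eq by (simp add: I1_def I2_def A1_def A2_def)
  define a1 a2 where "a1 = small_elt I1" and "a2 = small_elt I2"
  have a: "a1 \<noteq> 0" "a2 \<noteq> 0" "a1 \<in> KK" "a2 \<in> KK" "cj a1 \<noteq> 0" "cj a2 \<noteq> 0"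
    using small_elt(2) small_elt_KK I12 by (auto simp: a1_def a2_def cj_eq_0_iff)
  define c where "c = idnorm I"
  define N1 N2 where "N1 = idnorm A1" and "N2 = idnorm A2"
  have pos: "c > 0" "N1 > 0" "N2 > 0" using idnorm_pos A I by (auto simp: c_def N1_def N2_def)
  have n12: "idnorm I1 = N1 * c" "idnorm I2 = N2 * c"
    using idnorm_prd A I by (auto simp: I1_def I2_def N1_def N2_def c_def)
  define \<beta> where "\<beta> = a1 / a2 * of_int N2"
  have bK: "\<beta> \<in> KK" unfolding \<beta>_def using a KK_divide KK_mult(1) Rats_KK[OF Rats_of_int] by blast
  have cb: "cj \<beta> = cj a1 / cj a2 * of_int N2" unfolding \<beta>_def
    using a by (simp add: KK_mult KK_divide Rats_KK cj_divide)
  have "scale a1 I2 = scale a2 I1"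
    using scale_small_elt_cong[OF I12 reduced_eq_if_cell_eq[OF I12 ce]] by (simp add: a1_def a2_def)
  \<comment> \<open>Multiplication by the conjugate of \<open>I\<close> replaces the common factor
    \<open>I\<close> by its norm \<open>c\<close>, which cancels.\<close>
  then have "prd (scale a1 I2) (cj ` I) = prd (scale a2 I1) (cj ` I)" by simp
  then have "scale (of_int c) (scale a1 A2) = scale (of_int c) (scale a2 A1)"
    using prd_cj[OF I] A
    by (simp add: I1_def I2_def prd_scale prd_assoc prd_scale_right prd_ZK zidealD(1) scale_scale mult.commute c_def)
  then have "scale a1 A2 = scale a2 A1" using pos scale_cancel[of "of_int c"] by simp
  \<comment> \<open>Likewise the conjugate of \<open>A2\<close> turns \<open>A2\<close> into its
    norm \<open>N2\<close>, so that \<beta> generates \<open>A1\<close> times the conjugate of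
    \<open>A2\<close>.\<close>
  then have "prd (scale a1 A2) (cj ` A2) = prd (scale a2 A1) (cj ` A2)" by simp
  then have "scale (a1 * of_int N2) ZK = scale a2 (prd A1 (cj ` A2))"
    using prd_cj[OF A(2)] by (simp add: prd_scale scale_scale N2_def)
  then have "scale (1 / a2) (scale (a1 * of_int N2) ZK) = scale (1 / a2) (scale a2 (prd A1 (cj ` A2)))" by simp
  then have "scale \<beta> ZK = prd A1 (cj ` A2)" using a by (simp add: scale_scale \<beta>_def)
  also have "\<dots> = prd P1 (cj ` P2) [^]\<^bsub>FI\<^esub> l"
    using P by (simp add: A1_def A2_def prd_pow cj_pow zideal_cj)
  finally have ideal: "scale \<beta> ZK = prd P1 (cj ` P2) [^]\<^bsub>FI\<^esub> l" .
  have "\<beta> \<in> scale \<beta> ZK" by (auto simp: scale_def intro!: image_eqI[of _ _ 1])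
  moreover have "scale \<beta> ZK \<subseteq> ZK" unfolding ideal by (intro zidealD(2) zideal_pow zideal_prd zideal_cj P)
  ultimately have bZ: "\<beta> \<in> ZK" by blast
  have NZ: "of_int N1 \<le> Z ^ l" "of_int N2 \<le> Z ^ l"
    using Z idnorm_pos[OF P(1)] idnorm_pos[OF P(2)] P
    by (auto simp: N1_def N2_def A1_def A2_def idnorm_pow intro!: power_mono)
  have "\<bar>a1\<bar> / sqrt (of_int N1 * of_int c) \<le> exp 1 * (\<bar>a2\<bar> / sqrt (of_int N2 * of_int c))"
    using size1_le_if_cell_eq[OF I12 ce] by (simp add: size1_def n12 a1_def a2_def)
  then have "\<bar>a1\<bar> / \<bar>a2\<bar> * of_int N2 \<le> exp 1 * Z ^ l"
    using NZ pos a by (intro ratio_bound[of _ "of_int N1" _ "of_int c"]) auto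
  then have b1: "\<bar>\<beta>\<bar> \<le> exp 1 * Z ^ l" using pos by (simp add: \<beta>_def abs_mult)
  have "\<bar>cj a1\<bar> / sqrt (of_int N1 * of_int c) \<le> exp 1 * (\<bar>cj a2\<bar> / sqrt (of_int N2 * of_int c))"
    using size2_le_if_cell_eq[OF I12 ce] by (simp add: size2_def n12 a1_def a2_def)
  then have "\<bar>cj a1\<bar> / \<bar>cj a2\<bar> * of_int N2 \<le> exp 1 * Z ^ l"
    using NZ pos a by (intro ratio_bound[of _ "of_int N1" _ "of_int c"]) auto
  then have b2: "\<bar>cj \<beta>\<bar> \<le> exp 1 * Z ^ l" using pos by (simp add: cb abs_mult)
  show ?thesis using bZ ideal b1 b2 by blast
qed

section \<open>Elements of \<open>S_set\<close> and the final count\<close>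

lemma split_primes_zprime:
  assumes "P \<in> split_primes d Z"
  shows "zprime P" "zideal P" "of_int (idnorm P) \<le> Z"
proof -
  show 1: "zprime P" using assms primeideal_imp_zprime by (auto simp: split_primes_def)
  then show 2: "zideal P" by (simp add: zprime_def)
  have "real_of_int (idnorm P) = real (ideal_norm d P)"
    using ideal_norm_eq_idnorm[OF 2] by (metis of_int_of_nat_eq)
  then show "of_int (idnorm P) \<le> Z" using assms by (simp add: split_primes_def)
qed

lemma S_set_I:
  assumes P: "P1 \<in> split_primes d Z" "P2 \<in> split_primes d Z" "P1 \<noteq> P2"
    and b: "\<beta> \<in> ZK" "scale \<beta> ZK = prd P1 (cj ` P2) [^]\<^bsub>FI\<^esub> l"
    "\<bar>\<beta>\<bar> \<le> exp 1 * Z ^ l" "\<bar>cj \<beta>\<bar> \<le> exp 1 * Z ^ l"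
  shows "\<beta> \<in> S_set l d Z"
proof -
  define W where "W = 2 * exp (3/2) * Z ^ l"
  have "Z \<ge> 0" using split_primes_zprime(2,3)[OF P(1)] idnorm_pos[of P1] by linarith
  \<comment> \<open>The factor e from the unit interval of a cell is within the permitted 2
    e^(3/2).\<close>
  then have "exp 1 * Z ^ l \<le> W" unfolding W_def
    by (intro mult_right_mono) (auto intro: order_trans[of _ "exp (3/2)"])
  then have W: "\<bar>\<beta>\<bar> \<le> W" "\<bar>cj \<beta>\<bar> \<le> W" using b by linarith+
  obtain u v where uv: "u \<in> \<rat>" "v \<in> \<rat>" "\<beta> = u + v * rt" "\<bar>u\<bar> \<le> W" "\<bar>v\<bar> \<le> W / rt"
    using KK_coords_bound[OF ZK_KK[OF b(1)] W] by blast
  have "W / rt = W * real_of_int d powr (-1/2)"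
    using d_gt_1 by (simp add: rt_def powr_minus_divide powr_half_sqrt)
  then have "\<bar>v\<bar> \<le> W * real_of_int d powr (-1/2)" using uv(5) by simp
  then show ?thesis
    using uv b P unfolding S_set_def W_def rt_def
    by (auto simp: PIdl_eq ideals_set_pow ideal_prod_ring_of_integers)
qed

text \<open>An infinite set would have \<open>card\<close> equal to 0. Both conjugates are bounded,
  and \<beta> - \<sigma> \<beta> = y (2 \<open>om\<close> - \<open>tr\<close>) with a second factor
  of at least 1 bounds \<open>y\<close>, after which \<open>x\<close> is bounded too.\<close>

lemma finite_S_set: "finite (S_set l d Z)"
proof -
  define B where "B = 2 * exp (3/2) * Z ^ l"
  define B2 where "B2 = 2 * exp (3/2) * Z ^ l * real_of_int d powr (-1/2)"
  define M where "M = \<lceil>\<bar>B\<bar> + \<bar>B2\<bar> * rt\<rceil>"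
  define f :: "int \<times> int \<Rightarrow> real" where "f = (\<lambda>(x, y). of_int x + of_int y * om)"
  define K where "K = \<lceil>2 * of_int M * (1 + rt)\<rceil>"
  have "S_set l d Z \<subseteq> f ` ({-K..K} \<times> {-2 * M..2 * M})"
  proof
    fix \<beta> assume "\<beta> \<in> S_set l d Z"
    then obtain u v where b: "\<beta> \<in> ZK" "u \<in> \<rat>" "v \<in> \<rat>" "\<beta> = u + v * rt" "\<bar>u\<bar> \<le> B" "\<bar>v\<bar> \<le> B2"
      by (auto simp: S_set_def rt_def B_def B2_def)
    have vr: "\<bar>v * rt\<bar> \<le> \<bar>B2\<bar> * rt" using b(6) rt_ge_1 by (simp add: abs_mult mult_right_mono)
    have cb: "cj \<beta> = u - v * rt" using b cj_coords by simp
    have bM: "\<bar>\<beta>\<bar> \<le> of_int M" "\<bar>cj \<beta>\<bar> \<le> of_int M"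
      using vr b(5) le_of_int_ceiling[of "\<bar>B\<bar> + \<bar>B2\<bar> * rt"] unfolding cb M_def unfolding b(4) by linarith+
    obtain x y where xy: "\<beta> = of_int x + of_int y * om" using b(1) by (auto simp: ZK_iff)
    have cxy: "cj \<beta> = of_int x + of_int y * (of_int tr - om)" unfolding xy by (rule cj_om_coords)
    have "2 * om - of_int tr \<ge> 1" using rt_ge_1 by (auto simp: om_def tr_def)
    then have "\<bar>real_of_int y\<bar> * 1 \<le> \<bar>real_of_int y\<bar> * \<bar>2 * om - of_int tr\<bar>" by (intro mult_left_mono) auto
    also have "\<dots> = \<bar>\<beta> - cj \<beta>\<bar>" unfolding cxy unfolding xy by (simp add: abs_mult[symmetric] algebra_simps)
    finally have "\<bar>real_of_int y\<bar> \<le> of_int (2 * M)" using bM by linarith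
    then have y: "\<bar>y\<bar> \<le> 2 * M" by linarith
    have "\<bar>of_int y * om\<bar> \<le> of_int (2 * M) * rt"
      using \<open>\<bar>real_of_int y\<bar> \<le> of_int (2 * M)\<close> om_bounds(1) by (simp only: abs_mult) (intro mult_mono, auto)
    then have "\<bar>real_of_int x\<bar> \<le> of_int M + of_int (2 * M) * rt" using bM(1) unfolding xy by linarith
    also have "\<dots> \<le> 2 * of_int M * (1 + rt)" using bM(1) by (simp add: algebra_simps)
    finally have x: "\<bar>x\<bar> \<le> K" unfolding K_def using le_of_int_ceiling[of "2 * of_int M * (1 + rt)"] by linarith
    show "\<beta> \<in> f ` ({-K..K} \<times> {-2 * M..2 * M})"
      using x y by (intro image_eqI[of _ _ "(x, y)"]) (auto simp: f_def xy)
  qed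
  then show ?thesis by (rule finite_subset) simp
qed

text \<open>For any other pair, \<open>Q1\<close> and the conjugate of \<open>Q2\<close> are both
  among \<open>P1\<close> and the conjugate of \<open>P2\<close>: two choices each.\<close>

lemma card_prime_pairs_le:
  assumes "l > 0"
  shows "card {(P1, P2). P1 \<in> split_primes d Z \<and> P2 \<in> split_primes d Z \<and>
    scale \<beta> ZK = prd P1 (cj ` P2) [^]\<^bsub>FI\<^esub> (l::nat)} \<le> 4" (is "card ?W \<le> 4")
proof (cases "?W = {}")
  case False
  then obtain P1 P2 where P: "(P1, P2) \<in> ?W" by auto
  have PS: "P1 \<in> split_primes d Z" "P2 \<in> split_primes d Z" using P by auto
  have Pz: "zprime P1" "zprime (cj ` P2)" "P1 \<subseteq> KK" "P2 \<subseteq> KK"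
    using split_primes_zprime(1)[OF PS(1)] zprime_cj[OF split_primes_zprime(1)[OF PS(2)]]
      zidealD(3)[OF split_primes_zprime(2)[OF PS(1)]] zidealD(3)[OF split_primes_zprime(2)[OF PS(2)]] by blast+
  have "?W \<subseteq> {P1, cj ` P2} \<times> {P2, cj ` P1}"
  proof
    fix Q assume "Q \<in> ?W"
    then obtain Q1 Q2 where Q: "Q = (Q1, Q2)" "(Q1, Q2) \<in> ?W" by auto
    have QS: "Q1 \<in> split_primes d Z" "Q2 \<in> split_primes d Z" using Q by auto
    have Qz: "zprime Q1" "zprime (cj ` Q2)" "Q2 \<subseteq> KK"
      using split_primes_zprime(1)[OF QS(1)] zprime_cj[OF split_primes_zprime(1)[OF QS(2)]]
        zidealD(3)[OF split_primes_zprime(2)[OF QS(2)]] by blast+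
    have e: "prd P1 (cj ` P2) [^]\<^bsub>FI\<^esub> l = prd Q1 (cj ` Q2) [^]\<^bsub>FI\<^esub> l" using P Q by auto
    have 1: "Q1 \<in> {P1, cj ` P2}" by (rule zprime_factors_of_power[OF Pz(1,2) Qz(1,2) e assms])
    have "prd P1 (cj ` P2) [^]\<^bsub>FI\<^esub> l = prd (cj ` Q2) Q1 [^]\<^bsub>FI\<^esub> l" using e by (simp add: prd_commute)
    then have "cj ` Q2 \<in> {P1, cj ` P2}" by (rule zprime_factors_of_power[OF Pz(1,2) Qz(2,1) _ assms])
    then have "cj ` cj ` Q2 \<in> {cj ` P1, cj ` cj ` P2}" unfolding insert_iff empty_iff by (elim disjE) simp_all
    then have "Q2 \<in> {P2, cj ` P1}" unfolding cj_cj_image[OF Qz(3)] cj_cj_image[OF Pz(4)] by blast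
    then show "Q \<in> {P1, cj ` P2} \<times> {P2, cj ` P1}" using 1 Q(1) by auto
  qed
  then have "card ?W \<le> card ({P1, cj ` P2} \<times> {P2, cj ` P1})" by (intro card_mono) auto
  also have "\<dots> \<le> 2 * 2" unfolding card_cartesian_product by (intro mult_le_mono) (auto simp: card_insert_if)
  finally show ?thesis by simp
next
  case True
  show ?thesis unfolding True by simp
qed

lemma torsion_bound_cells:
  fixes l :: nat
  assumes l: "l > 0" and pos: "card (split_primes d Z) > 0"
  shows "real (card (torsion l (class_group d))) * (real (card (split_primes d Z)))\<^sup>2
    \<le> real (card (cells (4 * rt))) * (real (card (split_primes d Z)) + 4 * real (card (S_set l d Z)))"
proof -
  interpret G: comm_group "class_group d" by (rule comm_group_class_group)
  define \<pi> where "\<pi> = split_primes d Z"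
  define S where "S = S_set l d Z"
  have fp: "finite \<pi>" using pos card_ge_0_finite by (auto simp: \<pi>_def)
  have fS: "finite S" by (simp add: S_def finite_S_set)
  obtain T where T: "T \<subseteq> carrier (class_group d)" "card T = card (torsion l (class_group d))"
    and T0: "\<forall>c\<in>T. \<forall>c'\<in>T. \<forall>x\<in>carrier (class_group d). \<forall>y\<in>carrier (class_group d).
      c \<otimes>\<^bsub>class_group d\<^esub> x [^]\<^bsub>class_group d\<^esub> l = c' \<otimes>\<^bsub>class_group d\<^esub> y [^]\<^bsub>class_group d\<^esub> l \<longrightarrow> c = c'"
    using G.torsion_transversal[OF finite_class_group, of l] by (elim exE conjE)
  have fT: "finite T" using T(1) finite_class_group finite_subset by blast
  define rep where "rep c = (SOME I. zideal I \<and> cls I = c)" for c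
  have rep: "zideal (rep c)" "cls (rep c) = c" if "c \<in> T" for c
    using someI_ex[OF class_group_zideal_rep[of c]] T(1) that unfolding rep_def by blast+
  define F where "F = (\<lambda>(c, P). cell (prd (P [^]\<^bsub>FI\<^esub> l) (rep c)))"
  have zi: "zideal (prd (P [^]\<^bsub>FI\<^esub> l) (rep c))" if "c \<in> T" "P \<in> \<pi>" for c P
    using that rep split_primes_zprime(2) by (auto simp: \<pi>_def intro!: zideal_prd zideal_pow)
  define W where "W \<beta> = {(P1, P2). P1 \<in> \<pi> \<and> P2 \<in> \<pi> \<and> scale \<beta> ZK = prd P1 (cj ` P2) [^]\<^bsub>FI\<^esub> l}" for \<beta>
  \<comment> \<open>The pairs of primes that can collide: the diagonal and those recorded by some
    \<beta> in \<open>S\<close>.\<close>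
  define D where "D = (\<lambda>P. (P, P)) ` \<pi> \<union> (\<Union>\<beta>\<in>S. W \<beta>)"
  have fW: "finite (W \<beta>)" for \<beta> by (rule finite_subset[of _ "\<pi> \<times> \<pi>"]) (auto simp: W_def fp)
  have "card D \<le> card ((\<lambda>P. (P, P)) ` \<pi>) + card (\<Union>\<beta>\<in>S. W \<beta>)" unfolding D_def by (rule card_Un_le)
  also have "card ((\<lambda>P. (P, P)) ` \<pi>) \<le> card \<pi>" using fp by (rule card_image_le)
  also have "card (\<Union>\<beta>\<in>S. W \<beta>) \<le> (\<Sum>\<beta>\<in>S. card (W \<beta>))" using fS by (rule card_UN_le)
  also have "\<dots> \<le> (\<Sum>\<beta>\<in>S. 4)"
    unfolding W_def \<pi>_def using card_prime_pairs_le[OF l] by (intro sum_mono) blast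
  finally have cD: "card D \<le> card \<pi> + 4 * card S" by simp
  define E where "E = {(p, q). p \<in> T \<times> \<pi> \<and> q \<in> T \<times> \<pi> \<and> F p = F q}"
  define j where "j = (\<lambda>(c, P1, P2). ((c, P1), (c, P2)) :: (real set set \<times> real set) \<times> (real set set \<times> real set))"
  \<comment> \<open>Colliding pairs share their first component, so a collision is given by one
    element of \<open>T\<close> and one of \<open>D\<close>.\<close>
  have "E \<subseteq> j ` (T \<times> D)"
  proof
    fix e assume "e \<in> E"
    then obtain c1 P1 c2 P2 where e: "e = ((c1, P1), (c2, P2))" "c1 \<in> T" "P1 \<in> \<pi>" "c2 \<in> T" "P2 \<in> \<pi>"
      and ce: "cell (prd (P1 [^]\<^bsub>FI\<^esub> l) (rep c1)) = cell (prd (P2 [^]\<^bsub>FI\<^esub> l) (rep c2))"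
      by (auto simp: E_def F_def)
    have fr: "fractional_ideal d P1" "fractional_ideal d P2"
      using e split_primes_zprime(2) zideal_fractional by (auto simp: \<pi>_def)
    have zP: "zideal P1" "zideal P2" using e split_primes_zprime(2) by (auto simp: \<pi>_def)
    have clsF: "cls (prd (P [^]\<^bsub>FI\<^esub> l) (rep c)) = c \<otimes>\<^bsub>class_group d\<^esub> cls P [^]\<^bsub>class_group d\<^esub> l"
      if "c \<in> T" "zideal P" for c P
    proof -
      have "cls (prd (P [^]\<^bsub>FI\<^esub> l) (rep c)) = cls (prd (rep c) (P [^]\<^bsub>FI\<^esub> l))" by (simp only: prd_commute)
      also have "\<dots> = cls (rep c) \<otimes>\<^bsub>class_group d\<^esub> cls (P [^]\<^bsub>FI\<^esub> l)"
        using that rep zideal_pow by (intro cls_prd zideal_fractional) auto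
      finally show ?thesis using that rep cls_pow[OF zideal_fractional] by simp
    qed
    have "cls (prd (P1 [^]\<^bsub>FI\<^esub> l) (rep c1)) = cls (prd (P2 [^]\<^bsub>FI\<^esub> l) (rep c2))"
      using e zi ce by (intro cls_eq_if_reduced_eq reduced_eq_if_cell_eq) auto
    \<comment> \<open>A common cell means a common ideal class; the two classes differ from
      \<open>c1\<close> and \<open>c2\<close> by powers with exponent \<open>l\<close>, and
      \<open>T\<close> separates classes modulo these.\<close>
    then have "c1 \<otimes>\<^bsub>class_group d\<^esub> cls P1 [^]\<^bsub>class_group d\<^esub> l = c2 \<otimes>\<^bsub>class_group d\<^esub> cls P2 [^]\<^bsub>class_group d\<^esub> l"
      using clsF e zP by simp
    then have c12: "c1 = c2" by (rule T0[rule_format, OF e(2,4) cls_in_class_group[OF fr(1)] cls_in_class_group[OF fr(2)]])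
    have "(P1, P2) \<in> D"
    proof (cases "P1 = P2")
      case True then show ?thesis using e by (auto simp: D_def)
    next
      case False
      obtain \<beta> where b: "\<beta> \<in> ZK" "scale \<beta> ZK = prd P1 (cj ` P2) [^]\<^bsub>FI\<^esub> l"
        "\<bar>\<beta>\<bar> \<le> exp 1 * Z ^ l" "\<bar>cj \<beta>\<bar> \<le> exp 1 * Z ^ l"
        using cell_collision[OF zP rep(1)[OF e(2)], of Z l] ce e split_primes_zprime(3) unfolding c12 \<pi>_def by blast
      then have "\<beta> \<in> S" unfolding S_def using e False by (intro S_set_I[of P1 Z P2]) (auto simp: \<pi>_def)
      then show ?thesis using b e by (auto simp: D_def W_def)
    qed
    then show "e \<in> j ` (T \<times> D)"
      using e c12 by (intro image_eqI[of _ _ "(c1, P1, P2)"]) (auto simp: j_def)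
  qed
  moreover have fD: "finite D" using fp fS fW by (auto simp: D_def)
  ultimately have "card E \<le> card (j ` (T \<times> D))" using fT by (intro card_mono) auto
  also have "\<dots> \<le> card (T \<times> D)" using fT fD by (intro card_image_le) auto
  also have "\<dots> \<le> card T * (card \<pi> + 4 * card S)" unfolding card_cartesian_product using cD by simp
  finally have "real (card E) \<le> real (card T * (card \<pi> + 4 * card S))" by (rule of_nat_mono)
  then have cE: "real (card E) \<le> real (card T) * (real (card \<pi>) + 4 * real (card S))" by simp
  have "(real (card (T \<times> \<pi>)))\<^sup>2 \<le> real (card (cells (4 * rt))) * real (card E)"
    unfolding E_def using fT fp zi cell_in_cells finite_cells
    by (intro card_square_le_collisions) (auto simp: F_def)
  also have "\<dots> \<le> real (card (cells (4 * rt))) * (real (card T) * (real (card \<pi>) + 4 * real (card S)))"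
    using cE by (intro mult_left_mono) auto
  finally have main: "real (card T) * (real (card T) * (real (card \<pi>))\<^sup>2) \<le>
      real (card T) * (real (card (cells (4 * rt))) * (real (card \<pi>) + 4 * real (card S)))"
    by (simp add: card_cartesian_product power2_eq_square mult_ac)
  \<comment> \<open>Cauchy-Schwarz gives the square of \<open>card T\<close> on the left while the
    collisions carry a single factor, so one factor cancels.\<close>
  have "real (card T) * (real (card \<pi>))\<^sup>2 \<le> real (card (cells (4 * rt))) * (real (card \<pi>) + 4 * real (card S))"
  proof (cases "card T = 0")
    case True then show ?thesis by simp
  next
    case False then show ?thesis using main by (simp add: mult_le_cancel_left)
  qed
  then show ?thesis using T(2) by (simp add: \<pi>_def S_def)
qed

lemma card_cells_le_sqrt_log: "real (card (cells (4 * rt))) \<le> 300 * (rt * ln (of_int d))"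
proof -
  have d2: "real_of_int d \<ge> 2" using d_gt_1 by linarith
  have "ln 2 \<le> ln (real_of_int d)" using d2 by simp
  then have ld: "ln (real_of_int d) \<ge> 1/2" using ln2_ge_two_thirds by linarith
  have "ln (4 * rt) = ln 4 + ln (real_of_int d) / 2" using d2 by (simp add: rt_def ln_mult ln_sqrt)
  moreover have "ln (4 :: real) \<le> 3" using ln_le_minus_one[of 4] by simp
  \<comment> \<open>The constant part is at most 4, hence at most 8 ln d because ln d \<ge> 1/2; the
    remaining half of ln d makes 17/2.\<close>
  ultimately have l4: "1 + ln (4 * rt) \<le> (17 / 2) * ln (real_of_int d)" using ld by linarith
  have "real (card (cells (4 * rt))) \<le> 8 * (4 * rt) * (1 + ln (4 * rt))"
    using rt_ge_1 by (intro card_cells_le) simp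
  also have "\<dots> \<le> 8 * (4 * rt) * ((17 / 2) * ln (real_of_int d))"
    using l4 rt_ge_1 by (intro mult_left_mono) auto
  \<comment> \<open>The product 8 * 4 * 17/2 is 272, rounded up.\<close>
  also have "\<dots> \<le> 300 * (rt * ln (of_int d))" using ld rt_ge_1 by simp
  finally show ?thesis .
qed

end

theorem theorem2p1:
  shows "\<exists>C::real. C > 0 \<and>
    (\<forall>(l::nat) (Z::real) (d::int).
       prime l \<longrightarrow> Z > 0 \<longrightarrow> squarefree d \<longrightarrow> d > 1 \<longrightarrow> card (split_primes d Z) > 0 \<longrightarrow>
       real (card (torsion l (class_group d))) \<le>
         C * (sqrt (real_of_int d) * ln (real_of_int d) / real (card (split_primes d Z))
            + sqrt (real_of_int d) * ln (real_of_int d) / (real (card (split_primes d Z)))\<^sup>2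
                * real (card (S_set l d Z))))"
proof (intro exI[of _ 1200] conjI allI impI)
  fix l :: nat and Z :: real and d :: int
  assume l: "prime l" and d: "squarefree d" "d > 1" and pos: "card (split_primes d Z) > 0"
  interpret real_quadratic d using d by unfold_locales
  define p s R where "p = real (card (split_primes d Z))" and "s = real (card (S_set l d Z))"
    and "R = sqrt (real_of_int d) * ln (real_of_int d)"
  have p: "p > 0" using pos by (simp add: p_def)
  have s: "s \<ge> 0" by (simp add: s_def)
  have R: "R \<ge> 0" using d by (simp add: R_def)
  have "real (card (torsion l (class_group d))) * p\<^sup>2 \<le> real (card (cells (4 * rt))) * (p + 4 * s)"
    using torsion_bound_cells[OF prime_gt_0_nat[OF l] pos] by (simp add: p_def s_def)
  \<comment> \<open>Here \<open>p + 4 * s\<close> is at most \<open>4 * (p + s)\<close>, and 300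
    times 4 is the constant 1200.\<close>
  also have "\<dots> \<le> (300 * R) * (4 * (p + s))"
    using card_cells_le_sqrt_log p s R by (intro mult_mono) (auto simp: R_def rt_def)
  finally have "real (card (torsion l (class_group d))) \<le> 1200 * R * (p + s) / p\<^sup>2"
    using p by (simp add: pos_le_divide_eq algebra_simps)
  also have "\<dots> = 1200 * (R / p + R / p\<^sup>2 * s)" using p by (simp add: field_simps power2_eq_square)
  finally show "real (card (torsion l (class_group d))) \<le>
         1200 * (sqrt (real_of_int d) * ln (real_of_int d) / real (card (split_primes d Z))
            + sqrt (real_of_int d) * ln (real_of_int d) / (real (card (split_primes d Z)))\<^sup>2
                * real (card (S_set l d Z)))"
    by (simp only: p_def s_def R_def)
qed simp

end
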